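(* Let $\Omega\subset\mathbb R^N$ be a bounded Lipschitz domain, $s\in(0,1)$, $A_s=I+(-\Delta)^s$ the positive self-adjoint operator associated with the fractional Dirichlet form on $H_0^s(\Omega)$, $K:H_0^s(\Omega)\to L^2(\Omega)$ bounded and linear, and $B:=KA_s^{-1/2}$. Let $u^\dagger\in H_0^s(\Omega)$, $\delta>0$, and $y^\delta=Ku^\dagger+\eta^\delta$, where the random noise $\eta^\delta$ (with values in $L^2(\Omega)$) satisfies $\mathbb E\|\eta^\delta\|_{L^2(\Omega)}^2\le\delta^2$. Suppose that $A_s^{1/2}u^\dagger=(B^*B)^\beta w$ for some $w\in L^2(\Omega)$ and $0<\beta\le1$. Choose $$\alpha=\delta^{\frac{2}{2\beta+1}}$$ and let $u_\alpha^\delta$ be the unique minimizer over $u\in H_0^s(\Omega)$ of $\frac12\|Ku-y^\delta\|_{L^2(\Omega)}^2+\frac\alpha2\|u\|_{H_0^s(\Omega)}^2$. Then $$\mathbb E\|u_\alpha^\delta-u^\dagger\|_{H_0^s(\Omega)}^2\le C_{\mathrm{opt}}\,\delta^{\frac{4\beta}{2\beta+1}},\qquad C_{\mathrm{opt}}=2c_\beta^2\|w\|_{L^2(\Omega)}^2+\frac12,$$ where $c_\beta=\beta^\beta(1-\beta)^{1-\beta}$ for $0<\beta<1$ and $c_1=1$. In particular, the estimator converges with order $\delta^{\frac{4\beta}{2\beta+1}}$ in the mean-square $H_0^s(\Omega)$-norm.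
   Context: All spaces are real. $H_0^s(\Omega)$ is the space of functions $u\in H^s(\mathbb R^N)$ with $u=0$ a.e. in $\mathbb R^N\setminus\Omega$ (also regarded as functions on $\Omega$). The fractional Dirichlet form is the closed, symmetric, coercive bilinear form on $H_0^s(\Omega)$ $$a_s(u,v)=\int_\Omega uv\,dx+\frac{C_{N,s}}{2}\iint_{\mathbb R^{2N}}\frac{(u(x)-u(y))(v(x)-v(y))}{|x-y|^{N+2s}}\,dx\,dy,$$ where $C_{N,s}>0$ is the standard normalization constant of the integral fractional Laplacian, $C_{N,s}=\frac{4^s s\,\Gamma(N/2+s)}{\pi^{N/2}\Gamma(1-s)}$. $H_0^s(\Omega)$ is a Hilbert space with norm $\|u\|_{H_0^s(\Omega)}^2=a_s(u,u)$. $A_s=I+(-\Delta)^s$ is the unique positive self-adjoint operator on $L^2(\Omega)$ associated with $a_s$; powers are defined by the spectral theorem. $A_s^{1/2}$ is an isometric isomorphism of $D(A_s^{1/2})=H_0^s(\Omega)$ onto $L^2(\Omega)$ with inverse $A_s^{-1/2}:L^2(\Omega)\to H_0^s(\Omega)$; thus $B$ is bounded on $L^2(\Omega)$, and $B^*$ is its adjoint. *)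

theory Defs
  imports "HOL-Probability.Probability" "HOL-Library.Landau_Symbols"
begin

section \<open>The Hilbert space of square integrable functions\<close>

definition sq_int :: "('a::euclidean_space \<Rightarrow> real) \<Rightarrow> bool" where
  "sq_int f \<longleftrightarrow> f \<in> borel_measurable lborel \<and> integrable lborel (\<lambda>x. (f x)\<^sup>2)"

definition sq_int_eq :: "('a::euclidean_space \<Rightarrow> real) \<Rightarrow> ('a \<Rightarrow> real) \<Rightarrow> bool" where
  "sq_int_eq f g \<longleftrightarrow> sq_int f \<and> sq_int g \<and> (AE x in lborel. f x = g x)"

lemma sq_int_0: "sq_int (\<lambda>x. 0)"
  by (simp add: sq_int_def)

lemma sq_int_mult_integrable:
  assumes "sq_int f" "sq_int g"
  shows "integrable lborel (\<lambda>x. f x * g x)"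
proof (rule Bochner_Integration.integrable_bound)
  show "integrable lborel (\<lambda>x. (f x)\<^sup>2 + (g x)\<^sup>2)"
    using assms by (auto simp: sq_int_def)
  show "(\<lambda>x. f x * g x) \<in> borel_measurable lborel"
    using assms by (auto simp: sq_int_def)
  have "\<bar>a * b\<bar> \<le> a\<^sup>2 + b\<^sup>2" for a b :: real
  proof -
    have "2 * (\<bar>a\<bar> * \<bar>b\<bar>) \<le> a\<^sup>2 + b\<^sup>2"
      using sum_squares_bound[of "\<bar>a\<bar>" "\<bar>b\<bar>"] by (simp add: mult.assoc)
    moreover have "0 \<le> \<bar>a\<bar> * \<bar>b\<bar>" by simp
    ultimately show ?thesis unfolding abs_mult by linarith
  qed
  then show "AE x in lborel. norm (f x * g x) \<le> norm ((f x)\<^sup>2 + (g x)\<^sup>2)"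
    by (intro AE_I2) (simp only: real_norm_def, rule order_trans[OF _ abs_ge_self], blast)
qed

lemma sq_int_add:
  assumes "sq_int f" "sq_int g"
  shows "sq_int (\<lambda>x. f x + g x)"
  using assms sq_int_mult_integrable[OF assms]
  by (auto simp: sq_int_def power2_sum mult.assoc)

lemma sq_int_scale:
  assumes "sq_int f"
  shows "sq_int (\<lambda>x. c * f x)"
  using assms by (auto simp: sq_int_def power_mult_distrib)

lemma sq_int_uminus:
  assumes "sq_int f"
  shows "sq_int (\<lambda>x. - f x)"
  using assms by (auto simp: sq_int_def)

lemma sq_int_diff:
  assumes "sq_int f" "sq_int g"
  shows "sq_int (\<lambda>x. f x - g x)"
  using sq_int_add[OF assms(1) sq_int_uminus[OF assms(2)]] by simp

quotient_type (overloaded) 'a L2 = "'a::euclidean_space \<Rightarrow> real" / partial: sq_int_eq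
proof (rule part_equivpI)
  show "\<exists>f :: 'a \<Rightarrow> real. sq_int_eq f f"
    using sq_int_0 by (auto simp: sq_int_eq_def)
  show "symp (sq_int_eq :: ('a \<Rightarrow> real) \<Rightarrow> _)"
    by (auto simp: symp_def sq_int_eq_def)
  show "transp (sq_int_eq :: ('a \<Rightarrow> real) \<Rightarrow> _)"
    unfolding transp_def sq_int_eq_def by (auto elim: AE_mp)
qed

instantiation L2 :: (euclidean_space) real_vector
begin

lift_definition zero_L2 :: "'a L2" is "\<lambda>x. 0"
  by (simp add: sq_int_eq_def sq_int_0)

lift_definition plus_L2 :: "'a L2 \<Rightarrow> 'a L2 \<Rightarrow> 'a L2" is "\<lambda>f g x. f x + g x"
  by (auto simp: sq_int_eq_def intro: sq_int_add)

lift_definition scaleR_L2 :: "real \<Rightarrow> 'a L2 \<Rightarrow> 'a L2" is "\<lambda>c f x. c * f x"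
  by (auto simp: sq_int_eq_def intro: sq_int_scale)

lift_definition uminus_L2 :: "'a L2 \<Rightarrow> 'a L2" is "\<lambda>f x. - f x"
  by (auto simp: sq_int_eq_def intro: sq_int_uminus)

lift_definition minus_L2 :: "'a L2 \<Rightarrow> 'a L2 \<Rightarrow> 'a L2" is "\<lambda>f g x. f x - g x"
  by (auto simp: sq_int_eq_def intro: sq_int_diff)

instance
proof
  fix u v w :: "'a L2" and a b :: real
  show "u + v + w = u + (v + w)"
    by transfer (auto simp: sq_int_eq_def add.assoc intro!: sq_int_add)
  show "u + v = v + u"
    by transfer (auto simp: sq_int_eq_def add.commute intro!: sq_int_add)
  show "0 + u = u"
    by transfer (auto simp: sq_int_eq_def)
  show "- u + u = 0"
    by transfer (auto simp: sq_int_eq_def sq_int_0)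
  show "u - v = u + - v"
    by transfer (auto simp: sq_int_eq_def intro!: sq_int_diff)
  show "a *\<^sub>R (u + v) = a *\<^sub>R u + a *\<^sub>R v"
    by transfer (auto simp: sq_int_eq_def distrib_left intro!: sq_int_add sq_int_scale)
  show "(a + b) *\<^sub>R u = a *\<^sub>R u + b *\<^sub>R u"
    by transfer (auto simp: sq_int_eq_def distrib_right intro!: sq_int_add sq_int_scale)
  show "a *\<^sub>R b *\<^sub>R u = (a * b) *\<^sub>R u"
    by transfer (auto simp: sq_int_eq_def mult.assoc intro!: sq_int_scale)
  show "1 *\<^sub>R u = u"
    by transfer (auto simp: sq_int_eq_def)
qed

end

instantiation L2 :: (euclidean_space) real_inner
begin

lift_definition inner_L2 :: "'a L2 \<Rightarrow> 'a L2 \<Rightarrow> real" is "\<lambda>f g. \<integral>x. f x * g x \<partial>lborel"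
  by (rule integral_cong_AE) (auto simp: sq_int_eq_def sq_int_def)

definition norm_L2 :: "'a L2 \<Rightarrow> real" where
  "norm_L2 u = sqrt (inner u u)"

definition dist_L2 :: "'a L2 \<Rightarrow> 'a L2 \<Rightarrow> real" where
  "dist_L2 u v = norm (u - v)"

definition sgn_L2 :: "'a L2 \<Rightarrow> 'a L2" where
  "sgn_L2 u = u /\<^sub>R norm u"

definition uniformity_L2 :: "('a L2 \<times> 'a L2) filter" where
  "uniformity_L2 = (INF e\<in>{0 <..}. principal {(u, v). dist u v < e})"

definition open_L2 :: "'a L2 set \<Rightarrow> bool" where
  "open_L2 U \<longleftrightarrow> (\<forall>u\<in>U. eventually (\<lambda>(u', v). u' = u \<longrightarrow> v \<in> U) uniformity)"

instance
proof
  fix u v w :: "'a L2" and a b :: real and U :: "'a L2 set"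
  show "inner u v = inner v u"
    by transfer (simp add: mult.commute)
  show "inner (u + v) w = inner u w + inner v w"
    by transfer (auto simp: sq_int_eq_def distrib_right sq_int_mult_integrable)
  show "inner (a *\<^sub>R u) v = a * inner u v"
    by transfer (simp add: mult.assoc)
  show "0 \<le> inner u u"
    by transfer simp
  show "inner u u = 0 \<longleftrightarrow> u = 0"
  proof transfer
    fix f :: "'a \<Rightarrow> real"
    assume "sq_int_eq f f"
    then have f: "sq_int f" by (simp add: sq_int_eq_def)
    have "(\<integral>x. f x * f x \<partial>lborel) = 0 \<longleftrightarrow> (AE x in lborel. f x * f x = 0)"
      by (rule integral_nonneg_eq_0_iff_AE[OF sq_int_mult_integrable[OF f f]]) simp
    then show "(\<integral>x. f x * f x \<partial>lborel) = 0 \<longleftrightarrow> sq_int_eq f (\<lambda>x. 0)"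
      using f by (simp add: sq_int_eq_def sq_int_0)
  qed
  show "norm u = sqrt (inner u u)"
    by (rule norm_L2_def)
  show "dist u v = norm (u - v)"
    by (rule dist_L2_def)
  show "sgn u = u /\<^sub>R norm u"
    by (rule sgn_L2_def)
  show "uniformity = (INF e\<in>{0 <..}. principal {(u :: 'a L2, v). dist u v < e})"
    by (rule uniformity_L2_def)
  show "open U \<longleftrightarrow> (\<forall>u\<in>U. eventually (\<lambda>(u', v). u' = u \<longrightarrow> v \<in> U) uniformity)"
    by (rule open_L2_def)
qed

end

text \<open>
  \<^term>\<open>rep_L2 u\<close> is an arbitrary representative of the class \<^term>\<open>u\<close>; everything below depends on
  it only up to null sets.  \<open>L\<^sup>2(\<Omega>)\<close> is identified, by extension by zero, with the closed subspace
  of \<open>L\<^sup>2(\<real>\<^sup>N)\<close> of functions vanishing almost everywhere outside \<open>\<Omega>\<close>; the norm and inner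
  product of \<open>L\<^sup>2(\<Omega>)\<close> are those of the ambient space.
\<close>

definition L2_on :: "'a::euclidean_space set \<Rightarrow> 'a L2 set" where
  "L2_on \<Omega> = {u. AE x in lborel. x \<notin> \<Omega> \<longrightarrow> rep_L2 u x = 0}"


section \<open>Bounded Lipschitz domains\<close>

text \<open>
  Near each boundary point, after a rotation taking \<open>e\<close> to the last coordinate direction, the set
  is the part of a ball lying below the graph of a Lipschitz function \<open>\<gamma>\<close> of the coordinates
  orthogonal to \<open>e\<close> (only the values of \<open>\<gamma>\<close> on the hyperplane orthogonal to \<open>e\<close> matter).
\<close>

definition lipschitz_boundary :: "'a::euclidean_space set \<Rightarrow> bool" where
  "lipschitz_boundary \<Omega> \<longleftrightarrow>
     (\<forall>p\<in>frontier \<Omega>. \<exists>r>0. \<exists>e. \<exists>\<gamma>::'a \<Rightarrow> real. \<exists>L. norm e = 1 \<and> L-lipschitz_on UNIV \<gamma> \<and>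
        \<Omega> \<inter> ball p r = {x \<in> ball p r. x \<bullet> e < \<gamma> (x - (x \<bullet> e) *\<^sub>R e)})"

definition bounded_lipschitz_domain :: "'a::euclidean_space set \<Rightarrow> bool" where
  "bounded_lipschitz_domain \<Omega> \<longleftrightarrow>
     \<Omega> \<noteq> {} \<and> open \<Omega> \<and> connected \<Omega> \<and> bounded \<Omega> \<and> lipschitz_boundary \<Omega>"


section \<open>The fractional Dirichlet form\<close>

text \<open>The value at \<open>x = y\<close> is irrelevant, as the diagonal is a null set.\<close>

definition gagliardo_kernel :: "real \<Rightarrow> 'a::euclidean_space \<Rightarrow> 'a \<Rightarrow> real" where
  "gagliardo_kernel s x y = 1 / norm (x - y) powr (real DIM('a) + 2 * s)"

definition Hs :: "real \<Rightarrow> 'a::euclidean_space L2 set" where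
  "Hs s = {u. integrable (lborel \<Otimes>\<^sub>M lborel)
              (\<lambda>(x, y). (rep_L2 u x - rep_L2 u y)\<^sup>2 * gagliardo_kernel s x y)}"

definition Hs0 :: "'a::euclidean_space set \<Rightarrow> real \<Rightarrow> 'a L2 set" where
  "Hs0 \<Omega> s = {u \<in> Hs s. AE x in lborel. x \<notin> \<Omega> \<longrightarrow> rep_L2 u x = 0}"

definition frac_const :: "nat \<Rightarrow> real \<Rightarrow> real" where
  "frac_const N s =
     4 powr s * s * Gamma (real N / 2 + s) / (pi powr (real N / 2) * Gamma (1 - s))"

definition frac_form :: "'a::euclidean_space set \<Rightarrow> real \<Rightarrow> 'a L2 \<Rightarrow> 'a L2 \<Rightarrow> real" where
  "frac_form \<Omega> s u v =
     (LINT x:\<Omega>|lborel. rep_L2 u x * rep_L2 v x) +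
     frac_const DIM('a) s / 2 *
       (\<integral>(x, y). (rep_L2 u x - rep_L2 u y) * (rep_L2 v x - rep_L2 v y) * gagliardo_kernel s x y
          \<partial>(lborel \<Otimes>\<^sub>M lborel))"

definition Hs0_norm :: "'a::euclidean_space set \<Rightarrow> real \<Rightarrow> 'a L2 \<Rightarrow> real" where
  "Hs0_norm \<Omega> s u = sqrt (frac_form \<Omega> s u u)"


section \<open>Operators on a closed subspace of a Hilbert space and their powers\<close>

text \<open>
  An operator on the Hilbert space \<open>H\<close> (a closed subspace of the ambient type), possibly only
  partially defined, is represented by its graph \<open>{(x, T x) | x \<in> D(T)} \<subseteq> H \<times> H\<close>.
  Composition \<open>S T\<close> is then the relation \<open>T O S\<close>.
\<close>

definition adjoint_op :: "'h::real_inner set \<Rightarrow> ('h \<times> 'h) set \<Rightarrow> ('h \<times> 'h) set" where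
  "adjoint_op H T = {(y, z). y \<in> H \<and> z \<in> H \<and> (\<forall>(x, x') \<in> T. x' \<bullet> y = x \<bullet> z)}"

definition form_op :: "'h::real_inner set \<Rightarrow> 'h set \<Rightarrow> ('h \<Rightarrow> 'h \<Rightarrow> real) \<Rightarrow> ('h \<times> 'h) set" where
  "form_op H V a = {(u, f). u \<in> V \<and> f \<in> H \<and> (\<forall>v\<in>V. a u v = f \<bullet> v)}"

definition orth_proj_on :: "'h::real_inner set \<Rightarrow> ('h \<Rightarrow> 'h) \<Rightarrow> bool" where
  "orth_proj_on H P \<longleftrightarrow>
     (\<forall>x\<in>H. P x \<in> H \<and> P (P x) = P x) \<and>
     (\<forall>x\<in>H. \<forall>y\<in>H. \<forall>c. P (x + y) = P x + P y \<and> P (c *\<^sub>R x) = c *\<^sub>R P x) \<and>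
     (\<forall>x\<in>H. \<forall>y\<in>H. P x \<bullet> y = x \<bullet> P y)"

definition projection_valued_measure :: "'h::real_inner set \<Rightarrow> (real set \<Rightarrow> 'h \<Rightarrow> 'h) \<Rightarrow> bool" where
  "projection_valued_measure H E \<longleftrightarrow>
     (\<forall>A\<in>sets borel. orth_proj_on H (E A)) \<and>
     (\<forall>x\<in>H. E UNIV x = x) \<and>
     (\<forall>A::nat \<Rightarrow> real set. range A \<subseteq> sets borel \<and> disjoint_family A \<longrightarrow>
        (\<forall>x\<in>H. (\<lambda>n. E (A n) x) sums E (\<Union>n. A n) x))"

definition spectral_dist :: "(real set \<Rightarrow> 'h \<Rightarrow> 'h) \<Rightarrow> 'h::real_inner \<Rightarrow> real measure" where
  "spectral_dist E x = measure_of UNIV (sets borel) (\<lambda>A. ennreal (E A x \<bullet> x))"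

definition spectral_dom ::
  "'h::real_inner set \<Rightarrow> (real set \<Rightarrow> 'h \<Rightarrow> 'h) \<Rightarrow> (real \<Rightarrow> real) \<Rightarrow> 'h set" where
  "spectral_dom H E f = {x \<in> H. integrable (spectral_dist E x) (\<lambda>t. (f t)\<^sup>2)}"

text \<open>
  The graph of \<open>\<integral> f dE\<close>.  It consists of the pairs \<open>(x, y)\<close> with \<open>x\<close> in the domain and
  \<open>\<langle>y, z\<rangle> = \<integral> f d\<langle>E x, z\<rangle>\<close> for all \<open>z\<close> in the (dense) domain, where the signed measure
  \<open>\<langle>E x, z\<rangle>\<close> is written by polarization as \<open>(\<langle>E(x+z), x+z\<rangle> - \<langle>E(x-z), x-z\<rangle>) / 4\<close>.
\<close>

definition spectral_integral ::
  "'h::real_inner set \<Rightarrow> (real set \<Rightarrow> 'h \<Rightarrow> 'h) \<Rightarrow> (real \<Rightarrow> real) \<Rightarrow> ('h \<times> 'h) set" where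
  "spectral_integral H E f =
     {(x, y). x \<in> spectral_dom H E f \<and> y \<in> H \<and>
        (\<forall>z\<in>spectral_dom H E f.
           y \<bullet> z = ((\<integral>t. f t \<partial>spectral_dist E (x + z)) - (\<integral>t. f t \<partial>spectral_dist E (x - z))) / 4)}"

definition spectral_measure_of ::
  "'h::real_inner set \<Rightarrow> ('h \<times> 'h) set \<Rightarrow> (real set \<Rightarrow> 'h \<Rightarrow> 'h) \<Rightarrow> bool" where
  "spectral_measure_of H T E \<longleftrightarrow>
     projection_valued_measure H E \<and> T = spectral_integral H E (\<lambda>t. t)"

text \<open>
  The power \<open>T\<^sup>p = \<integral> t\<^sup>p dE(t)\<close> of a nonnegative self-adjoint operator \<open>T\<close> (injective if
  \<open>p < 0\<close>).  By the spectral theorem the spectral measure \<open>E\<close> of \<open>T\<close> exists and is unique on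
  Borel sets.  The convention \<^term>\<open>0 powr p = 0\<close> gives the right value on the kernel for \<open>p > 0\<close>,
  and the values at negative \<open>t\<close> are irrelevant.
\<close>

definition op_power :: "'h::real_inner set \<Rightarrow> ('h \<times> 'h) set \<Rightarrow> real \<Rightarrow> ('h \<times> 'h) set" where
  "op_power H T p =
     {(x, y). \<exists>E. spectral_measure_of H T E \<and> (x, y) \<in> spectral_integral H E (\<lambda>t. t powr p)}"

definition frac_op :: "'a::euclidean_space set \<Rightarrow> real \<Rightarrow> ('a L2 \<times> 'a L2) set" where
  "frac_op \<Omega> s = form_op (L2_on \<Omega>) (Hs0 \<Omega> s) (frac_form \<Omega> s)"


section \<open>The inverse problem\<close>

definition bounded_linear_Hs0_L2 ::
  "'a::euclidean_space set \<Rightarrow> real \<Rightarrow> ('a L2 \<Rightarrow> 'a L2) \<Rightarrow> bool" where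
  "bounded_linear_Hs0_L2 \<Omega> s K \<longleftrightarrow>
     (\<forall>u\<in>Hs0 \<Omega> s. K u \<in> L2_on \<Omega>) \<and>
     (\<forall>u\<in>Hs0 \<Omega> s. \<forall>v\<in>Hs0 \<Omega> s. K (u + v) = K u + K v) \<and>
     (\<forall>u\<in>Hs0 \<Omega> s. \<forall>c. K (c *\<^sub>R u) = c *\<^sub>R K u) \<and>
     (\<exists>C. \<forall>u\<in>Hs0 \<Omega> s. norm (K u) \<le> C * Hs0_norm \<Omega> s u)"

definition B_op ::
  "'a::euclidean_space set \<Rightarrow> real \<Rightarrow> ('a L2 \<Rightarrow> 'a L2) \<Rightarrow> ('a L2 \<times> 'a L2) set" where
  "B_op \<Omega> s K = {(f, K u) | f u. (f, u) \<in> op_power (L2_on \<Omega>) (frac_op \<Omega> s) (- 1 / 2)}"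

definition BstarB_op ::
  "'a::euclidean_space set \<Rightarrow> real \<Rightarrow> ('a L2 \<Rightarrow> 'a L2) \<Rightarrow> ('a L2 \<times> 'a L2) set" where
  "BstarB_op \<Omega> s K = B_op \<Omega> s K O adjoint_op (L2_on \<Omega>) (B_op \<Omega> s K)"

definition source_condition ::
  "'a::euclidean_space set \<Rightarrow> real \<Rightarrow> ('a L2 \<Rightarrow> 'a L2) \<Rightarrow> 'a L2 \<Rightarrow> real \<Rightarrow> 'a L2 \<Rightarrow> bool" where
  "source_condition \<Omega> s K u\<^sub>0 \<beta> w \<longleftrightarrow>
     (\<exists>z. (u\<^sub>0, z) \<in> op_power (L2_on \<Omega>) (frac_op \<Omega> s) (1 / 2) \<and>
          (w, z) \<in> op_power (L2_on \<Omega>) (BstarB_op \<Omega> s K) \<beta>)"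

definition L2_noise ::
  "'w measure \<Rightarrow> 'a::euclidean_space set \<Rightarrow> real \<Rightarrow> ('w \<Rightarrow> 'a L2) \<Rightarrow> bool" where
  "L2_noise M \<Omega> \<delta> \<eta> \<longleftrightarrow>
     prob_space M \<and> \<eta> \<in> borel_measurable M \<and> (\<forall>\<omega>\<in>space M. \<eta> \<omega> \<in> L2_on \<Omega>) \<and>
     integrable M (\<lambda>\<omega>. (norm (\<eta> \<omega>))\<^sup>2) \<and> (\<integral>\<omega>. (norm (\<eta> \<omega>))\<^sup>2 \<partial>M) \<le> \<delta>\<^sup>2"

definition tikhonov_functional ::
  "'a::euclidean_space set \<Rightarrow> real \<Rightarrow> ('a L2 \<Rightarrow> 'a L2) \<Rightarrow> real \<Rightarrow> 'a L2 \<Rightarrow> 'a L2 \<Rightarrow> real" where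
  "tikhonov_functional \<Omega> s K \<alpha> y u =
     1 / 2 * (norm (K u - y))\<^sup>2 + \<alpha> / 2 * (Hs0_norm \<Omega> s u)\<^sup>2"

definition is_tikhonov_min ::
  "'a::euclidean_space set \<Rightarrow> real \<Rightarrow> ('a L2 \<Rightarrow> 'a L2) \<Rightarrow> real \<Rightarrow> 'a L2 \<Rightarrow> 'a L2 \<Rightarrow> bool" where
  "is_tikhonov_min \<Omega> s K \<alpha> y u \<longleftrightarrow>
     is_arg_min (tikhonov_functional \<Omega> s K \<alpha> y) (\<lambda>v. v \<in> Hs0 \<Omega> s) u"

definition tikhonov_min ::
  "'a::euclidean_space set \<Rightarrow> real \<Rightarrow> ('a L2 \<Rightarrow> 'a L2) \<Rightarrow> real \<Rightarrow> 'a L2 \<Rightarrow> 'a L2" where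
  "tikhonov_min \<Omega> s K \<alpha> y = (THE u. is_tikhonov_min \<Omega> s K \<alpha> y u)"

definition c_const :: "real \<Rightarrow> real" where
  "c_const \<beta> = (if \<beta> = 1 then 1 else \<beta> powr \<beta> * (1 - \<beta>) powr (1 - \<beta>))"

definition C_opt :: "real \<Rightarrow> 'a::euclidean_space L2 \<Rightarrow> real" where
  "C_opt \<beta> w = 2 * (c_const \<beta>)\<^sup>2 * (norm w)\<^sup>2 + 1 / 2"

definition alpha_opt :: "real \<Rightarrow> real \<Rightarrow> real" where
  "alpha_opt \<beta> \<delta> = \<delta> powr (2 / (2 * \<beta> + 1))"

definition sq_error ::
  "'a::euclidean_space set \<Rightarrow> real \<Rightarrow> ('a L2 \<Rightarrow> 'a L2) \<Rightarrow> 'a L2 \<Rightarrow> real \<Rightarrow> 'a L2 \<Rightarrow> real" where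
  "sq_error \<Omega> s K u\<^sub>0 \<alpha> e = (Hs0_norm \<Omega> s (tikhonov_min \<Omega> s K \<alpha> (K u\<^sub>0 + e) - u\<^sub>0))\<^sup>2"

end

theory Submission
  imports Defs
begin

text \<open>
  Let \<open>S = A\<^sub>s\<^bsup>-1/2\<^esup>\<close>, which maps \<open>L\<^sup>2(\<Omega>)\<close> isometrically onto \<open>H\<^sub>0\<^sup>s(\<Omega>)\<close>, and let \<open>T = B\<^sup>*B\<close>. The minimizer
  solves the normal equation \<open>\<langle>K u, K v\<rangle> + \<alpha> a(u, v) = \<langle>y, K v\<rangle>\<close>, so the error splits into a noise part \<open>e\<close> (data
  \<open>\<eta>\<close>) and a bias \<open>q\<close>. Testing with \<open>e\<close> gives \<open>\<alpha> a(e, e) \<le> \<parallel>\<eta>\<parallel>\<^sup>2 / 4\<close>. The bias \<open>q = S p\<close>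
  satisfies \<open>(T + \<alpha>) p = \<alpha> T\<^sup>\<beta> w\<close>; comparing spectral distributions,
  \<open>(t + \<alpha>)\<^sup>2 d\<mu>\<^sub>p = \<alpha>\<^sup>2 t\<^bsup>2\<beta>\<^esup> d\<mu>\<^sub>w\<close>, and Young's inequality
  \<open>\<alpha> t\<^sup>\<beta> \<le> c\<^sub>\<beta> \<alpha>\<^sup>\<beta> (t + \<alpha>)\<close> yields \<open>\<parallel>p\<parallel> \<le> c\<^sub>\<beta> \<alpha>\<^sup>\<beta> \<parallel>w\<parallel>\<close>.

  Spectral measures are only ever those provided by the source condition; neither the spectral
  theorem nor uniqueness of spectral measures is used. Uniqueness of \<open>S\<close> is that of
  the positive square root of \<open>A\<^sub>s\<^sup>-\<^sup>1\<close>.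
\<close>

text \<open>\<open>op_power\<close> quantifies existentially over spectral measures, so
  \<open>B_op\<close> is at first only a relation: two measures of the same operator might give two
  values of its power -1/2. This is why the square root of the inverse has to be shown independent
  of the measure. All that is known of a spectral measure is that the integral of t is the operator.
  Its support must therefore be deduced: [1,\<infinity>) for the form operator, from coercivity and
  surjectivity; [0,\<infinity>) for T, from positivity and solvability of T p + \<alpha> p = x.
  Identities between powers are used only there. \<open>spectral_integral\<close> tests with domain
  vectors through differences of integrals that default to 0 without integrability. Hence each
  identity is accompanied by integrability claims, and vectors outside a domain are reached by
  truncating with projections. Constants: the choice of \<alpha> gives \<delta>^2 / \<alpha> and
  \<alpha>^(2 \<beta>) the same order. The squared error is at most twice the sum of the squares of
  its two parts, so the noise contributes 2 * 1/4 = 1/2 and the bias 2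
  \<open>c_const \<beta>\<close>^2 times the squared norm of w.\<close>

lemma quadratic_nonneg_imp:
  fixes A B C :: real
  assumes C: "0 \<le> C" and *: "\<And>t. 0 \<le> A + 2 * t * B + t\<^sup>2 * C"
  shows "B\<^sup>2 \<le> A * C"
proof (cases "C = 0")
  case True
  have "B = 0"
  proof (rule ccontr)
    assume "B \<noteq> 0"
    \<comment> \<open>For \<open>C = 0\<close>, a case that semidefinite forms do produce, this
      choice of \<open>t\<close> makes the affine expression equal to -1.\<close>
    then show False
      using *[of "- (A + 1) / (2 * B)"] True by (simp add: field_simps)
  qed
  then show ?thesis using True by simp
next
  case False
  have "C > 0" using False C by simp
  have "0 \<le> C * (A + 2 * (- B / C) * B + (- B / C)\<^sup>2 * C)"
    using *[of "- B / C"] C by simp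
  also have "\<dots> = A * C - B\<^sup>2"
    using \<open>C > 0\<close> by (simp add: field_simps power2_eq_square)
  finally show ?thesis by simp
qed

lemma quadratic_nonneg_imp_zero:
  fixes B C :: real
  assumes "0 \<le> C" "\<And>t. 0 \<le> 2 * t * B + t\<^sup>2 * C"
  shows "B = 0"
  using quadratic_nonneg_imp[of C 0 B] assms by simp

section \<open>Complete symmetric forms\<close>

text \<open>One locale serves three forms: the inner product on \<open>H\<close>, the energy form on
  \<open>V\<close>, and the Tikhonov form \<open>b\<close> on \<open>V\<close>. Completeness is
  expressed by the form itself because \<open>V\<close> carries a norm different from that of the
  ambient type. The form is only semidefinite here; definiteness enters later through
  coercivity.\<close>

locale form_space =
  fixes V :: "'v::real_vector set" and a :: "'v \<Rightarrow> 'v \<Rightarrow> real"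
  assumes subsp: "subspace V"
    and add_left: "\<And>u v w. u \<in> V \<Longrightarrow> v \<in> V \<Longrightarrow> w \<in> V \<Longrightarrow> a (u + v) w = a u w + a v w"
    and scale_left: "\<And>u w c. u \<in> V \<Longrightarrow> w \<in> V \<Longrightarrow> a (c *\<^sub>R u) w = c * a u w"
    and sym: "\<And>u v. u \<in> V \<Longrightarrow> v \<in> V \<Longrightarrow> a u v = a v u"
    and nonneg: "\<And>u. u \<in> V \<Longrightarrow> 0 \<le> a u u"
    and complete: "\<And>X. (\<And>n::nat. X n \<in> V) \<Longrightarrow>
      (\<And>e. e > 0 \<Longrightarrow> \<exists>N. \<forall>m\<ge>N. \<forall>n\<ge>N. a (X m - X n) (X m - X n) < e) \<Longrightarrow>
      \<exists>l\<in>V. (\<lambda>n. a (X n - l) (X n - l)) \<longlonglongrightarrow> 0"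
begin

lemma closed[simp, intro]:
  "0 \<in> V" "u \<in> V \<Longrightarrow> v \<in> V \<Longrightarrow> u + v \<in> V" "u \<in> V \<Longrightarrow> v \<in> V \<Longrightarrow> u - v \<in> V"
  "u \<in> V \<Longrightarrow> c *\<^sub>R u \<in> V" "u \<in> V \<Longrightarrow> - u \<in> V"
  using subsp by (simp_all add: subspace_0 subspace_add subspace_diff subspace_scale subspace_neg)

lemma add_right: "u \<in> V \<Longrightarrow> v \<in> V \<Longrightarrow> w \<in> V \<Longrightarrow> a w (u + v) = a w u + a w v"
  using add_left[of u v w] sym[of w] by simp

lemma scale_right: "u \<in> V \<Longrightarrow> w \<in> V \<Longrightarrow> a w (c *\<^sub>R u) = c * a w u"
  using scale_left[of u w c] sym[of w] by simp

lemma minus_left: "u \<in> V \<Longrightarrow> w \<in> V \<Longrightarrow> a (- u) w = - a u w"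
  using scale_left[of u w "-1"] by simp

lemma minus_right: "u \<in> V \<Longrightarrow> w \<in> V \<Longrightarrow> a w (- u) = - a w u"
  using scale_right[of u w "-1"] by simp

lemma diff_left: "u \<in> V \<Longrightarrow> v \<in> V \<Longrightarrow> w \<in> V \<Longrightarrow> a (u - v) w = a u w - a v w"
  using add_left[of u "-v" w] minus_left[of v w] by simp

lemma diff_right: "u \<in> V \<Longrightarrow> v \<in> V \<Longrightarrow> w \<in> V \<Longrightarrow> a w (u - v) = a w u - a w v"
  using add_right[of u "-v" w] minus_right[of v w] by simp

lemmas bilin = add_left add_right scale_left scale_right minus_left minus_right diff_left diff_right

lemma cauchy_schwarz:
  assumes "u \<in> V" "v \<in> V"
  shows "(a u v)\<^sup>2 \<le> a u u * a v v"
proof (rule quadratic_nonneg_imp)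
  fix t
  have "0 \<le> a (u + t *\<^sub>R v) (u + t *\<^sub>R v)" using assms by (intro nonneg) auto
  then show "0 \<le> a u u + 2 * t * a u v + t\<^sup>2 * a v v"
    using assms sym[of u v] by (simp add: bilin algebra_simps power2_eq_square)
qed (use nonneg assms in auto)

lemma cauchy_schwarz_sqrt:
  assumes "u \<in> V" "v \<in> V"
  shows "\<bar>a u v\<bar> \<le> sqrt (a u u) * sqrt (a v v)"
  using real_sqrt_le_mono[OF cauchy_schwarz[OF assms]] by (simp add: real_sqrt_mult)

lemma minkowski:
  assumes "u \<in> V" "v \<in> V"
  shows "sqrt (a (u + v) (u + v)) \<le> sqrt (a u u) + sqrt (a v v)"
proof (rule real_le_lsqrt)
  have "a (u + v) (u + v) = a u u + a v v + 2 * a u v"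
    using assms sym[of u v] by (simp add: bilin)
  also have "\<dots> \<le> a u u + a v v + 2 * (sqrt (a u u) * sqrt (a v v))"
    using cauchy_schwarz_sqrt[OF assms] by linarith
  also have "\<dots> = (sqrt (a u u) + sqrt (a v v))\<^sup>2"
    using nonneg assms by (simp add: power2_sum)
  finally show "a (u + v) (u + v) \<le> (sqrt (a u u) + sqrt (a v v))\<^sup>2" .
qed (use nonneg assms in \<open>auto intro!: add_nonneg_nonneg\<close>)

text \<open>The parallelogram law with one square dropped. Its factor 2 reappears in the final
  constant.\<close>

lemma sum_sq_le:
  assumes "u \<in> V" "v \<in> V"
  shows "a (u - v) (u - v) \<le> 2 * a u u + 2 * a v v"
proof -
  have "a (u - v) (u - v) + a (u + v) (u + v) = 2 * a u u + 2 * a v v"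
    using assms by (simp add: bilin)
  then show ?thesis using nonneg[of "u + v"] assms by simp
qed

lemma tendsto_form:
  assumes "\<And>n. X n \<in> V" "l \<in> V" "(\<lambda>n. a (X n - l) (X n - l)) \<longlonglongrightarrow> 0" "v \<in> V"
  shows "(\<lambda>n. a (X n) v) \<longlonglongrightarrow> a l v"
proof -
  have "(\<lambda>n. sqrt (a (X n - l) (X n - l)) * sqrt (a v v)) \<longlonglongrightarrow> sqrt 0 * sqrt (a v v)"
    by (rule tendsto_mult_right[OF tendsto_real_sqrt[OF assms(3)]])
  then have lim: "(\<lambda>n. sqrt (a (X n - l) (X n - l)) * sqrt (a v v)) \<longlonglongrightarrow> 0" by simp
  have le: "norm (a (X n) v - a l v) \<le> sqrt (a (X n - l) (X n - l)) * sqrt (a v v)" for n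
    unfolding diff_left[OF assms(1,2,4), symmetric] real_norm_def
    by (rule cauchy_schwarz_sqrt) (use assms(1,2,4) in auto)
  have "(\<lambda>n. a (X n) v - a l v) \<longlonglongrightarrow> 0"
    by (rule Lim_null_comparison[OF always_eventually lim]) (simp only: le simp_thms)
  then show ?thesis by (rule LIM_zero_cancel)
qed

text \<open>Direct method: the representative is a minimizer of \<open>a v v - 2 * \<phi> v\<close>.
  The parallelogram law makes a minimizing sequence Cauchy, and the vanishing first variation at the
  limit is the claim. This works for a semidefinite form.\<close>

theorem riesz:
  assumes add: "\<And>u v. u \<in> V \<Longrightarrow> v \<in> V \<Longrightarrow> \<phi> (u + v) = \<phi> u + \<phi> v"
    and scale: "\<And>u c. u \<in> V \<Longrightarrow> \<phi> (c *\<^sub>R u) = c * \<phi> u"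
    and bound: "\<And>u. u \<in> V \<Longrightarrow> \<bar>\<phi> u\<bar> \<le> C * sqrt (a u u)"
  shows "\<exists>u\<in>V. \<forall>v\<in>V. a u v = \<phi> v"
proof -
  define J where "J v = a v v - 2 * \<phi> v" for v
  define m where "m = Inf (J ` V)"
  have J_ge: "- C\<^sup>2 \<le> J v" if "v \<in> V" for v
  proof -
    have "0 \<le> (sqrt (a v v) - C)\<^sup>2" by simp
    also have "\<dots> = a v v - 2 * (C * sqrt (a v v)) + C\<^sup>2"
      using nonneg[OF that] by (simp add: power2_diff)
    finally show ?thesis using bound[OF that] by (simp add: J_def)
  qed
  have bdd: "bdd_below (J ` V)" using J_ge by (intro bdd_belowI2)
  have m_le: "m \<le> J v" if "v \<in> V" for v
    unfolding m_def using bdd that by (intro cInf_lower) auto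
  have "\<exists>v\<in>V. J v < m + 1 / real (Suc n)" for n
  proof -
    have "J ` V \<noteq> {}" "Inf (J ` V) < m + 1 / real (Suc n)"
      using closed(1) by (auto simp: m_def)
    from cInf_lessD[OF this] show ?thesis by blast
  qed
  then obtain X where X: "\<And>n. X n \<in> V" "\<And>n. J (X n) < m + 1 / real (Suc n)" by metis
  \<comment> \<open>Comparison with the midpoint, where \<open>J\<close> is still at least
    \<open>m\<close>: the distance of two points is controlled by the excess of their
    values.\<close>
  have par: "a (u - v) (u - v) \<le> 2 * (J u - m) + 2 * (J v - m)" if "u \<in> V" "v \<in> V" for u v
  proof -
    have "\<phi> ((1/2) *\<^sub>R (u + v)) = (\<phi> u + \<phi> v) / 2"
      using that by (subst scale) (auto simp: add)
    then have "4 * J ((1/2) *\<^sub>R (u + v)) = 2 * J u + 2 * J v - a (u - v) (u - v)"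
      using that sym[of u v] by (simp add: J_def bilin field_simps)
    moreover have "m \<le> J ((1/2) *\<^sub>R (u + v))" using that by (intro m_le) auto
    ultimately show ?thesis by simp
  qed
  have "\<exists>l\<in>V. (\<lambda>n. a (X n - l) (X n - l)) \<longlonglongrightarrow> 0"
  proof (rule complete)
    fix e :: real assume "e > 0"
    then obtain N where N: "1 / real (Suc N) < e / 4"
      using nat_approx_posE[of "e / 4"] by auto
    have small: "J (X n) - m < e / 4" if "n \<ge> N" for n
    proof -
      have "1 / real (Suc n) \<le> 1 / real (Suc N)" using that by (simp add: frac_le)
      then show ?thesis using X(2)[of n] N by linarith
    qed
    have "a (X i - X j) (X i - X j) < e" if "i \<ge> N" "j \<ge> N" for i j
    proof -
      have "2 * (J (X i) - m) + 2 * (J (X j) - m) < e"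
        using small[OF that(1)] small[OF that(2)] by (simp add: field_simps)
      then show ?thesis using par[OF X(1) X(1), of i j] by linarith
    qed
    then show "\<exists>N. \<forall>m\<ge>N. \<forall>n\<ge>N. a (X m - X n) (X m - X n) < e" by blast
  qed (rule X)
  then obtain l where l: "l \<in> V" "(\<lambda>n. a (X n - l) (X n - l)) \<longlonglongrightarrow> 0" by blast
  have "a l v = \<phi> v" if v: "v \<in> V" for v
  proof -
    have "a l v - \<phi> v = 0"
    proof (rule quadratic_nonneg_imp_zero[where C = "a v v"])
      fix t
      \<comment> \<open>Near-minimality of \<open>X n\<close> along a line. In the limit the error
        1/(n+1) disappears and leaves a nonnegative quadratic in \<open>t\<close> without constant
        term, whose linear coefficient must vanish.\<close>
      have *: "0 \<le> 1 / real (Suc n) + (2 * t * (a (X n) v - \<phi> v) + t\<^sup>2 * a v v)" for n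
      proof -
        have "m \<le> J (X n + t *\<^sub>R v)" using X v by (intro m_le) auto
        also have "J (X n + t *\<^sub>R v) = J (X n) + (2 * t * (a (X n) v - \<phi> v) + t\<^sup>2 * a v v)"
        proof -
          have "a (X n + t *\<^sub>R v) (X n + t *\<^sub>R v) = a (X n) (X n) + 2 * t * a (X n) v + t\<^sup>2 * a v v"
            using X(1)[of n] v sym[of v "X n"] by (simp add: bilin power2_eq_square algebra_simps)
          moreover have "\<phi> (X n + t *\<^sub>R v) = \<phi> (X n) + t * \<phi> v"
            using X(1)[of n] v by (simp add: add scale)
          ultimately show ?thesis by (simp add: J_def algebra_simps)
        qed
        finally show ?thesis using X(2)[of n] by linarith
      qed
      have "(\<lambda>n. 1 / real (Suc n) + (2 * t * (a (X n) v - \<phi> v) + t\<^sup>2 * a v v))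
          \<longlonglongrightarrow> 0 + (2 * t * (a l v - \<phi> v) + t\<^sup>2 * a v v)"
        using tendsto_form[OF X(1) l v]
        by (intro tendsto_intros LIMSEQ_Suc[OF lim_1_over_n])
      from LIMSEQ_le_const[OF this] * show "0 \<le> 2 * t * (a l v - \<phi> v) + t\<^sup>2 * a v v" by simp
    qed (use nonneg v in auto)
    then show ?thesis by simp
  qed
  with l show ?thesis by blast
qed

end

section \<open>Calculus for projection valued measures\<close>

text \<open>Approximating \<open>g\<close> by simple functions, an identity between weighted measures that holds
  on sets holds for integrals of \<open>g\<close>.\<close>

lemma weighted_measures_integral_zero:
  fixes L :: "(real \<times> 'a measure \<times> ('a \<Rightarrow> real)) list" and g :: "'a \<Rightarrow> real"
  assumes g: "g \<in> borel_measurable N"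
    and M: "\<And>c M h. (c, M, h) \<in> set L \<Longrightarrow> sets M = sets N"
    and h: "\<And>c M h. (c, M, h) \<in> set L \<Longrightarrow> integrable M h"
    and gh: "\<And>c M h. (c, M, h) \<in> set L \<Longrightarrow> integrable M (\<lambda>t. g t * h t)"
    and zero: "\<And>B. B \<in> sets N \<Longrightarrow> (\<Sum>(c, M, h)\<leftarrow>L. c * (\<integral>t. indicator B t * h t \<partial>M)) = 0"
  shows "(\<Sum>(c, M, h)\<leftarrow>L. c * (\<integral>t. g t * h t \<partial>M)) = 0"
proof -
  obtain s where s: "\<And>i. simple_function N (s i)"
      "\<And>x. x \<in> space N \<Longrightarrow> (\<lambda>i. s i x) \<longlonglongrightarrow> g x"
      "\<And>i x. x \<in> space N \<Longrightarrow> norm (s i x) \<le> 2 * norm (g x)"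
  proof -
    obtain F where "\<And>i. simple_function N (F i)"
      "\<And>x. x \<in> space N \<Longrightarrow> (\<lambda>i. F i x) \<longlonglongrightarrow> g x"
      "\<And>i x. x \<in> space N \<Longrightarrow> dist (F i x) 0 \<le> 2 * dist (g x) 0"
      using borel_measurable_implies_sequence_metric[OF g, of 0] by blast
    then show ?thesis by (intro that[of F]) (simp_all add: dist_norm)
  qed
  have sp: "space M = space N" if "(c, M, h) \<in> set L" for c M h
    using M[OF that] by (rule sets_eq_imp_space_eq)
  have simple: "(\<Sum>(c, M, h)\<leftarrow>L. c * (\<integral>t. s i t * h t \<partial>M)) = 0" for i
  proof -
    let ?Y = "s i ` space N"
    have fin: "finite ?Y" using s(1)[of i] by (simp add: simple_function_def)
    let ?B = "\<lambda>y. s i -` {y} \<inter> space N"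
    have B: "?B y \<in> sets N" for y using s(1)[of i] by (rule simple_functionD)
    have "(\<integral>t. s i t * h t \<partial>M) = (\<Sum>y\<in>?Y. y * (\<integral>t. indicator (?B y) t * h t \<partial>M))"
      if "(c, M, h) \<in> set L" for c M h
    proof -
      have "(\<integral>t. s i t * h t \<partial>M) = (\<integral>t. (\<Sum>y\<in>?Y. y * (indicator (?B y) t * h t)) \<partial>M)"
      proof (rule Bochner_Integration.integral_cong[OF refl])
        fix t assume "t \<in> space M"
        then have t: "t \<in> space N" using sp[OF that] by simp
        have "(\<Sum>y\<in>?Y. y * (indicator (?B y) t * h t)) = (\<Sum>y\<in>{s i t}. y * h t)"
          by (rule sum.mono_neutral_cong_right) (use fin t in \<open>auto simp: indicator_def\<close>)
        then show "s i t * h t = (\<Sum>y\<in>?Y. y * (indicator (?B y) t * h t))" by simp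
      qed
      also have "\<dots> = (\<Sum>y\<in>?Y. y * (\<integral>t. indicator (?B y) t * h t \<partial>M))"
        using integrable_real_mult_indicator[OF _ h[OF that]] B M[OF that]
        by (subst Bochner_Integration.integral_sum) (auto simp: mult.commute)
      finally show ?thesis .
    qed
    then have "(\<Sum>(c, M, h)\<leftarrow>L. c * (\<integral>t. s i t * h t \<partial>M)) =
      (\<Sum>(c, M, h)\<leftarrow>L. c * (\<Sum>y\<in>?Y. y * (\<integral>t. indicator (?B y) t * h t \<partial>M)))"
      by (intro arg_cong[where f=sum_list] map_cong[OF refl]) auto
    also have "\<dots> = (\<Sum>y\<in>?Y. y * (\<Sum>(c, M, h)\<leftarrow>L. c * (\<integral>t. indicator (?B y) t * h t \<partial>M)))"
    proof (induction L)
      case (Cons p L)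
      then show ?case
        by (cases p) (simp add: distrib_left sum.distrib sum_distrib_left mult.left_commute)
    qed simp
    also have "\<dots> = 0" using zero[OF B] by simp
    finally show ?thesis .
  qed
  have "(\<lambda>i. \<Sum>(c, M, h)\<leftarrow>L. c * (\<integral>t. s i t * h t \<partial>M))
      \<longlonglongrightarrow> (\<Sum>(c, M, h)\<leftarrow>L. c * (\<integral>t. g t * h t \<partial>M))"
    using M h gh sp
  proof (induction L)
    case (Cons p L)
    obtain c M h where p: "p = (c, M, h)" by (cases p)
    have in_set: "(c, M, h) \<in> set (p # L)" by (simp add: p)
    have "(\<lambda>i. \<integral>t. s i t * h t \<partial>M) \<longlonglongrightarrow> (\<integral>t. g t * h t \<partial>M)"
    proof (rule integral_dominated_convergence)
      have hm: "h \<in> borel_measurable M" using Cons.prems(2)[OF in_set] by simp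
      have sm: "f \<in> borel_measurable M" if "f \<in> borel_measurable N" for f :: "'a \<Rightarrow> real"
        using that Cons.prems(1)[OF in_set] measurable_cong_sets[OF Cons.prems(1)[OF in_set] refl]
        by blast
      show "(\<lambda>t. g t * h t) \<in> borel_measurable M" using hm sm[OF g] by measurable
      show "(\<lambda>t. s i t * h t) \<in> borel_measurable M" for i
        using hm sm[OF borel_measurable_simple_function[OF s(1)]] by measurable
      show "integrable M (\<lambda>t. 2 * \<bar>g t * h t\<bar>)" using Cons.prems(3)[OF in_set] by simp
      show "AE t in M. (\<lambda>i. s i t * h t) \<longlonglongrightarrow> g t * h t"
        using s(2) Cons.prems(4)[OF in_set] by (intro AE_I2 tendsto_intros) auto
      show "AE t in M. norm (s i t * h t) \<le> 2 * \<bar>g t * h t\<bar>" for i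
      proof (rule AE_I2)
        fix t assume "t \<in> space M"
        then have "\<bar>s i t\<bar> \<le> 2 * \<bar>g t\<bar>" using s(3)[of t i] Cons.prems(4)[OF in_set] by simp
        then have "\<bar>s i t\<bar> * \<bar>h t\<bar> \<le> 2 * \<bar>g t\<bar> * \<bar>h t\<bar>" by (rule mult_right_mono) simp
        then show "norm (s i t * h t) \<le> 2 * \<bar>g t * h t\<bar>" by (simp add: abs_mult)
      qed
    qed
    moreover have "(\<lambda>i. \<Sum>(c, M, h)\<leftarrow>L. c * (\<integral>t. s i t * h t \<partial>M))
      \<longlonglongrightarrow> (\<Sum>(c, M, h)\<leftarrow>L. c * (\<integral>t. g t * h t \<partial>M))"
      by (rule Cons.IH)
        (rule Cons.prems, erule list.set_intros(2))+
    ultimately show ?case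
      unfolding p by (auto intro: tendsto_add tendsto_mult_left)
  qed simp
  with simple show ?thesis by (simp add: LIMSEQ_const_iff)
qed

text \<open>Induction over nonnegative measurable functions. Two measures stand on the right because
  the parallelogram law bounds the spectral distribution of a sum by those of both summands.\<close>

lemma nn_integral_le_of_emeasure_le:
  assumes g: "g \<in> borel_measurable N"
    and sets: "sets M1 = sets N" "sets M2 = sets N" "sets M3 = sets N"
    and le: "\<And>A. A \<in> sets N \<Longrightarrow> emeasure M1 A \<le> c * (emeasure M2 A + emeasure M3 A)"
  shows "(\<integral>\<^sup>+t. g t \<partial>M1) \<le> c * ((\<integral>\<^sup>+t. g t \<partial>M2) + (\<integral>\<^sup>+t. g t \<partial>M3))"
proof -
  note sp = sets[THEN sets_eq_imp_space_eq]
  have meas: "f \<in> borel_measurable M1" "f \<in> borel_measurable M2" "f \<in> borel_measurable M3"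
    if "f \<in> borel_measurable N" for f :: "'a \<Rightarrow> ennreal"
    using that measurable_cong_sets[OF sets(1) refl] measurable_cong_sets[OF sets(2) refl]
      measurable_cong_sets[OF sets(3) refl] by blast+
  show ?thesis
    using g
  proof (induction g rule: borel_measurable_induct)
    case (cong f g)
    have "nn_integral M f = nn_integral M g" if "space M = space N" for M
      using cong that by (intro nn_integral_cong) auto
    then show ?case using cong sp by simp
  next
    case (set A)
    then have "A \<in> sets M1" "A \<in> sets M2" "A \<in> sets M3" by (simp_all only: sets)
    then show ?case using le[OF set] by (simp only: nn_integral_indicator)
  next
    case (mult u k)
    note meas_u = meas[OF \<open>u \<in> borel_measurable N\<close>]
    have "(\<integral>\<^sup>+t. k * u t \<partial>M1) \<le> k * (c * ((\<integral>\<^sup>+t. u t \<partial>M2) + (\<integral>\<^sup>+t. u t \<partial>M3)))"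
      unfolding nn_integral_cmult[OF meas_u(1)] by (rule mult_left_mono[OF mult.IH]) simp
    also have "\<dots> = c * ((\<integral>\<^sup>+t. k * u t \<partial>M2) + (\<integral>\<^sup>+t. k * u t \<partial>M3))"
      unfolding nn_integral_cmult[OF meas_u(2)] nn_integral_cmult[OF meas_u(3)]
      by (simp only: distrib_left mult.left_commute)
    finally show ?case .
  next
    case (add u v)
    note meas_u = meas[OF \<open>u \<in> borel_measurable N\<close>]
    note meas_v = meas[OF \<open>v \<in> borel_measurable N\<close>]
    have "(\<integral>\<^sup>+t. v t + u t \<partial>M1) \<le> c * ((\<integral>\<^sup>+t. v t \<partial>M2) + (\<integral>\<^sup>+t. v t \<partial>M3)) +
        c * ((\<integral>\<^sup>+t. u t \<partial>M2) + (\<integral>\<^sup>+t. u t \<partial>M3))"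
      unfolding nn_integral_add[OF meas_v(1) meas_u(1)] by (rule add_mono; fact)
    also have "\<dots> = c * ((\<integral>\<^sup>+t. v t + u t \<partial>M2) + (\<integral>\<^sup>+t. v t + u t \<partial>M3))"
      unfolding nn_integral_add[OF meas_v(2) meas_u(2)] nn_integral_add[OF meas_v(3) meas_u(3)]
      by (simp only: distrib_left ac_simps)
    finally show ?case .
  next
    case (seq U)
    have "(\<integral>\<^sup>+t. (SUP i. U i) t \<partial>M1) = (SUP i. \<integral>\<^sup>+t. U i t \<partial>M1)"
      unfolding SUP_apply
      by (rule nn_integral_monotone_convergence_SUP[OF \<open>incseq U\<close> meas(1)]) fact
    also have "\<dots> \<le> c * ((\<integral>\<^sup>+t. (SUP i. U i) t \<partial>M2) + (\<integral>\<^sup>+t. (SUP i. U i) t \<partial>M3))"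
    proof (rule SUP_least)
      fix i
      have "(\<integral>\<^sup>+t. U i t \<partial>M) \<le> (\<integral>\<^sup>+t. (SUP i. U i) t \<partial>M)" for M
        unfolding SUP_apply by (intro nn_integral_mono SUP_upper) simp
      then show "(\<integral>\<^sup>+t. U i t \<partial>M1) \<le> c * ((\<integral>\<^sup>+t. (SUP i. U i) t \<partial>M2) + (\<integral>\<^sup>+t. (SUP i. U i) t \<partial>M3))"
        by (intro order_trans[OF seq.IH] mult_left_mono add_mono) simp_all
    qed
    finally show ?case .
  qed
qed

text \<open>Completeness is demanded of the set itself, since the ambient type is only an inner
  product space, in which a closed subspace may be incomplete.\<close>

locale hilbert_subspace =
  fixes H :: "'h::real_inner set"
  assumes subspace_H: "subspace H" and complete_H: "Topological_Spaces.complete H"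

sublocale hilbert_subspace \<subseteq> form_space H "\<lambda>x y. x \<bullet> y"
proof
  fix X :: "nat \<Rightarrow> 'h"
  assume X: "\<And>n. X n \<in> H"
    and C: "\<And>e. e > 0 \<Longrightarrow> \<exists>N. \<forall>m\<ge>N. \<forall>n\<ge>N. (X m - X n) \<bullet> (X m - X n) < e"
  have "Cauchy X"
  proof (rule metric_CauchyI)
    fix e :: real assume "e > 0"
    then have "e\<^sup>2 > 0" by simp
    then obtain N where "\<forall>m\<ge>N. \<forall>n\<ge>N. (X m - X n) \<bullet> (X m - X n) < e\<^sup>2" using C by blast
    then have "dist (X m) (X n) < e" if "m \<ge> N" "n \<ge> N" for m n
      using that \<open>e > 0\<close> by (auto simp: dist_norm norm_eq_sqrt_inner intro: real_less_lsqrt)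
    then show "\<exists>N. \<forall>m\<ge>N. \<forall>n\<ge>N. dist (X m) (X n) < e" by blast
  qed
  then obtain l where l: "l \<in> H" "X \<longlonglongrightarrow> l"
    using complete_H X using completeE[of H X] by blast
  have "(\<lambda>n. (norm (X n - l))\<^sup>2) \<longlonglongrightarrow> 0"
    using tendsto_power[OF tendsto_norm[OF LIM_zero[OF l(2)]], of 2] by simp
  with l(1) show "\<exists>l\<in>H. (\<lambda>n. (X n - l) \<bullet> (X n - l)) \<longlonglongrightarrow> 0"
    by (auto simp: power2_norm_eq_inner)
qed (use subspace_H in \<open>auto simp: inner_add_left intro: inner_commute\<close>)

section \<open>Projections and spectral distributions\<close>

locale pvm = hilbert_subspace H for H :: "'h::real_inner set" +
  fixes E :: "real set \<Rightarrow> 'h \<Rightarrow> 'h"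
  assumes pvm: "projection_valued_measure H E"
begin

abbreviation "\<mu> x \<equiv> spectral_dist E x"

lemma proj:
  assumes "A \<in> sets borel" "x \<in> H"
  shows "E A x \<in> H" "E A (E A x) = E A x" "E A (c *\<^sub>R x) = c *\<^sub>R E A x"
    "y \<in> H \<Longrightarrow> E A (x + y) = E A x + E A y" "y \<in> H \<Longrightarrow> E A x \<bullet> y = x \<bullet> E A y"
  using pvm assms unfolding projection_valued_measure_def orth_proj_on_def by blast+

lemma proj_diff:
  assumes "A \<in> sets borel" "x \<in> H" "y \<in> H"
  shows "E A (x - y) = E A x - E A y"
  using proj(4)[OF assms(1,2), of "- y"] proj(3)[OF assms(1,3), of "-1"] assms by simp

lemma proj_UNIV[simp]: "x \<in> H \<Longrightarrow> E UNIV x = x"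
  using pvm unfolding projection_valued_measure_def by blast

lemma proj_sums:
  fixes A :: "nat \<Rightarrow> real set"
  assumes "range A \<subseteq> sets borel" "disjoint_family A" "x \<in> H"
  shows "(\<lambda>n. E (A n) x) sums E (\<Union>n. A n) x"
  using pvm assms unfolding projection_valued_measure_def by blast

lemma proj_empty[simp]:
  assumes "x \<in> H"
  shows "E {} x = 0"
proof -
  \<comment> \<open>The empty sets are disjoint from each other, and a constant series converges
    only if its term is 0.\<close>
  have "(\<lambda>n::nat. E {} x) sums E (\<Union>n::nat. {}) x"
    using assms by (intro proj_sums) (auto simp: disjoint_family_on_def)
  then have "(\<lambda>n::nat. E {} x) \<longlonglongrightarrow> 0" by (intro summable_LIMSEQ_zero sums_summable)
  then show ?thesis by (simp add: LIMSEQ_const_iff)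
qed

lemma proj_inner: "A \<in> sets borel \<Longrightarrow> x \<in> H \<Longrightarrow> E A x \<bullet> x = (norm (E A x))\<^sup>2"
  using proj(5)[of A "E A x" x] proj[of A x] by (simp add: power2_norm_eq_inner)

lemma proj_disjoint_union:
  assumes "A \<in> sets borel" "B \<in> sets borel" "A \<inter> B = {}" "x \<in> H"
  shows "E (A \<union> B) x = E A x + E B x"
proof -
  have "(\<lambda>n. E (binaryset A B n) x) sums E (\<Union>n. binaryset A B n) x"
    using assms by (intro proj_sums) (auto simp: binaryset_def disjoint_family_on_def)
  moreover have "(\<lambda>n. E (binaryset A B n) x) sums (\<Sum>n\<in>{0,1}. E (binaryset A B n) x)"
    using assms by (intro sums_finite) (auto simp: binaryset_def)
  ultimately have "E (\<Union>n. binaryset A B n) x = (\<Sum>n\<in>{0,1}. E (binaryset A B n) x)"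
    using sums_unique2 by blast
  then show ?thesis by (simp add: UN_binaryset_eq binaryset_def)
qed

text \<open>For \<open>y = E B x\<close> the squared norm of \<open>y\<close> splits into three
  nonnegative parts over \<open>A\<close>, \<open>B\<close> and the rest. The part over
  \<open>B\<close> is already everything, so the other two vanish.\<close>

lemma proj_disjoint:
  assumes A: "A \<in> sets borel" and B: "B \<in> sets borel" and AB: "A \<inter> B = {}" and x: "x \<in> H"
  shows "E A (E B x) = 0"
proof -
  let ?y = "E B x"
  have y: "?y \<in> H" using B x by (rule proj)
  have "UNIV = A \<union> B \<union> - (A \<union> B)" by blast
  then have "E UNIV ?y = E (A \<union> B \<union> - (A \<union> B)) ?y" by (rule arg_cong)
  also have "\<dots> = E (A \<union> B) ?y + E (- (A \<union> B)) ?y"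
    using A B y by (intro proj_disjoint_union) auto
  also have "E (A \<union> B) ?y = E A ?y + E B ?y" using A B AB y by (intro proj_disjoint_union)
  finally have "E UNIV ?y \<bullet> ?y = E A ?y \<bullet> ?y + E B ?y \<bullet> ?y + E (- (A \<union> B)) ?y \<bullet> ?y"
    by (simp only: inner_add_left)
  then have "E A ?y \<bullet> ?y + E (- (A \<union> B)) ?y \<bullet> ?y = 0"
    unfolding proj_UNIV[OF y] proj(2)[OF B x] by linarith
  moreover have "- (A \<union> B) \<in> sets borel" using A B by auto
  ultimately have "(norm (E A ?y))\<^sup>2 + (norm (E (- (A \<union> B)) ?y))\<^sup>2 = 0"
    by (simp only: proj_inner[OF A y] proj_inner[OF _ y])
  then show ?thesis by (simp add: sum_power2_eq_zero_iff)
qed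

text \<open>Multiplicativity follows from additivity: split both sets along the intersection and
  cancel the disjoint parts by \<open>proj_disjoint\<close>.\<close>

lemma proj_proj:
  assumes A: "A \<in> sets borel" and B: "B \<in> sets borel" and x: "x \<in> H"
  shows "E A (E B x) = E (A \<inter> B) x"
proof -
  have 1: "E B x = E (A \<inter> B) x + E (B - A) x"
    using proj_disjoint_union[of "B \<inter> A" "B - A" x] A B x
    by (simp add: Int_Diff_Un Int_Diff_disjoint inf_commute[of A B])
  have 2: "E A y = E (A \<inter> B) y + E (A - B) y" if "y \<in> H" for y
    using proj_disjoint_union[of "A \<inter> B" "A - B" y] A B that
    by (simp add: Int_Diff_Un Int_Diff_disjoint)
  have in_H: "E (A \<inter> B) x \<in> H" "E (B - A) x \<in> H" using A B x by (auto intro: proj(1))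
  have "E A (E B x) = E A (E (A \<inter> B) x) + E A (E (B - A) x)"
    using 1 proj(4)[OF A in_H(1) in_H(2)] by simp
  also have "E A (E (B - A) x) = 0" using A B x by (intro proj_disjoint) auto
  also have "E A (E (A \<inter> B) x) = E (A \<inter> B) (E (A \<inter> B) x) + E (A - B) (E (A \<inter> B) x)"
    by (rule 2[OF in_H(1)])
  also have "E (A - B) (E (A \<inter> B) x) = 0" using A B x by (intro proj_disjoint) auto
  finally show ?thesis using A B x by (simp add: proj(2))
qed

lemma sets_\<mu>[simp, measurable_cong]: "sets (\<mu> x) = sets borel"
  unfolding spectral_dist_def using sigma_algebra.sets_measure_of_eq[of UNIV "sets (borel :: real measure)"]
    sets.sigma_algebra_axioms[of "borel :: real measure"] by simp

lemma space_\<mu>[simp]: "space (\<mu> x) = UNIV"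
  using sets_eq_imp_space_eq[OF sets_\<mu>] by simp

lemma emeasure_\<mu>:
  assumes A: "A \<in> sets borel" and x: "x \<in> H"
  shows "emeasure (\<mu> x) A = ennreal (E A x \<bullet> x)"
proof (rule emeasure_measure_of[OF spectral_dist_def])
  show "sets borel \<subseteq> Pow (UNIV :: real set)" by simp
  show "positive (sets (\<mu> x)) (\<lambda>A. ennreal (E A x \<bullet> x))"
    using x by (simp add: positive_def)
  show "countably_additive (sets (\<mu> x)) (\<lambda>A. ennreal (E A x \<bullet> x))"
    unfolding countably_additive_def
  proof (intro allI impI)
    fix A :: "nat \<Rightarrow> real set"
    assume A: "range A \<subseteq> sets (\<mu> x)" "disjoint_family A"
    have "(\<lambda>n. E (A n) x \<bullet> x) sums (E (\<Union>n. A n) x \<bullet> x)"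
      using A x by (intro bounded_linear.sums[OF bounded_linear_inner_left] proj_sums) auto
    then show "(\<Sum>n. ennreal (E (A n) x \<bullet> x)) = ennreal (E (\<Union>n. A n) x \<bullet> x)"
      using A x by (intro suminf_ennreal_eq) (auto simp: proj_inner)
  qed
qed (use A in simp)

lemma measure_\<mu>: "A \<in> sets borel \<Longrightarrow> x \<in> H \<Longrightarrow> measure (\<mu> x) A = E A x \<bullet> x"
  by (simp add: measure_def emeasure_\<mu> proj_inner)

lemma measure_\<mu>_UNIV[simp]: "x \<in> H \<Longrightarrow> measure (\<mu> x) UNIV = x \<bullet> x"
  by (simp add: measure_\<mu>)

lemma finite_\<mu>: "x \<in> H \<Longrightarrow> finite_measure (\<mu> x)"
  by (rule finite_measureI) (simp add: emeasure_\<mu>)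

lemma emeasure_\<mu>_measure: "x \<in> H \<Longrightarrow> emeasure (\<mu> x) A = ennreal (measure (\<mu> x) A)"
  using finite_measure.emeasure_eq_measure[OF finite_\<mu>] .

lemma \<mu>_eqI:
  assumes "\<And>A. A \<in> sets borel \<Longrightarrow> E A x \<bullet> x = E A y \<bullet> y" "x \<in> H" "y \<in> H"
  shows "\<mu> x = \<mu> y"
  using assms by (intro measure_eqI) (auto simp: emeasure_\<mu>)

lemma \<mu>_uminus:
  assumes "x \<in> H" shows "\<mu> (- x) = \<mu> x"
  by (rule \<mu>_eqI) (use assms proj(3)[of _ x "-1"] in auto)

lemma \<mu>_diff_commute: "x \<in> H \<Longrightarrow> y \<in> H \<Longrightarrow> \<mu> (x - y) = \<mu> (y - x)"
  using \<mu>_uminus[of "y - x"] by simp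

lemma measure_\<mu>_scale:
  "A \<in> sets borel \<Longrightarrow> x \<in> H \<Longrightarrow> measure (\<mu> (c *\<^sub>R x)) A = c\<^sup>2 * measure (\<mu> x) A"
  by (simp add: measure_\<mu> proj power2_eq_square)

lemma measure_\<mu>_proj:
  assumes "A \<in> sets borel" "B \<in> sets borel" "x \<in> H"
  shows "measure (\<mu> (E B x)) A = measure (\<mu> x) (A \<inter> B)"
proof -
  have "measure (\<mu> (E B x)) A = E (A \<inter> B) x \<bullet> E B x"
    using assms by (simp add: measure_\<mu> proj proj_proj)
  also have "\<dots> = E B (E (A \<inter> B) x) \<bullet> x"
    using assms proj(5)[of B "E (A \<inter> B) x" x] proj(1)[of "A \<inter> B" x] by simp
  also have "E B (E (A \<inter> B) x) = E (A \<inter> B) x"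
    using assms by (simp add: proj_proj inf_commute inf_left_commute)
  finally show ?thesis using assms by (simp add: measure_\<mu>)
qed

text \<open>Identifies the difference of measures used in \<open>spectral_integral\<close> with the
  signed measure of \<open>E A x \<bullet> z\<close>. Linear identities for vectors thereby become
  identities on sets, as \<open>weighted_measures_integral_zero\<close> expects.\<close>

lemma polarization:
  assumes "A \<in> sets borel" "x \<in> H" "z \<in> H"
  shows "measure (\<mu> (x + z)) A - measure (\<mu> (x - z)) A = 4 * (E A x \<bullet> z)"
proof -
  have "E A z \<bullet> x = E A x \<bullet> z" using proj(5)[of A z x] assms by (simp add: inner_commute)
  then show ?thesis
    using assms by (simp add: measure_\<mu> proj(4) proj_diff inner_add_left inner_add_right
        inner_diff_left inner_diff_right)
qed

lemma parallelogram:
  assumes "A \<in> sets borel" "x \<in> H" "z \<in> H"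
  shows "measure (\<mu> (x + z)) A + measure (\<mu> (x - z)) A = 2 * measure (\<mu> x) A + 2 * measure (\<mu> z) A"
  using assms by (simp add: measure_\<mu> proj(4) proj_diff inner_add_left inner_add_right
        inner_diff_left inner_diff_right)

lemma integrable_\<mu>_le:
  fixes g :: "real \<Rightarrow> real"
  assumes g: "g \<in> borel_measurable borel" "integrable (\<mu> x) g" "integrable (\<mu> z) g"
    and H: "x \<in> H" "z \<in> H" "v \<in> H" and "c \<ge> 0"
    and le: "\<And>A. A \<in> sets borel \<Longrightarrow> measure (\<mu> v) A \<le> c * (measure (\<mu> x) A + measure (\<mu> z) A)"
  shows "integrable (\<mu> v) g"
proof (rule integrableI_bounded)
  have "(\<integral>\<^sup>+t. norm (g t) \<partial>\<mu> v) \<le> ennreal c * ((\<integral>\<^sup>+t. norm (g t) \<partial>\<mu> x) + (\<integral>\<^sup>+t. norm (g t) \<partial>\<mu> z))"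
  proof (rule nn_integral_le_of_emeasure_le[where N=borel])
    fix A :: "real set" assume "A \<in> sets borel"
    then have "ennreal (measure (\<mu> v) A) \<le> ennreal (c * (measure (\<mu> x) A + measure (\<mu> z) A))"
      by (intro ennreal_leI le)
    then show "emeasure (\<mu> v) A \<le> ennreal c * (emeasure (\<mu> x) A + emeasure (\<mu> z) A)"
      using H \<open>c \<ge> 0\<close> by (simp add: emeasure_\<mu>_measure ennreal_mult)
  qed (use g in auto)
  also have "\<dots> < \<infinity>"
    using g(2,3) by (auto simp: integrable_iff_bounded ennreal_mult_less_top)
  finally show "(\<integral>\<^sup>+t. norm (g t) \<partial>\<mu> v) < \<infinity>" .
qed (use g in simp)

text \<open>In the parallelogram law both measures on the left are nonnegative, so each is dominated
  by twice the sum of those of \<open>x\<close> and \<open>z\<close>.\<close>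

lemma integrable_\<mu>_add:
  fixes g :: "real \<Rightarrow> real"
  assumes "g \<in> borel_measurable borel" "integrable (\<mu> x) g" "integrable (\<mu> z) g" "x \<in> H" "z \<in> H"
  shows "integrable (\<mu> (x + z)) g" "integrable (\<mu> (x - z)) g"
proof -
  have "measure (\<mu> (x + z)) A \<le> 2 * (measure (\<mu> x) A + measure (\<mu> z) A) \<and>
    measure (\<mu> (x - z)) A \<le> 2 * (measure (\<mu> x) A + measure (\<mu> z) A)" if "A \<in> sets borel" for A
    using parallelogram[OF that assms(4,5)] measure_nonneg[of "\<mu> (x + z)" A]
      measure_nonneg[of "\<mu> (x - z)" A] unfolding distrib_left by linarith
  then show "integrable (\<mu> (x + z)) g" "integrable (\<mu> (x - z)) g"
    using assms by (auto intro!: integrable_\<mu>_le[where c=2 and x=x and z=z])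
qed

lemma integrable_\<mu>_scale:
  fixes g :: "real \<Rightarrow> real"
  assumes "g \<in> borel_measurable borel" "integrable (\<mu> x) g" "x \<in> H"
  shows "integrable (\<mu> (c *\<^sub>R x)) g"
proof (rule integrable_\<mu>_le[where c="c\<^sup>2" and x=x and z=x])
  fix A :: "real set" assume A: "A \<in> sets borel"
  show "measure (\<mu> (c *\<^sub>R x)) A \<le> c\<^sup>2 * (measure (\<mu> x) A + measure (\<mu> x) A)"
    unfolding measure_\<mu>_scale[OF A assms(3)] by (intro mult_left_mono) simp_all
qed (use assms in auto)

lemma integrable_\<mu>_proj:
  fixes g :: "real \<Rightarrow> real"
  assumes "g \<in> borel_measurable borel" "integrable (\<mu> x) g" "x \<in> H" "B \<in> sets borel"
  shows "integrable (\<mu> (E B x)) g"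
proof (rule integrable_\<mu>_le[where c=1 and x=x and z=x])
  fix A :: "real set" assume A: "A \<in> sets borel"
  have "measure (\<mu> x) (A \<inter> B) \<le> measure (\<mu> x) A"
    using A assms by (intro finite_measure.finite_measure_mono[OF finite_\<mu>]) auto
  then show "measure (\<mu> (E B x)) A \<le> 1 * (measure (\<mu> x) A + measure (\<mu> x) A)"
    unfolding measure_\<mu>_proj[OF A assms(4,3)] mult_1 using measure_nonneg[of "\<mu> x" A] by linarith
qed (use assms proj(1) in auto)

lemma spectral_dom_iff: "x \<in> spectral_dom H E f \<longleftrightarrow> x \<in> H \<and> integrable (\<mu> x) (\<lambda>t. (f t)\<^sup>2)"
  by (simp add: spectral_dom_def)

lemma spectral_dom_in: "x \<in> spectral_dom H E f \<Longrightarrow> x \<in> H"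
  by (simp add: spectral_dom_def)

lemma spectral_dom_closed:
  assumes "f \<in> borel_measurable borel" "x \<in> spectral_dom H E f"
  shows "z \<in> spectral_dom H E f \<Longrightarrow> x + z \<in> spectral_dom H E f"
    "z \<in> spectral_dom H E f \<Longrightarrow> x - z \<in> spectral_dom H E f"
    "c *\<^sub>R x \<in> spectral_dom H E f" "B \<in> sets borel \<Longrightarrow> E B x \<in> spectral_dom H E f"
  using assms unfolding spectral_dom_iff
  by (auto intro!: integrable_\<mu>_add integrable_\<mu>_scale integrable_\<mu>_proj proj(1))

text \<open>Spectral distributions are finite, so square integrability implies integrability. Thus
  the integrals in \<open>spectral_integral\<close> are genuine and not the default value 0.\<close>

lemma integrable_of_square:
  fixes f :: "real \<Rightarrow> real"
  assumes "f \<in> borel_measurable borel" "x \<in> spectral_dom H E f"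
  shows "integrable (\<mu> x) f"
proof (rule Bochner_Integration.integrable_bound)
  interpret finite_measure "\<mu> x" using assms by (intro finite_\<mu> spectral_dom_in)
  show "integrable (\<mu> x) (\<lambda>t. 1 + (f t)\<^sup>2)" using assms by (simp add: spectral_dom_iff)
  have "\<bar>a\<bar> \<le> 1 + a\<^sup>2" for a :: real
  proof -
    have "0 \<le> (\<bar>a\<bar> - 1)\<^sup>2" by simp
    also have "\<dots> = a\<^sup>2 + 1 - 2 * \<bar>a\<bar>" by (simp add: power2_diff)
    finally show ?thesis using abs_ge_zero[of a] by linarith
  qed
  then show "AE t in \<mu> x. norm (f t) \<le> norm (1 + (f t)\<^sup>2)"
    by simp
qed (use assms in simp)

end

section \<open>Polarized integrals and the weak functional calculus\<close>

context pvm
begin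

lemma integral_\<mu>_indicator_mult:
  assumes "B \<in> sets borel" "C \<in> sets borel"
  shows "(\<integral>t. indicator B t * indicator C t \<partial>\<mu> x) = measure (\<mu> x) (B \<inter> C)"
  using assms by (simp flip: indicator_inter_arith)

lemma integrable_\<mu>_const[simp]: "x \<in> H \<Longrightarrow> integrable (\<mu> x) (\<lambda>t. c :: real)"
  by (rule finite_measure.integrable_const[OF finite_\<mu>])

lemma integrable_\<mu>_indicator[simp]:
  "x \<in> H \<Longrightarrow> B \<in> sets borel \<Longrightarrow> integrable (\<mu> x) (indicator B :: real \<Rightarrow> real)"
  by (simp add: emeasure_\<mu>)

lemma integrable_\<mu>_indicator_mult:
  fixes f :: "real \<Rightarrow> real"
  shows "integrable (\<mu> x) f \<Longrightarrow> B \<in> sets borel \<Longrightarrow> integrable (\<mu> x) (\<lambda>t. indicator B t * f t)"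
    "integrable (\<mu> x) f \<Longrightarrow> B \<in> sets borel \<Longrightarrow> integrable (\<mu> x) (\<lambda>t. f t * indicator B t)"
  using integrable_real_mult_indicator[of B "\<mu> x" f] by (simp_all add: mult.commute)

lemma integrable_\<mu>_bounded:
  fixes f :: "real \<Rightarrow> real"
  assumes "f \<in> borel_measurable borel" "AE t in \<mu> x. \<bar>f t\<bar> \<le> C" "x \<in> H"
  shows "integrable (\<mu> x) f"
  using assms(1,2) by (intro finite_measure.integrable_const_bound[OF finite_\<mu>[OF assms(3)]]) simp_all

text \<open>A projection applied to the test vector can be moved into the integrand, because
  \<open>E C x \<bullet> E B v = E (C \<inter> B) x \<bullet> v\<close>.\<close>

lemma polar_proj:
  fixes g :: "real \<Rightarrow> real"
  assumes g: "g \<in> borel_measurable borel" and B: "B \<in> sets borel" and x: "x \<in> H" and v: "v \<in> H"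
    and int: "integrable (\<mu> (x + E B v)) g" "integrable (\<mu> (x - E B v)) g"
      "integrable (\<mu> (x + v)) (\<lambda>t. g t * indicator B t)" "integrable (\<mu> (x - v)) (\<lambda>t. g t * indicator B t)"
  shows "(\<integral>t. g t \<partial>\<mu> (x + E B v)) - (\<integral>t. g t \<partial>\<mu> (x - E B v)) =
    (\<integral>t. g t * indicator B t \<partial>\<mu> (x + v)) - (\<integral>t. g t * indicator B t \<partial>\<mu> (x - v))"
proof -
  let ?L = "[(1, \<mu> (x + E B v), \<lambda>t. 1), (-1, \<mu> (x - E B v), \<lambda>t. 1),
    (-1, \<mu> (x + v), indicator B), (1, \<mu> (x - v), indicator B)] :: (real \<times> real measure \<times> (real \<Rightarrow> real)) list"
  have v': "E B v \<in> H" using B v by (rule proj)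
  have "(\<Sum>(c, M, h)\<leftarrow>?L. c * (\<integral>t. g t * h t \<partial>M)) = 0"
  proof (rule weighted_measures_integral_zero[OF g])
    fix C :: "real set" assume C: "C \<in> sets borel"
    have "E C x \<bullet> E B v = E B (E C x) \<bullet> v"
      using proj(5)[OF B proj(1)[OF C x] v] by simp
    then have "E C x \<bullet> E B v = E (C \<inter> B) x \<bullet> v"
      by (simp only: proj_proj[OF B C x] inf_commute)
    then show "(\<Sum>(c, M, h)\<leftarrow>?L. c * (\<integral>t. indicator C t * h t \<partial>M)) = 0"
      using polarization[OF C x v'] polarization[OF _ x v, of "C \<inter> B"] B C
      by (simp add: integral_\<mu>_indicator_mult)
  next
    fix c M h assume "(c, M, h) \<in> set ?L"
    then show "integrable M h" using x v v' B by auto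
  next
    fix c M h assume "(c, M, h) \<in> set ?L"
    then show "integrable M (\<lambda>t. g t * h t)" using int by auto
  qed auto
  then show ?thesis by simp
qed

text \<open>Here \<open>\<mu> (x + x)\<close> is four times \<open>\<mu> x\<close>, and
  \<open>\<mu> (x - x)\<close> is the zero measure.\<close>

lemma polar_diag:
  fixes g :: "real \<Rightarrow> real"
  assumes g: "g \<in> borel_measurable borel" and x: "x \<in> H" and int: "integrable (\<mu> x) g"
  shows "(\<integral>t. g t \<partial>\<mu> (x + x)) - (\<integral>t. g t \<partial>\<mu> (x - x)) = 4 * (\<integral>t. g t \<partial>\<mu> x)"
proof -
  let ?L = "[(1, \<mu> (x + x), \<lambda>t. 1), (-1, \<mu> (x - x), \<lambda>t. 1),
    (-4, \<mu> x, \<lambda>t. 1)] :: (real \<times> real measure \<times> (real \<Rightarrow> real)) list"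
  have "(\<Sum>(c, M, h)\<leftarrow>?L. c * (\<integral>t. g t * h t \<partial>M)) = 0"
  proof (rule weighted_measures_integral_zero[OF g])
    fix C :: "real set" assume C: "C \<in> sets borel"
    then show "(\<Sum>(c, M, h)\<leftarrow>?L. c * (\<integral>t. indicator C t * h t \<partial>M)) = 0"
      using polarization[OF C x x] measure_\<mu>[OF C x] by simp
  next
    fix c M h assume "(c, M, h) \<in> set ?L"
    then show "integrable M h" using integrable_\<mu>_const x by auto
  next
    fix c M h assume "(c, M, h) \<in> set ?L"
    then show "integrable M (\<lambda>t. g t * h t)"
      using int integrable_\<mu>_add[OF g int int x x] by auto
  qed auto
  then show ?thesis by simp
qed

lemma spectral_integralD:
  assumes "(x, y) \<in> spectral_integral H E f"
  shows "x \<in> spectral_dom H E f" "x \<in> H" "y \<in> H"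
    "z \<in> spectral_dom H E f \<Longrightarrow> 4 * (y \<bullet> z) = (\<integral>t. f t \<partial>\<mu> (x + z)) - (\<integral>t. f t \<partial>\<mu> (x - z))"
  using assms spectral_dom_in by (auto simp: spectral_integral_def)

lemma integrable_dom_polar:
  assumes "f \<in> borel_measurable borel" "x \<in> spectral_dom H E f" "z \<in> spectral_dom H E f"
  shows "integrable (\<mu> (x + z)) f" "integrable (\<mu> (x - z)) f"
  using assms by (auto intro!: integrable_of_square spectral_dom_closed)

text \<open>The defining identity localized to \<open>B\<close>: the projection passes to the test
  vector, which stays in the domain, and from there into the integrand.\<close>

lemma spectral_integral_set:
  assumes f: "f \<in> borel_measurable borel" and xy: "(x, y) \<in> spectral_integral H E f"
    and z: "z \<in> spectral_dom H E f" and B: "B \<in> sets borel"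
  shows "4 * (E B y \<bullet> z) =
    (\<integral>t. indicator B t * f t \<partial>\<mu> (x + z)) - (\<integral>t. indicator B t * f t \<partial>\<mu> (x - z))"
proof -
  note D = spectral_integralD[OF xy]
  have z': "E B z \<in> spectral_dom H E f" using f z B by (intro spectral_dom_closed)
  have "4 * (E B y \<bullet> z) = 4 * (y \<bullet> E B z)" using proj(5)[OF B D(3) spectral_dom_in[OF z]] by simp
  also have "\<dots> = (\<integral>t. f t \<partial>\<mu> (x + E B z)) - (\<integral>t. f t \<partial>\<mu> (x - E B z))" by (rule D(4)[OF z'])
  also have "\<dots> = (\<integral>t. f t * indicator B t \<partial>\<mu> (x + z)) - (\<integral>t. f t * indicator B t \<partial>\<mu> (x - z))"
    using integrable_dom_polar[OF f D(1) z'] integrable_dom_polar[OF f D(1) z]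
      integrable_\<mu>_indicator_mult(2)[OF _ B]
    by (intro polar_proj f B D(2) spectral_dom_in[OF z])
  finally show ?thesis by (simp only: mult.commute[of "indicator B _"])
qed

text \<open>Weak form of multiplicativity: the signed measure of \<open>y\<close> and
  \<open>z\<close> has density \<open>f\<close> with respect to that of \<open>x\<close> and
  \<open>z\<close>, first on sets and then against \<open>g\<close>. Compositions of spectral
  integrals are treated by using it repeatedly.\<close>

lemma spectral_integral_polar:
  fixes g :: "real \<Rightarrow> real"
  assumes f: "f \<in> borel_measurable borel" and xy: "(x, y) \<in> spectral_integral H E f"
    and z: "z \<in> spectral_dom H E f" and g: "g \<in> borel_measurable borel"
    and int: "integrable (\<mu> (y + z)) g" "integrable (\<mu> (y - z)) g"
      "integrable (\<mu> (x + z)) (\<lambda>t. g t * f t)" "integrable (\<mu> (x - z)) (\<lambda>t. g t * f t)"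
  shows "(\<integral>t. g t \<partial>\<mu> (y + z)) - (\<integral>t. g t \<partial>\<mu> (y - z)) =
    (\<integral>t. g t * f t \<partial>\<mu> (x + z)) - (\<integral>t. g t * f t \<partial>\<mu> (x - z))"
proof -
  let ?L = "[(1, \<mu> (y + z), \<lambda>t. 1), (-1, \<mu> (y - z), \<lambda>t. 1),
    (-1, \<mu> (x + z), f), (1, \<mu> (x - z), f)] :: (real \<times> real measure \<times> (real \<Rightarrow> real)) list"
  note D = spectral_integralD[OF xy] and zH = spectral_dom_in[OF z]
  have "(\<Sum>(c, M, h)\<leftarrow>?L. c * (\<integral>t. g t * h t \<partial>M)) = 0"
  proof (rule weighted_measures_integral_zero[OF g])
    fix C :: "real set" assume C: "C \<in> sets borel"
    show "(\<Sum>(c, M, h)\<leftarrow>?L. c * (\<integral>t. indicator C t * h t \<partial>M)) = 0"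
      using polarization[OF C D(3) zH] spectral_integral_set[OF f xy z C] C by simp
  next
    fix c M h assume "(c, M, h) \<in> set ?L"
    then show "integrable M h"
      using D(2,3) zH integrable_dom_polar[OF f D(1) z] by auto
  next
    fix c M h assume "(c, M, h) \<in> set ?L"
    then show "integrable M (\<lambda>t. g t * h t)" using int by auto
  qed auto
  then show ?thesis by simp
qed

lemma spectral_integral_diag:
  assumes f: "f \<in> borel_measurable borel" and xy: "(x, y) \<in> spectral_integral H E f"
    and B: "B \<in> sets borel"
  shows "E B y \<bullet> x = (\<integral>t. indicator B t * f t \<partial>\<mu> x)"
proof -
  note D = spectral_integralD[OF xy]
  have "integrable (\<mu> x) (\<lambda>t. indicator B t * f t)"
    using integrable_of_square[OF f D(1)] B by (rule integrable_\<mu>_indicator_mult(1))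
  then have "4 * (E B y \<bullet> x) = 4 * (\<integral>t. indicator B t * f t \<partial>\<mu> x)"
    unfolding spectral_integral_set[OF f xy D(1) B]
    using f B by (intro polar_diag D) auto
  then show ?thesis by simp
qed

lemma spectral_integral_inner:
  assumes "f \<in> borel_measurable borel" "(x, y) \<in> spectral_integral H E f"
  shows "y \<bullet> x = (\<integral>t. f t \<partial>\<mu> x)"
  using spectral_integral_diag[OF assms, of UNIV] spectral_integralD(3)[OF assms(2)] by simp

lemma AE_\<mu>_proj:
  assumes "B \<in> sets borel" "x \<in> H"
  shows "AE t in \<mu> (E B x). t \<in> B"
proof (rule AE_I[where N="- B"])
  show "emeasure (\<mu> (E B x)) (- B) = 0"
    using assms measure_\<mu>_proj[of "- B" B x] emeasure_\<mu>_measure[OF proj(1)[OF assms]] by simp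
qed (use assms in auto)

text \<open>Formally, testing \<open>y\<close> with itself produces \<open>f\<close> twice. But
  \<open>y\<close> need not lie in the domain of \<open>f\<close>, so the computation runs on
  truncations of \<open>A\<close> where \<open>f\<close> is bounded and then passes to the
  limit.\<close>

lemma spectral_integral_measure:
  assumes f: "f \<in> borel_measurable borel" and xy: "(x, y) \<in> spectral_integral H E f"
    and A: "A \<in> sets borel"
  shows "measure (\<mu> y) A = (\<integral>t. indicator A t * (f t)\<^sup>2 \<partial>\<mu> x)"
proof -
  note D = spectral_integralD[OF xy]
  define B where "B n = A \<inter> {t. \<bar>f t\<bar> \<le> real n}" for n
  have B: "B n \<in> sets borel" for n unfolding B_def using A f by measurable
  have f2: "integrable (\<mu> x) (\<lambda>t. (f t)\<^sup>2)" using D(1) by (simp add: spectral_dom_iff)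
  have eq: "measure (\<mu> y) (B n) = (\<integral>t. indicator (B n) t * (f t)\<^sup>2 \<partial>\<mu> x)" for n
  proof -
    \<comment> \<open>The projected vector has its spectral distribution on \<open>B n\<close>,
      where \<open>\<bar>f t\<bar> \<le> n\<close>; this puts it into the domain.\<close>
    define z where "z = E (B n) y"
    define g where "g t = indicator (B n) t * f t" for t
    have g: "g \<in> borel_measurable borel" unfolding g_def using f B by measurable
    have gb: "\<bar>g t\<bar> \<le> real n" for t by (auto simp: g_def B_def indicator_def)
    have int_g: "integrable (\<mu> v) g" if "v \<in> H" for v
      using gb g that by (intro integrable_\<mu>_bounded) auto
    have zH: "z \<in> H" unfolding z_def using B D(3) by (rule proj)
    have z: "z \<in> spectral_dom H E f"
      unfolding spectral_dom_iff
    proof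
      show "integrable (\<mu> z) (\<lambda>t. (f t)\<^sup>2)"
      proof (rule integrable_\<mu>_bounded)
        have "AE t in \<mu> z. t \<in> B n" unfolding z_def using B D(3) by (rule AE_\<mu>_proj)
        then show "AE t in \<mu> z. \<bar>(f t)\<^sup>2\<bar> \<le> (real n)\<^sup>2"
          by eventually_elim (auto simp: B_def intro: abs_le_square_iff[THEN iffD1])
      qed (use f zH in auto)
    qed (rule zH)
    have ind: "g t * indicator (B n) t = g t" for t by (simp add: g_def indicator_def)
    have gf: "g t * f t = indicator (B n) t * (f t)\<^sup>2" for t by (simp add: g_def power2_eq_square)
    have int_gf: "integrable (\<mu> x) (\<lambda>t. g t * f t)"
      unfolding gf using f2 B by (rule integrable_\<mu>_indicator_mult(1))
    have gf_meas: "(\<lambda>t. g t * f t) \<in> borel_measurable borel" using f g by measurable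
    have "E (B n) y \<bullet> z = E (B n) y \<bullet> y"
      unfolding z_def using proj(5)[of "B n" "E (B n) y" y] proj(1,2)[OF B[of n] D(3)] D(3) B[of n] by simp
    then have "4 * measure (\<mu> y) (B n) = 4 * (E (B n) y \<bullet> z)"
      by (simp add: measure_\<mu>[OF B D(3)])
    also have "\<dots> = (\<integral>t. g t \<partial>\<mu> (x + z)) - (\<integral>t. g t \<partial>\<mu> (x - z))"
      unfolding g_def by (rule spectral_integral_set[OF f xy z B])
    also have "\<dots> = (\<integral>t. g t \<partial>\<mu> (x + y)) - (\<integral>t. g t \<partial>\<mu> (x - y))"
      using polar_proj[OF g B[of n] D(2,3), folded z_def, unfolded ind] int_g D(2,3) zH
      by (simp add: z_def)
    \<comment> \<open>Exchanging the two vectors allows \<open>y\<close> to be replaced by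
      \<open>x\<close> a second time, now with \<open>x\<close> as test vector; this yields the
      second factor \<open>f\<close>.\<close>
    also have "\<dots> = (\<integral>t. g t \<partial>\<mu> (y + x)) - (\<integral>t. g t \<partial>\<mu> (y - x))"
      using \<mu>_diff_commute[OF D(2,3)] by (simp add: add.commute)
    also have "\<dots> = (\<integral>t. g t * f t \<partial>\<mu> (x + x)) - (\<integral>t. g t * f t \<partial>\<mu> (x - x))"
      using integrable_\<mu>_add[OF gf_meas int_gf int_gf D(2,2)] int_g D
      by (intro spectral_integral_polar[OF f xy D(1) g]) auto
    also have "\<dots> = 4 * (\<integral>t. g t * f t \<partial>\<mu> x)"
      by (rule polar_diag[OF gf_meas D(2) int_gf])
    finally show ?thesis unfolding gf by simp
  qed
  have mono: "incseq B" by (auto simp: incseq_def B_def)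
  have UN: "(\<Union>n. B n) = A"
    unfolding B_def using real_arch_simple by auto
  have "(\<lambda>n. measure (\<mu> y) (B n)) \<longlonglongrightarrow> measure (\<mu> y) (\<Union>n. B n)"
    using B mono by (intro finite_measure.finite_Lim_measure_incseq[OF finite_\<mu>[OF D(3)]]) auto
  moreover have "(\<lambda>n. \<integral>t. indicator (B n) t * (f t)\<^sup>2 \<partial>\<mu> x) \<longlonglongrightarrow> (\<integral>t. indicator A t * (f t)\<^sup>2 \<partial>\<mu> x)"
  proof (rule integral_dominated_convergence[OF _ _ f2])
    show "AE t in \<mu> x. (\<lambda>n. indicator (B n) t * (f t)\<^sup>2) \<longlonglongrightarrow> indicator A t * (f t)\<^sup>2"
    proof (rule AE_I2)
      fix t
      have "(\<lambda>n. indicator (B n) t :: real) \<longlonglongrightarrow> indicator (\<Union>n. B n) t"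
        using mono by (rule LIMSEQ_indicator_incseq)
      then show "(\<lambda>n. indicator (B n) t * (f t)\<^sup>2) \<longlonglongrightarrow> indicator A t * (f t)\<^sup>2"
        unfolding UN by (rule tendsto_mult_right)
    qed
    show "(\<lambda>t. indicator A t * (f t)\<^sup>2) \<in> borel_measurable (\<mu> x)" using f A by simp
    show "(\<lambda>t. indicator (B n) t * (f t)\<^sup>2) \<in> borel_measurable (\<mu> x)" for n using f B by simp
    show "AE t in \<mu> x. norm (indicator (B n) t * (f t)\<^sup>2) \<le> (f t)\<^sup>2" for n
      by (intro AE_I2) (auto simp: indicator_def)
  qed
  ultimately show ?thesis unfolding eq UN using LIMSEQ_unique by blast
qed

text \<open>The density form transfers integrability questions from \<open>y\<close> back to
  \<open>x\<close>.\<close>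

lemma spectral_integral_density:
  assumes f: "f \<in> borel_measurable borel" and xy: "(x, y) \<in> spectral_integral H E f"
  shows "\<mu> y = density (\<mu> x) (\<lambda>t. ennreal ((f t)\<^sup>2))"
proof (rule measure_eqI)
  note D = spectral_integralD[OF xy]
  fix A assume "A \<in> sets (\<mu> y)"
  then have A: "A \<in> sets borel" by simp
  have "integrable (\<mu> x) (\<lambda>t. indicator A t * (f t)\<^sup>2)"
    using D(1) A by (intro integrable_\<mu>_indicator_mult(1)) (simp_all add: spectral_dom_iff)
  then have "ennreal (\<integral>t. indicator A t * (f t)\<^sup>2 \<partial>\<mu> x) = (\<integral>\<^sup>+t. ennreal (indicator A t * (f t)\<^sup>2) \<partial>\<mu> x)"
    by (intro nn_integral_eq_integral[symmetric]) auto
  also have "\<dots> = (\<integral>\<^sup>+t. ennreal ((f t)\<^sup>2) * indicator A t \<partial>\<mu> x)"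
    by (intro nn_integral_cong) (auto simp: indicator_def)
  also have "\<dots> = emeasure (density (\<mu> x) (\<lambda>t. ennreal ((f t)\<^sup>2))) A"
    using f A by (subst emeasure_density) auto
  finally show "emeasure (\<mu> y) A = emeasure (density (\<mu> x) (\<lambda>t. ennreal ((f t)\<^sup>2))) A"
    using spectral_integral_measure[OF f xy A] emeasure_\<mu>_measure[OF D(3)] by simp
qed simp

end

text \<open>Origin of \<open>c_const\<close>: weighted Young with weights \<beta> and 1 - \<beta> at
  the points t / \<beta> and \<alpha> / (1 - \<beta>), chosen so that the weighted sum is t +
  \<alpha>. For \<beta> = 1 these points degenerate, and the bound is just t \<le> t +
  \<alpha>.\<close>

lemma holder_source_bound:
  assumes "0 \<le> t" "0 < \<alpha>" "0 < \<beta>" "\<beta> \<le> 1"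
  shows "\<alpha> * t powr \<beta> \<le> c_const \<beta> * \<alpha> powr \<beta> * (t + \<alpha>)"
proof (cases "\<beta> = 1")
  case True
  then show ?thesis using assms by (simp add: c_const_def mult_left_mono)
next
  case False
  then have b: "0 < \<beta>" "0 < 1 - \<beta>" using assms by auto
  show ?thesis
  proof (cases "t = 0")
    case True
    then show ?thesis using assms by (simp add: c_const_def)
  next
    case False
    then have t: "t > 0" using assms by simp
    have "(t / \<beta>) powr \<beta> * (\<alpha> / (1 - \<beta>)) powr (1 - \<beta>) \<le> \<beta> * (t / \<beta>) + (1 - \<beta>) * (\<alpha> / (1 - \<beta>))"
      by (rule Youngs_inequality_0) (use b t assms in auto)
    also have "\<dots> = t + \<alpha>" using b by simp
    also have "(t / \<beta>) powr \<beta> * (\<alpha> / (1 - \<beta>)) powr (1 - \<beta>) =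
        t powr \<beta> * \<alpha> powr (1 - \<beta>) / c_const \<beta>"
      using b t assms \<open>\<beta> \<noteq> 1\<close> by (simp add: c_const_def powr_divide)
    finally have "t powr \<beta> * \<alpha> powr (1 - \<beta>) \<le> c_const \<beta> * (t + \<alpha>)"
      using b \<open>\<beta> \<noteq> 1\<close> by (simp add: c_const_def pos_divide_le_eq mult.commute)
    then have "t powr \<beta> * \<alpha> powr (1 - \<beta>) * \<alpha> powr \<beta> \<le> c_const \<beta> * (t + \<alpha>) * \<alpha> powr \<beta>"
      by (rule mult_right_mono) simp
    moreover have "t powr \<beta> * \<alpha> powr (1 - \<beta>) * \<alpha> powr \<beta> = \<alpha> * t powr \<beta>"
      using assms by (simp add: mult.assoc flip: powr_add)
    ultimately show ?thesis by (simp only: mult.assoc mult.left_commute mult.commute)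
  qed
qed

section \<open>Bounded functions, lower spectral bounds and the bias estimate\<close>

context pvm
begin

lemma abs_integral_\<mu>_le:
  fixes f :: "real \<Rightarrow> real"
  assumes f: "f \<in> borel_measurable borel" and C: "AE t in \<mu> x. \<bar>f t\<bar> \<le> C" and x: "x \<in> H"
  shows "\<bar>\<integral>t. f t \<partial>\<mu> x\<bar> \<le> C * (x \<bullet> x)"
proof -
  have int: "integrable (\<mu> x) f" using assms by (rule integrable_\<mu>_bounded)
  have "\<bar>\<integral>t. f t \<partial>\<mu> x\<bar> \<le> (\<integral>t. \<bar>f t\<bar> \<partial>\<mu> x)" by (rule integral_abs_bound)
  also have "\<dots> \<le> (\<integral>t. C \<partial>\<mu> x)"
    using int C x by (intro integral_mono_AE) simp_all
  also have "\<dots> = C * (x \<bullet> x)" using x by simp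
  finally show ?thesis .
qed

lemma spectral_dom_bounded:
  fixes f :: "real \<Rightarrow> real"
  assumes f: "f \<in> borel_measurable borel" and C: "\<And>x. x \<in> H \<Longrightarrow> AE t in \<mu> x. \<bar>f t\<bar> \<le> C"
  shows "spectral_dom H E f = H"
proof -
  have "integrable (\<mu> x) (\<lambda>t. (f t)\<^sup>2)" if x: "x \<in> H" for x
  proof (rule integrable_\<mu>_bounded[OF _ _ x])
    show "AE t in \<mu> x. \<bar>(f t)\<^sup>2\<bar> \<le> C\<^sup>2"
      using C[OF x] by eventually_elim (simp add: power2_le_iff_abs_le power_mono abs_le_square_iff[symmetric])
  qed (use f in simp)
  then show ?thesis by (auto simp: spectral_dom_iff)
qed

text \<open>Riesz representation of the polarized integral as a functional of \<open>z\<close>.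
  Linearity is checked on sets by \<open>polarization\<close>; boundedness is checked on unit
  vectors and extended by homogeneity.\<close>

lemma spectral_integral_exists:
  fixes f :: "real \<Rightarrow> real"
  assumes f: "f \<in> borel_measurable borel" and C: "\<And>x. x \<in> H \<Longrightarrow> AE t in \<mu> x. \<bar>f t\<bar> \<le> C"
    and x: "x \<in> H"
  shows "\<exists>y. (x, y) \<in> spectral_integral H E f"
proof -
  define \<phi> where "\<phi> z = ((\<integral>t. f t \<partial>\<mu> (x + z)) - (\<integral>t. f t \<partial>\<mu> (x - z))) / 4" for z
  have int: "integrable (\<mu> v) f" if "v \<in> H" for v
    using f C[OF that] that by (rule integrable_\<mu>_bounded)
  have add: "\<phi> (u + v) = \<phi> u + \<phi> v" if u: "u \<in> H" and v: "v \<in> H" for u v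
  proof -
    let ?L = "[(1, \<mu> (x + (u + v)), \<lambda>t. 1), (-1, \<mu> (x - (u + v)), \<lambda>t. 1),
      (-1, \<mu> (x + u), \<lambda>t. 1), (1, \<mu> (x - u), \<lambda>t. 1),
      (-1, \<mu> (x + v), \<lambda>t. 1), (1, \<mu> (x - v), \<lambda>t. 1)] :: (real \<times> real measure \<times> (real \<Rightarrow> real)) list"
    have "(\<Sum>(c, M, h)\<leftarrow>?L. c * (\<integral>t. f t * h t \<partial>M)) = 0"
    proof (rule weighted_measures_integral_zero[OF f])
      fix B :: "real set" assume B: "B \<in> sets borel"
      then show "(\<Sum>(c, M, h)\<leftarrow>?L. c * (\<integral>t. indicator B t * h t \<partial>M)) = 0"
        using polarization[OF B x closed(2)[OF u v]] polarization[OF B x u] polarization[OF B x v]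
        by (simp add: inner_add_right)
    next
      fix c M h assume "(c, M, h) \<in> set ?L"
      then show "integrable M h" using x u v by auto
    next
      fix c M h assume "(c, M, h) \<in> set ?L"
      then show "integrable M (\<lambda>t. f t * h t)" using x u v int by auto
    qed auto
    then show ?thesis by (simp add: \<phi>_def field_simps)
  qed
  have scale: "\<phi> (c *\<^sub>R u) = c * \<phi> u" if u: "u \<in> H" for c u
  proof -
    let ?L = "[(1, \<mu> (x + c *\<^sub>R u), \<lambda>t. 1), (-1, \<mu> (x - c *\<^sub>R u), \<lambda>t. 1),
      (-c, \<mu> (x + u), \<lambda>t. 1), (c, \<mu> (x - u), \<lambda>t. 1)] :: (real \<times> real measure \<times> (real \<Rightarrow> real)) list"
    have "(\<Sum>(c, M, h)\<leftarrow>?L. c * (\<integral>t. f t * h t \<partial>M)) = 0"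
    proof (rule weighted_measures_integral_zero[OF f])
      fix B :: "real set" assume B: "B \<in> sets borel"
      have "c * measure (\<mu> (x + u)) B - c * measure (\<mu> (x - u)) B = c * (4 * (E B x \<bullet> u))"
        using polarization[OF B x u] by (simp only: right_diff_distrib[symmetric])
      then show "(\<Sum>(c, M, h)\<leftarrow>?L. c * (\<integral>t. indicator B t * h t \<partial>M)) = 0"
        using polarization[OF B x closed(4)[OF u, of c]] B by simp
    next
      fix c M h assume "(c, M, h) \<in> set ?L"
      then show "integrable M h" using x u by auto
    next
      fix c M h assume "(c, M, h) \<in> set ?L"
      then show "integrable M (\<lambda>t. f t * h t)" using x u int by auto
    qed auto
    then show ?thesis by (simp add: \<phi>_def right_diff_distrib)
  qed
  \<comment> \<open>The cross terms of \<open>x + z\<close> and \<open>x - z\<close> cancel, leaving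
    C (2 |x|^2 + 2) / 4 for a unit vector \<open>z\<close>.\<close>
  define D where "D = C * (x \<bullet> x + 1) / 2"
  have unit: "\<bar>\<phi> z\<bar> \<le> D" if z: "z \<in> H" "norm z = 1" for z
  proof -
    have "\<bar>\<integral>t. f t \<partial>\<mu> (x + z)\<bar> \<le> C * ((x + z) \<bullet> (x + z))"
      "\<bar>\<integral>t. f t \<partial>\<mu> (x - z)\<bar> \<le> C * ((x - z) \<bullet> (x - z))"
      using f C x z by (auto intro!: abs_integral_\<mu>_le)
    then have "\<bar>\<phi> z\<bar> \<le> (C * ((x + z) \<bullet> (x + z)) + C * ((x - z) \<bullet> (x - z))) / 4"
      by (simp add: \<phi>_def abs_le_iff)
    also have "(x + z) \<bullet> (x + z) = x \<bullet> x + 2 * (x \<bullet> z) + 1"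
      using z by (simp add: inner_add_left inner_add_right inner_commute norm_eq_1)
    also have "(x - z) \<bullet> (x - z) = x \<bullet> x - 2 * (x \<bullet> z) + 1"
      using z by (simp add: inner_diff_left inner_diff_right inner_commute norm_eq_1)
    finally show ?thesis by (simp add: D_def field_simps)
  qed
  have "\<exists>y\<in>H. \<forall>z\<in>H. y \<bullet> z = \<phi> z"
  proof (rule riesz[OF add scale])
    fix z assume z: "z \<in> H"
    show "\<bar>\<phi> z\<bar> \<le> D * sqrt (z \<bullet> z)"
    proof (cases "z = 0")
      case True
      then show ?thesis using scale[OF z, of 0] by simp
    next
      case False
      have "\<phi> z = norm z * \<phi> ((1 / norm z) *\<^sub>R z)"
        using False scale[OF z, of "1 / norm z"] by simp
      moreover have "\<bar>\<phi> ((1 / norm z) *\<^sub>R z)\<bar> \<le> D" using False z by (intro unit) auto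
      ultimately show ?thesis
        by (simp add: abs_mult mult.commute[of D] mult_left_mono flip: norm_eq_sqrt_inner)
    qed
  qed
  then show ?thesis
    using spectral_dom_bounded[OF f C] x by (auto simp: spectral_integral_def \<phi>_def)
qed

text \<open>Expansion of the square: \<open>spectral_integral_measure\<close> gives the t^2 part,
  and \<open>spectral_integral_diag\<close> the cross term. This describes the distribution of T x +
  \<alpha> x.\<close>

lemma measure_shifted:
  assumes xy: "(x, y) \<in> spectral_integral H E (\<lambda>t. t)" and B: "B \<in> sets borel"
  shows "measure (\<mu> (y + \<alpha> *\<^sub>R x)) B = (\<integral>t. indicator B t * (t + \<alpha>)\<^sup>2 \<partial>\<mu> x)"
proof -
  note D = spectral_integralD[OF xy]
  have id: "(\<lambda>t::real. t) \<in> borel_measurable borel" by simp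
  have int: "integrable (\<mu> x) (\<lambda>t. indicator B t * t\<^sup>2)" "integrable (\<mu> x) (\<lambda>t. indicator B t * t)"
    using D(1) integrable_of_square[OF id D(1)] B
    by (auto intro!: integrable_\<mu>_indicator_mult(1) simp: spectral_dom_iff)
  have intB: "integrable (\<mu> x) (indicator B :: real \<Rightarrow> real)" using D(2) B by simp
  have sym: "E B x \<bullet> y = E B y \<bullet> x" using proj(5)[OF B D(2,3)] by (simp add: inner_commute)
  have "measure (\<mu> (y + \<alpha> *\<^sub>R x)) B = measure (\<mu> y) B + 2 * \<alpha> * (E B y \<bullet> x) + \<alpha>\<^sup>2 * measure (\<mu> x) B"
    using D(2,3) B sym
    by (simp add: measure_\<mu> proj(3,4) inner_add_left inner_add_right power2_eq_square algebra_simps)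
  also have "\<dots> = (\<integral>t. indicator B t * t\<^sup>2 \<partial>\<mu> x) + 2 * \<alpha> * (\<integral>t. indicator B t * t \<partial>\<mu> x)
      + \<alpha>\<^sup>2 * (\<integral>t. indicator B t \<partial>\<mu> x)"
    using B by (simp add: spectral_integral_measure[OF id xy B] spectral_integral_diag[OF id xy B])
  also have "\<dots> = (\<integral>t. indicator B t * t\<^sup>2 + 2 * \<alpha> * (indicator B t * t) + \<alpha>\<^sup>2 * indicator B t \<partial>\<mu> x)"
    using int intB
    by simp
  also have "\<dots> = (\<integral>t. indicator B t * (t + \<alpha>)\<^sup>2 \<partial>\<mu> x)"
    by (intro Bochner_Integration.integral_cong) (auto simp: power2_sum indicator_def)
  finally show ?thesis .
qed

lemma integrable_shifted:
  assumes "x \<in> spectral_dom H E (\<lambda>t. t)"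
  shows "integrable (\<mu> x) (\<lambda>t. (t + \<alpha>)\<^sup>2)"
proof -
  have "integrable (\<mu> x) (\<lambda>t. t)" using assms by (intro integrable_of_square) auto
  then show ?thesis using assms spectral_dom_in[OF assms]
    by (simp add: spectral_dom_iff power2_sum)
qed

lemma \<mu>_zero_iff:
  assumes "x \<in> H" shows "(AE t in \<mu> x. False) \<longleftrightarrow> x = 0"
proof -
  have "(AE t in \<mu> x. False) \<longleftrightarrow> emeasure (\<mu> x) UNIV = 0"
    using AE_iff_measurable[of UNIV "\<mu> x" "\<lambda>t. False"] by simp
  also have "\<dots> \<longleftrightarrow> x = 0"
  proof -
    have "x \<bullet> x \<le> 0 \<longleftrightarrow> x = 0" by (metis inner_eq_zero_iff inner_ge_zero order_antisym)
    then show ?thesis using assms by (simp add: emeasure_\<mu> ennreal_eq_0_iff)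
  qed
  finally show ?thesis .
qed

lemma spectral_integral_zero:
  assumes f: "f \<in> borel_measurable borel" and "(0, y) \<in> spectral_integral H E f"
  shows "y = 0"
proof -
  note D = spectral_integralD[OF assms(2)]
  have "AE t in \<mu> 0. False" using \<mu>_zero_iff[of 0] by simp
  then have "(\<integral>t. indicator UNIV t * (f t)\<^sup>2 \<partial>\<mu> 0) = 0"
    by (intro integral_eq_zero_AE) auto
  then show ?thesis using spectral_integral_measure[OF assms, of UNIV] D(3) by simp
qed

text \<open>The solution \<open>p\<close> of \<open>T p + \<alpha> p = E A x\<close> for \<open>A = {..<m}\<close> has its spectral distribution on \<open>A\<close>,
  where the lower bound fails, so \<open>p = 0\<close>.\<close>

lemma spectral_lower_bound:
  assumes resolvent: "\<And>x. x \<in> H \<Longrightarrow> \<exists>p y. (p, y) \<in> spectral_integral H E (\<lambda>t. t) \<and> y + \<alpha> *\<^sub>R p = x"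
    and bound: "\<And>p y. (p, y) \<in> spectral_integral H E (\<lambda>t. t) \<Longrightarrow> m * (p \<bullet> p) \<le> y \<bullet> p"
    and m: "- \<alpha> < m" and x: "x \<in> H"
  shows "AE t in \<mu> x. m \<le> t"
proof -
  let ?A = "{..<m}"
  have A: "?A \<in> sets borel" by simp
  obtain p y where py: "(p, y) \<in> spectral_integral H E (\<lambda>t. t)" and y: "y + \<alpha> *\<^sub>R p = E ?A x"
    using resolvent[OF proj(1)[OF A x]] by blast
  note D = spectral_integralD[OF py]
  have id: "(\<lambda>t::real. t) \<in> borel_measurable borel" by simp
  \<comment> \<open>The vector \<open>E ?A x\<close> has distribution (t + \<alpha>)^2 times that of
    \<open>p\<close>, and no mass off \<open>?A\<close>. Since m > -\<alpha>, the weight is positive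
    there, so \<open>p\<close> has no mass off \<open>?A\<close> either.\<close>
  have "(\<integral>t. indicator (- ?A) t * (t + \<alpha>)\<^sup>2 \<partial>\<mu> p) = measure (\<mu> (E ?A x)) (- ?A)"
    using measure_shifted[OF py, of "- ?A" \<alpha>] A by (simp add: y)
  also have "\<dots> = 0"
    unfolding measure_\<mu>_proj[OF borel_comp[OF A] A x] Compl_disjoint2 by simp
  finally have "AE t in \<mu> p. indicator (- ?A) t * (t + \<alpha>)\<^sup>2 = 0"
    using integrable_\<mu>_indicator_mult(1)[OF integrable_shifted[OF D(1)], of "- ?A" \<alpha>]
    by (subst (asm) integral_nonneg_eq_0_iff_AE) auto
  then have p_less: "AE t in \<mu> p. t < m"
    by eventually_elim (use m in \<open>auto simp: indicator_def split: if_splits\<close>)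
  have int_t: "integrable (\<mu> p) (\<lambda>t. t)" by (rule integrable_of_square[OF id D(1)])
  \<comment> \<open>The integrand is positive almost everywhere, whereas \<open>bound\<close> makes
    the integral nonpositive; hence the measure of \<open>p\<close> is zero.\<close>
  have "(\<integral>t. m - t \<partial>\<mu> p) = m * (p \<bullet> p) - y \<bullet> p"
    using int_t D(2) spectral_integral_inner[OF id py] by simp
  also have "\<dots> \<le> 0" using bound[OF py] by simp
  moreover have "0 \<le> (\<integral>t. m - t \<partial>\<mu> p)"
    by (rule integral_nonneg_AE) (use p_less in eventually_elim, simp)
  ultimately have "(\<integral>t. m - t \<partial>\<mu> p) = 0" by linarith
  moreover have "AE t in \<mu> p. 0 \<le> m - t" using p_less by eventually_elim simp
  ultimately have "AE t in \<mu> p. m - t = 0"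
    using int_t D(2) by (subst (asm) integral_nonneg_eq_0_iff_AE) auto
  then have "AE t in \<mu> p. False" using p_less by eventually_elim simp
  then have "p = 0" using \<mu>_zero_iff[OF D(2)] by simp
  moreover from this have "y = 0" using spectral_integral_zero[OF id] py by simp
  ultimately have "E ?A x = 0" using y by simp
  then have "emeasure (\<mu> x) ?A = 0" using emeasure_\<mu>[OF A x] by simp
  then show ?thesis by (intro AE_I[where N="?A"]) auto
qed

lemma source_bias_bound:
  assumes py: "(p, y) \<in> spectral_integral H E (\<lambda>t. t)"
    and wz: "(w, z) \<in> spectral_integral H E (\<lambda>t. t powr \<beta>)"
    and eq: "y + \<alpha> *\<^sub>R p = \<alpha> *\<^sub>R z"
    and pos: "AE t in \<mu> p. 0 \<le> t" "AE t in \<mu> w. 0 \<le> t"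
    and "0 < \<alpha>" "0 < \<beta>" "\<beta> \<le> 1"
  shows "p \<bullet> p \<le> (c_const \<beta> * \<alpha> powr \<beta>)\<^sup>2 * (w \<bullet> w)"
proof -
  note Dp = spectral_integralD[OF py] and Dw = spectral_integralD[OF wz]
  define b where "b = c_const \<beta> * \<alpha> powr \<beta>"
  \<comment> \<open>The reciprocal weight turns (t + \<alpha>)^2 times the measure of
    \<open>p\<close> into that measure itself. The cutoff at 0 keeps \<open>g\<close> away from its
    pole at -\<alpha>.\<close>
  define g where "g t = indicator {0..} t / (t + \<alpha>)\<^sup>2" for t :: real
  have g: "g \<in> borel_measurable borel" unfolding g_def by measurable
  have pw: "(\<lambda>t::real. t powr \<beta>) \<in> borel_measurable borel" by simp
  have gt: "g t * (t + \<alpha>)\<^sup>2 = indicator {0..} t" for t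
    using \<open>0 < \<alpha>\<close> by (auto simp: g_def indicator_def)
  have gle: "\<alpha>\<^sup>2 * (g t * (t powr \<beta>)\<^sup>2) \<le> b\<^sup>2" for t
  proof (cases "0 \<le> t")
    case True
    have "(\<alpha> * t powr \<beta>)\<^sup>2 \<le> (b * (t + \<alpha>))\<^sup>2"
      using holder_source_bound[OF True assms(6,7,8)] \<open>0 < \<alpha>\<close> unfolding b_def
      by (intro power_mono) auto
    then show ?thesis using True \<open>0 < \<alpha>\<close>
      by (simp add: g_def power_mult_distrib pos_divide_le_eq)
  qed (simp add: g_def)
  have g0: "0 \<le> g t" for t by (simp add: g_def)
  have gm: "(\<lambda>t. g t * (t powr \<beta>)\<^sup>2) \<in> borel_measurable borel" using g by measurable
  have intw: "integrable (\<mu> w) (\<lambda>t. g t * (t powr \<beta>)\<^sup>2)"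
  proof (rule integrable_\<mu>_bounded[OF gm _ Dw(2)])
    show "AE t in \<mu> w. \<bar>g t * (t powr \<beta>)\<^sup>2\<bar> \<le> b\<^sup>2 / \<alpha>\<^sup>2"
      using gle g0 \<open>0 < \<alpha>\<close> by (intro AE_I2) (simp add: pos_le_divide_eq mult.commute)
  qed
  let ?L = "[(1, \<mu> p, \<lambda>t. (t + \<alpha>)\<^sup>2), (- \<alpha>\<^sup>2, \<mu> w, \<lambda>t. (t powr \<beta>)\<^sup>2)] :: (real \<times> real measure \<times> (real \<Rightarrow> real)) list"
  have "(\<Sum>(c, M, h)\<leftarrow>?L. c * (\<integral>t. g t * h t \<partial>M)) = 0"
  proof (rule weighted_measures_integral_zero[OF g])
    fix B :: "real set" assume B: "B \<in> sets borel"
    have "(\<integral>t. indicator B t * (t + \<alpha>)\<^sup>2 \<partial>\<mu> p) = \<alpha>\<^sup>2 * (\<integral>t. indicator B t * (t powr \<beta>)\<^sup>2 \<partial>\<mu> w)"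
      unfolding measure_shifted[OF py B, symmetric] spectral_integral_measure[OF pw wz B, symmetric] eq
      using B Dw(3) by (rule measure_\<mu>_scale)
    then show "(\<Sum>(c, M, h)\<leftarrow>?L. c * (\<integral>t. indicator B t * h t \<partial>M)) = 0" by simp
  next
    fix c M h assume "(c, M, h) \<in> set ?L"
    then show "integrable M h" using integrable_shifted[OF Dp(1)] Dw(1) by (auto simp: spectral_dom_iff)
  next
    fix c M h assume "(c, M, h) \<in> set ?L"
    then show "integrable M (\<lambda>t. g t * h t)" using gt Dp(2) intw by auto
  qed auto
  then have "measure (\<mu> p) {0..} = \<alpha>\<^sup>2 * (\<integral>t. g t * (t powr \<beta>)\<^sup>2 \<partial>\<mu> w)"
    by (simp add: gt)
  moreover have "measure (\<mu> p) {0..} = p \<bullet> p"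
  proof -
    have "measure (\<mu> p) {0..} = measure (\<mu> p) UNIV"
      using pos(1) by (intro finite_measure.finite_measure_eq_AE[OF finite_\<mu>[OF Dp(2)]]) auto
    then show ?thesis using Dp(2) by simp
  qed
  moreover have "\<alpha>\<^sup>2 * (\<integral>t. g t * (t powr \<beta>)\<^sup>2 \<partial>\<mu> w) = (\<integral>t. \<alpha>\<^sup>2 * (g t * (t powr \<beta>)\<^sup>2) \<partial>\<mu> w)"
    by simp
  moreover have "\<dots> \<le> (\<integral>t. b\<^sup>2 \<partial>\<mu> w)"
    using intw gle Dw(2) by (intro integral_mono) auto
  moreover have "(\<integral>t. b\<^sup>2 \<partial>\<mu> w) = b\<^sup>2 * (w \<bullet> w)" using Dw(2) by simp
  ultimately show ?thesis unfolding b_def[symmetric] by linarith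
qed

end

section \<open>The operator of a coercive form and its inverse square root\<close>

text \<open>The coercivity constant 1 reflects the identity summand of the operator. It pushes the
  spectrum into [1,\<infinity>), where negative powers are bounded.\<close>

locale form_operator = hilbert_subspace H + V: form_space V a
  for H V :: "'h::real_inner set" and a :: "'h \<Rightarrow> 'h \<Rightarrow> real" +
  assumes V_subset: "V \<subseteq> H" and coercive: "\<And>v. v \<in> V \<Longrightarrow> v \<bullet> v \<le> a v v"
begin

lemma V_in_H: "v \<in> V \<Longrightarrow> v \<in> H"
  using V_subset by blast

lemma norm_le_form: "v \<in> V \<Longrightarrow> norm v \<le> sqrt (a v v)"
  by (simp add: coercive norm_eq_sqrt_inner)

lemma form_op_exists: "\<exists>u\<in>V. \<forall>v\<in>V. a u v = f \<bullet> v"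
proof (rule V.riesz)
  fix v assume v: "v \<in> V"
  have "\<bar>f \<bullet> v\<bar> \<le> norm f * norm v" by (rule Cauchy_Schwarz_ineq2)
  also have "\<dots> \<le> norm f * sqrt (a v v)" using norm_le_form[OF v] by (intro mult_left_mono) auto
  finally show "\<bar>f \<bullet> v\<bar> \<le> norm f * sqrt (a v v)" .
qed (simp_all add: inner_add_right)

lemma form_eqI:
  assumes "u \<in> V" "u' \<in> V" "\<And>v. v \<in> V \<Longrightarrow> a u v = a u' v"
  shows "u = u'"
proof -
  have "a (u - u') (u - u') = 0" using assms by (simp add: V.diff_left)
  then show ?thesis using coercive[of "u - u'"] assms by (simp add: antisym_conv[OF inner_ge_zero])
qed

end

lemma (in hilbert_subspace) inner_eqI:
  assumes "x \<in> H" "y \<in> H" "\<And>z. z \<in> H \<Longrightarrow> x \<bullet> z = y \<bullet> z"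
  shows "x = y"
proof -
  have "(x - y) \<bullet> (x - y) = 0" using assms by (simp add: inner_diff_left)
  then show ?thesis by simp
qed

text \<open>Names for the powers -1/2 and 1/2 that keep \<open>powr\<close> folded. Their algebra is
  used for t \<ge> 1, where the spectral distributions of the form operator live.\<close>

definition root_inv :: "real \<Rightarrow> real" where "root_inv t = t powr (- 1 / 2)"
definition root_pos :: "real \<Rightarrow> real" where "root_pos t = t powr (1 / 2)"

lemma root_measurable[measurable]:
  "root_inv \<in> borel_measurable borel" "root_pos \<in> borel_measurable borel"
  by (simp_all add: root_inv_def[abs_def] root_pos_def[abs_def])

lemma root_facts:
  assumes "1 \<le> t"
  shows "0 < root_inv t" "root_inv t \<le> 1" "root_pos t * root_inv t = 1"
    "t * root_inv t = root_pos t" "(root_pos t)\<^sup>2 = t" "(root_inv t)\<^sup>2 * t = 1"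
proof -
  have t: "0 < t" using assms by simp
  show "0 < root_inv t" using t by (simp add: root_inv_def)
  have "root_inv t \<le> t powr 0" unfolding root_inv_def using assms by (intro powr_mono) auto
  then show "root_inv t \<le> 1" using t by simp
  show *: "root_pos t * root_inv t = 1"
    using t by (simp add: root_inv_def root_pos_def flip: powr_add)
  show **: "(root_pos t)\<^sup>2 = t"
    using t by (simp add: root_pos_def power2_eq_square flip: powr_add)
  show "t * root_inv t = root_pos t"
  proof -
    have "t * root_inv t = root_pos t * (root_pos t * root_inv t)"
      by (simp only: **[unfolded power2_eq_square] flip: mult.assoc)
    then show ?thesis by (simp only: * mult_1_right)
  qed
  have "(root_inv t)\<^sup>2 * (root_pos t)\<^sup>2 = 1"
    using * by (simp add: mult.commute flip: power_mult_distrib)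
  then show "(root_inv t)\<^sup>2 * t = 1" unfolding ** .
qed

locale form_operator_pvm = form_operator H V a + pvm H E
  for H V :: "'h::real_inner set" and a E +
  assumes spectral: "form_op H V a = spectral_integral H E (\<lambda>t. t)"
begin

text \<open>Surjectivity of the form operator provides the resolvent hypothesis with \<alpha> = 0,
  and coercivity provides m = 1.\<close>

lemma AE_ge_1:
  assumes "x \<in> H"
  shows "AE t in \<mu> x. 1 \<le> t"
proof (rule spectral_lower_bound[where \<alpha>=0])
  fix x assume x: "x \<in> H"
  obtain u where "u \<in> V" "\<forall>v\<in>V. a u v = x \<bullet> v" using form_op_exists by blast
  with x have "(u, x) \<in> form_op H V a" by (simp add: form_op_def)
  then show "\<exists>p y. (p, y) \<in> spectral_integral H E (\<lambda>t. t) \<and> y + 0 *\<^sub>R p = x"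
    unfolding spectral by auto
next
  fix p y assume "(p, y) \<in> spectral_integral H E (\<lambda>t. t)"
  then have "p \<in> V" "a p p = y \<bullet> p" by (auto simp: form_op_def simp flip: spectral)
  then show "1 * (p \<bullet> p) \<le> y \<bullet> p" using coercive by fastforce
qed (use assms in auto)

lemma AE_root_inv_le:
  assumes "x \<in> H" shows "AE t in \<mu> x. \<bar>root_inv t\<bar> \<le> 1"
  using AE_ge_1[OF assms] by eventually_elim (simp add: root_facts(1,2) less_imp_le)

lemma dom_root_inv: "spectral_dom H E root_inv = H"
  by (rule spectral_dom_bounded[OF _ AE_root_inv_le]) simp_all

definition S where "S x = (SOME y. (x, y) \<in> spectral_integral H E root_inv)"

lemma S_spectral: "x \<in> H \<Longrightarrow> (x, S x) \<in> spectral_integral H E root_inv"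
  unfolding S_def by (rule someI_ex[OF spectral_integral_exists[OF _ AE_root_inv_le]]) simp_all

lemma S_in_H: "x \<in> H \<Longrightarrow> S x \<in> H"
  using spectral_integralD(3)[OF S_spectral] .

lemma S_inner:
  "x \<in> H \<Longrightarrow> z \<in> H \<Longrightarrow> 4 * (S x \<bullet> z) = (\<integral>t. root_inv t \<partial>\<mu> (x + z)) - (\<integral>t. root_inv t \<partial>\<mu> (x - z))"
  using spectral_integralD(4)[OF S_spectral] by (simp add: dom_root_inv)

lemma S_unique:
  assumes "(x, y) \<in> spectral_integral H E root_inv" shows "y = S x"
proof (rule inner_eqI)
  note D = spectral_integralD[OF assms]
  show "y \<in> H" "S x \<in> H" using D S_in_H by auto
  show "y \<bullet> z = S x \<bullet> z" if "z \<in> H" for z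
    using D(4)[unfolded dom_root_inv, OF that] S_inner[OF D(2) that] by linarith
qed

lemma S_sym:
  assumes "x \<in> H" "z \<in> H" shows "S x \<bullet> z = x \<bullet> S z"
  using S_inner[OF assms] S_inner[OF assms(2,1)] \<mu>_diff_commute[OF assms]
  by (simp add: add.commute[of z x] inner_commute)

lemma S_add:
  assumes "x \<in> H" "y \<in> H" shows "S (x + y) = S x + S y"
  by (rule inner_eqI) (use assms in \<open>auto simp: S_in_H S_sym inner_add_left\<close>)

lemma S_diff:
  assumes "x \<in> H" "y \<in> H" shows "S (x - y) = S x - S y"
  by (rule inner_eqI) (use assms in \<open>auto simp: S_in_H S_sym inner_diff_left\<close>)

lemma S_scale:
  assumes "x \<in> H" shows "S (c *\<^sub>R x) = c *\<^sub>R S x"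
  by (rule inner_eqI) (use assms in \<open>auto simp: S_in_H S_sym\<close>)

text \<open>Since 0 < \<open>root_inv t\<close> \<le> 1 on the support, the square of S lies below
  S. This one inequality carries both positivity and contractivity, and is what the uniqueness of
  the root relies on.\<close>

lemma S_norm_le_inner:
  assumes x: "x \<in> H" shows "S x \<bullet> S x \<le> S x \<bullet> x"
proof -
  have int: "integrable (\<mu> x) root_inv" "integrable (\<mu> x) (\<lambda>t. (root_inv t)\<^sup>2)"
    using integrable_of_square[of root_inv x] x dom_root_inv by (auto simp: spectral_dom_iff)
  have "S x \<bullet> S x = (\<integral>t. (root_inv t)\<^sup>2 \<partial>\<mu> x)"
    using spectral_integral_measure[OF _ S_spectral[OF x], of UNIV] S_in_H[OF x] by simp
  also have "\<dots> \<le> (\<integral>t. root_inv t \<partial>\<mu> x)"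
  proof (rule integral_mono_AE[OF int(2,1)])
    show "AE t in \<mu> x. (root_inv t)\<^sup>2 \<le> root_inv t"
      using AE_ge_1[OF x]
      by eventually_elim (use root_facts(1,2) in \<open>simp add: power2_eq_square mult_left_le less_imp_le\<close>)
  qed
  also have "\<dots> = S x \<bullet> x"
    using spectral_integral_inner[OF _ S_spectral[OF x]] by simp
  finally show ?thesis .
qed

lemma S_norm_le:
  assumes "x \<in> H" shows "norm (S x) \<le> norm x"
proof -
  have "norm (S x) * norm (S x) \<le> norm (S x) * norm x"
    using S_norm_le_inner[OF assms] norm_cauchy_schwarz[of "S x" x]
    by (simp add: power2_norm_eq_inner flip: power2_eq_square)
  then show ?thesis by (cases "norm (S x) = 0") auto
qed

lemma integrable_S:
  fixes g :: "real \<Rightarrow> real"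
  assumes x: "x \<in> H" and g: "g \<in> borel_measurable borel"
  shows "integrable (\<mu> (S x)) g \<longleftrightarrow> integrable (\<mu> x) (\<lambda>t. (root_inv t)\<^sup>2 * g t)"
  unfolding spectral_integral_density[OF root_measurable(1) S_spectral[OF x]]
  using g by (subst integrable_density) auto

lemma S_dom_root_pos:
  assumes x: "x \<in> H" shows "S x \<in> spectral_dom H E root_pos"
  unfolding spectral_dom_iff
proof
  have "AE t in \<mu> x. \<bar>(root_inv t)\<^sup>2 * (root_pos t)\<^sup>2\<bar> \<le> 1"
    using AE_ge_1[OF x] by eventually_elim (simp add: root_facts)
  then show "integrable (\<mu> (S x)) (\<lambda>t. (root_pos t)\<^sup>2)"
    using x by (subst integrable_S) (auto intro!: integrable_\<mu>_bounded)
qed (rule S_in_H[OF x])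

lemma dom_id_root_pos:
  assumes "z \<in> spectral_dom H E (\<lambda>t. t)" shows "z \<in> spectral_dom H E root_pos"
  unfolding spectral_dom_iff
proof
  note z = spectral_dom_in[OF assms]
  have "integrable (\<mu> z) (\<lambda>t. t)" using assms by (intro integrable_of_square) auto
  then show "integrable (\<mu> z) (\<lambda>t. (root_pos t)\<^sup>2)"
  proof (rule Bochner_Integration.integrable_bound)
    show "AE t in \<mu> z. norm ((root_pos t)\<^sup>2) \<le> norm t"
      using AE_ge_1[OF z] by eventually_elim (simp add: root_facts)
  qed simp
qed (rule spectral_dom_in[OF assms])

lemma polar_const_1:
  assumes g: "g \<in> borel_measurable borel" and eq: "\<And>t. 1 \<le> t \<Longrightarrow> g t = 1" and H: "x \<in> H" "z \<in> H"
  shows "(\<integral>t. g t \<partial>\<mu> (x + z)) - (\<integral>t. g t \<partial>\<mu> (x - z)) = 4 * (x \<bullet> z)"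
proof -
  have "(\<integral>t. g t \<partial>\<mu> v) = v \<bullet> v" if v: "v \<in> H" for v
  proof -
    have "(\<integral>t. g t \<partial>\<mu> v) = (\<integral>t. 1 \<partial>\<mu> v)"
      using AE_ge_1[OF v] g by (intro integral_cong_AE) (auto elim: eventually_mono simp: eq)
    then show ?thesis using v by simp
  qed
  then show ?thesis using H
    by (simp add: inner_add_left inner_add_right inner_diff_left inner_diff_right inner_commute)
qed

lemma integrable_eq_1:
  fixes g :: "real \<Rightarrow> real"
  assumes g: "g \<in> borel_measurable borel" and eq: "\<And>t. 1 \<le> t \<Longrightarrow> g t = 1" and x: "x \<in> H"
  shows "integrable (\<mu> x) g"
  by (rule integrable_\<mu>_bounded[OF g _ x, where C=1])
    (use AE_ge_1[OF x] in eventually_elim, simp add: eq)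

text \<open>Two applications of \<open>spectral_integral_polar\<close> produce the integrand t *
  \<open>root_inv t\<close>^2, which is 1 on the support. The result identifies S S x with the
  solution of the form equation for x.\<close>

lemma S_S_spectral:
  assumes x: "x \<in> H" shows "(S (S x), x) \<in> spectral_integral H E (\<lambda>t. t)"
proof -
  note Sx = S_in_H[OF x]
  have dom: "S (S x) \<in> spectral_dom H E (\<lambda>t. t)"
    unfolding spectral_dom_iff
  proof
    have "integrable (\<mu> x) (\<lambda>t. (root_inv t)\<^sup>2 * ((root_inv t)\<^sup>2 * t\<^sup>2))"
    proof (rule integrable_eq_1[OF _ _ x])
      fix t :: real assume "1 \<le> t"
      have "(root_inv t)\<^sup>2 * ((root_inv t)\<^sup>2 * t\<^sup>2) = ((root_inv t)\<^sup>2 * t)\<^sup>2"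
        by (simp add: power2_eq_square ac_simps)
      then show "(root_inv t)\<^sup>2 * ((root_inv t)\<^sup>2 * t\<^sup>2) = 1" using root_facts(6)[OF \<open>1 \<le> t\<close>] by simp
    qed simp
    then show "integrable (\<mu> (S (S x))) (\<lambda>t. t\<^sup>2)" using x Sx by (simp add: integrable_S)
  qed (rule S_in_H[OF Sx])
  have "4 * (x \<bullet> z) = (\<integral>t. t \<partial>\<mu> (S (S x) + z)) - (\<integral>t. t \<partial>\<mu> (S (S x) - z))"
    if z: "z \<in> spectral_dom H E (\<lambda>t. t)" for z
  proof -
    note zH = spectral_dom_in[OF z]
    have zdom: "z \<in> spectral_dom H E root_inv" using zH dom_root_inv by simp
    have id: "(\<lambda>t::real. t) \<in> borel_measurable borel" by simp
    \<comment> \<open>On the support t * \<open>root_inv t\<close> equals \<open>root_pos t\<close>,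
      so membership in the domain of the root suffices; both S x and z have it.\<close>
    have int1: "integrable (\<mu> v) (\<lambda>t. t * root_inv t)" if "v \<in> spectral_dom H E root_pos" for v
    proof (rule Bochner_Integration.integrable_bound)
      show "integrable (\<mu> v) root_pos" using that by (intro integrable_of_square) auto
      show "AE t in \<mu> v. norm (t * root_inv t) \<le> norm (root_pos t)"
        using AE_ge_1[OF spectral_dom_in[OF that]] by eventually_elim (simp add: root_facts)
    qed simp
    have int: "integrable (\<mu> (S x + z)) (\<lambda>t. t * root_inv t)" "integrable (\<mu> (S x - z)) (\<lambda>t. t * root_inv t)"
      using S_dom_root_pos[OF x] dom_id_root_pos[OF z] by (auto intro!: int1 spectral_dom_closed)
    have one: "t * root_inv t * root_inv t = 1" if "1 \<le> t" for t
      using root_facts(3,4)[OF that] by simp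
    have "(\<integral>t. t \<partial>\<mu> (S (S x) + z)) - (\<integral>t. t \<partial>\<mu> (S (S x) - z)) =
        (\<integral>t. t * root_inv t \<partial>\<mu> (S x + z)) - (\<integral>t. t * root_inv t \<partial>\<mu> (S x - z))"
      by (rule spectral_integral_polar[OF root_measurable(1) S_spectral[OF Sx] zdom id
            integrable_dom_polar[OF id dom z] int])
    also have "\<dots> = (\<integral>t. t * root_inv t * root_inv t \<partial>\<mu> (x + z)) - (\<integral>t. t * root_inv t * root_inv t \<partial>\<mu> (x - z))"
    proof (rule spectral_integral_polar[OF root_measurable(1) S_spectral[OF x] zdom _ int])
      show "integrable (\<mu> (x + z)) (\<lambda>t. t * root_inv t * root_inv t)"
        "integrable (\<mu> (x - z)) (\<lambda>t. t * root_inv t * root_inv t)"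
        using x zH by (auto intro!: integrable_eq_1 one)
    qed simp
    also have "\<dots> = 4 * (x \<bullet> z)" by (rule polar_const_1[OF _ one x zH]) simp_all
    finally show ?thesis by simp
  qed
  with dom x show ?thesis by (simp add: spectral_integral_def mult.commute)
qed

lemma S_S_V: "x \<in> H \<Longrightarrow> S (S x) \<in> V" "x \<in> H \<Longrightarrow> v \<in> V \<Longrightarrow> a (S (S x)) v = x \<bullet> v"
  using S_S_spectral by (auto simp: form_op_def simp flip: spectral)

text \<open>Explicit preimages: for the root cut off at n, the product with \<open>root_inv\<close>
  is the indicator of \<open>{..n}\<close> on the support, so \<open>S (\<eta> n)\<close> is
  \<open>E {..n} x\<close>. These projections exhaust \<open>x\<close>.\<close>

lemma approx_range_S:
  assumes x: "x \<in> H"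
  obtains \<eta> where "\<And>n::nat. \<eta> n \<in> H" "(\<lambda>n. S (\<eta> n)) \<longlonglongrightarrow> x"
proof -
  define q where "q n t = indicator {..real n} t * root_pos t" for n :: nat and t
  have q: "q n \<in> borel_measurable borel" for n unfolding q_def by measurable
  have qb: "AE t in \<mu> v. \<bar>q n t\<bar> \<le> root_pos (real n)" if "v \<in> H" for v n
    using AE_ge_1[OF that]
    by eventually_elim (auto simp: q_def indicator_def root_pos_def intro!: powr_mono2)
  have "\<exists>y. (x, y) \<in> spectral_integral H E (q n)" for n
    by (rule spectral_integral_exists[OF q qb x])
  then obtain \<eta> where \<eta>: "(x, \<eta> n) \<in> spectral_integral H E (q n)" for n by metis
  have \<eta>H: "\<eta> n \<in> H" for n using spectral_integralD(3)[OF \<eta>] .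
  have B: "{..real n} \<in> sets borel" for n by simp
  have S\<eta>: "S (\<eta> n) = E {..real n} x" for n
  proof (rule inner_eqI)
    fix z assume z: "z \<in> H"
    have dom: "z \<in> spectral_dom H E (q n)" using spectral_dom_bounded[OF q qb] z by simp
    have AE: "AE t in \<mu> v. root_inv t * q n t = indicator {..real n} t" if "v \<in> H" for v
      using AE_ge_1[OF that]
      by eventually_elim (use root_facts(3) in \<open>auto simp: q_def indicator_def mult.commute\<close>)
    have int: "integrable (\<mu> v) (\<lambda>t. root_inv t * q n t)" if "v \<in> H" for v
    proof (rule integrable_\<mu>_bounded[OF _ _ that])
      show "AE t in \<mu> v. \<bar>root_inv t * q n t\<bar> \<le> 1"
        using AE[OF that] by eventually_elim (simp add: indicator_def)
    qed (use q in simp)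
    have eq: "(\<integral>t. root_inv t * q n t \<partial>\<mu> v) = measure (\<mu> v) {..real n}" if "v \<in> H" for v
    proof -
      have "(\<integral>t. root_inv t * q n t \<partial>\<mu> v) = (\<integral>t. indicator {..real n} t \<partial>\<mu> v)"
        using AE[OF that] q by (intro integral_cong_AE) auto
      then show ?thesis by simp
    qed
    have int_r: "integrable (\<mu> v) root_inv" if "v \<in> H" for v
      using AE_root_inv_le[OF that] that by (intro integrable_\<mu>_bounded) auto
    have "4 * (S (\<eta> n) \<bullet> z) = (\<integral>t. root_inv t \<partial>\<mu> (\<eta> n + z)) - (\<integral>t. root_inv t \<partial>\<mu> (\<eta> n - z))"
      using \<eta>H z by (rule S_inner)
    also have "\<dots> = (\<integral>t. root_inv t * q n t \<partial>\<mu> (x + z)) - (\<integral>t. root_inv t * q n t \<partial>\<mu> (x - z))"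
      using int int_r \<eta>H z x by (intro spectral_integral_polar[OF q \<eta> dom]) auto
    also have "\<dots> = 4 * (E {..real n} x \<bullet> z)"
      using eq[of "x + z"] eq[of "x - z"] polarization[OF B x z] x z by simp
    finally show "S (\<eta> n) \<bullet> z = E {..real n} x \<bullet> z" by simp
  qed (use \<eta>H x B in \<open>auto intro: S_in_H proj\<close>)
  have "(\<lambda>n. measure (\<mu> x) {..real n}) \<longlonglongrightarrow> measure (\<mu> x) (\<Union>n. {..real n})"
    by (intro finite_measure.finite_Lim_measure_incseq[OF finite_\<mu>[OF x]]) (auto simp: incseq_def)
  moreover have "(\<Union>n. {..real n}) = UNIV" using real_arch_simple by auto
  ultimately have lim: "(\<lambda>n. E {..real n} x \<bullet> x) \<longlonglongrightarrow> x \<bullet> x"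
    using x by (simp add: measure_\<mu>)
  have "(norm (E {..real n} x - x))\<^sup>2 = x \<bullet> x - E {..real n} x \<bullet> x" for n
    using proj_inner[OF B x, of n]
    by (simp add: power2_norm_eq_inner inner_diff_left inner_diff_right inner_commute)
  moreover have "(\<lambda>n. x \<bullet> x - E {..real n} x \<bullet> x) \<longlonglongrightarrow> 0"
    using tendsto_diff[OF tendsto_const lim, of "x \<bullet> x"] by simp
  ultimately have "(\<lambda>n. (norm (E {..real n} x - x))\<^sup>2) \<longlonglongrightarrow> 0" by simp
  then have "(\<lambda>n. norm (E {..real n} x - x)) \<longlonglongrightarrow> 0"
    using tendsto_real_sqrt[of "\<lambda>n. (norm (E {..real n} x - x))\<^sup>2" 0] by simp
  then have "(\<lambda>n. E {..real n} x) \<longlonglongrightarrow> x"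
    by (rule LIM_zero_cancel[OF tendsto_norm_zero_cancel])
  then show ?thesis using that[of \<eta>] \<eta>H S\<eta> by simp
qed

end

section \<open>The inverse root as an isometry onto the form domain\<close>

context form_operator_pvm
begin

text \<open>On vectors S S u the isometry follows from the form equation and the symmetry of S. The
  range of S is dense, and completeness of \<open>V\<close> supplies limits; by coercivity these are
  also limits in \<open>H\<close>, where contractivity of S identifies them as S x.\<close>

lemma S_in_V_iso:
  assumes x: "x \<in> H"
  shows "S x \<in> V" and "y \<in> H \<Longrightarrow> a (S x) (S y) = x \<bullet> y"
proof -
  have iso0: "a (S (S u)) (S (S v)) = S u \<bullet> S v" if "u \<in> H" "v \<in> H" for u v
    using that by (simp add: S_S_V S_in_H S_sym)
  have approx: "S x \<in> V \<and> (\<exists>\<eta>. (\<forall>n::nat. \<eta> n \<in> H) \<and> (\<lambda>n. S (\<eta> n)) \<longlonglongrightarrow> x \<and>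
      (\<lambda>n. a (S (S (\<eta> n)) - S x) (S (S (\<eta> n)) - S x)) \<longlonglongrightarrow> 0)" if x: "x \<in> H" for x
  proof -
    obtain \<eta> where \<eta>: "\<And>n::nat. \<eta> n \<in> H" and lim: "(\<lambda>n. S (\<eta> n)) \<longlonglongrightarrow> x"
      using approx_range_S[OF x] by blast
    have diff: "a (S (S (\<eta> m)) - S (S (\<eta> n))) (S (S (\<eta> m)) - S (S (\<eta> n))) = (dist (S (\<eta> m)) (S (\<eta> n)))\<^sup>2" for m n
    proof -
      have "S (S (\<eta> m)) - S (S (\<eta> n)) = S (S (\<eta> m - \<eta> n))"
        using \<eta> by (simp add: S_diff S_in_H)
      then show ?thesis using iso0[of "\<eta> m - \<eta> n" "\<eta> m - \<eta> n"] \<eta>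
        by (simp add: S_diff dist_norm power2_norm_eq_inner)
    qed
    have "\<exists>l\<in>V. (\<lambda>n. a (S (S (\<eta> n)) - l) (S (S (\<eta> n)) - l)) \<longlonglongrightarrow> 0"
    proof (rule V.complete)
      show "S (S (\<eta> n)) \<in> V" for n using S_S_V(1)[OF \<eta>] .
      fix e :: real assume "e > 0"
      then obtain N where N: "\<forall>m\<ge>N. \<forall>n\<ge>N. dist (S (\<eta> m)) (S (\<eta> n)) < sqrt e"
        using metric_CauchyD[OF LIMSEQ_imp_Cauchy[OF lim], of "sqrt e"] by auto
      have "(dist (S (\<eta> m)) (S (\<eta> n)))\<^sup>2 < e" if "m \<ge> N" "n \<ge> N" for m n
      proof -
        have "(dist (S (\<eta> m)) (S (\<eta> n)))\<^sup>2 < (sqrt e)\<^sup>2"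
          using N that by (intro power_strict_mono) auto
        then show ?thesis using \<open>e > 0\<close> by simp
      qed
      then show "\<exists>N. \<forall>m\<ge>N. \<forall>n\<ge>N. a (S (S (\<eta> m)) - S (S (\<eta> n))) (S (S (\<eta> m)) - S (S (\<eta> n))) < e"
        unfolding diff by blast
    qed
    then obtain l where l: "l \<in> V" "(\<lambda>n. a (S (S (\<eta> n)) - l) (S (S (\<eta> n)) - l)) \<longlonglongrightarrow> 0" by blast
    have "(\<lambda>n. S (S (\<eta> n)) - l) \<longlonglongrightarrow> 0"
    proof (rule Lim_null_comparison[OF always_eventually])
      show "\<forall>n. norm (S (S (\<eta> n)) - l) \<le> sqrt (a (S (S (\<eta> n)) - l) (S (S (\<eta> n)) - l))"
        using S_S_V(1)[OF \<eta>] l(1) by (auto intro: norm_le_form)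
      show "(\<lambda>n. sqrt (a (S (S (\<eta> n)) - l) (S (S (\<eta> n)) - l))) \<longlonglongrightarrow> 0"
        using tendsto_real_sqrt[OF l(2)] by simp
    qed
    then have 1: "(\<lambda>n. S (S (\<eta> n))) \<longlonglongrightarrow> l" by (rule LIM_zero_cancel)
    have "(\<lambda>n. S (S (\<eta> n)) - S x) \<longlonglongrightarrow> 0"
    proof (rule Lim_null_comparison[OF always_eventually])
      show "\<forall>n. norm (S (S (\<eta> n)) - S x) \<le> norm (S (\<eta> n) - x)"
      proof
        fix n
        have "S (S (\<eta> n)) - S x = S (S (\<eta> n) - x)" using \<eta>[of n] x by (simp add: S_diff S_in_H)
        then show "norm (S (S (\<eta> n)) - S x) \<le> norm (S (\<eta> n) - x)"
          using S_norm_le[of "S (\<eta> n) - x"] \<eta>[of n] x by (simp add: S_in_H)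
      qed
      show "(\<lambda>n. norm (S (\<eta> n) - x)) \<longlonglongrightarrow> 0"
        using tendsto_norm[OF LIM_zero[OF lim]] by simp
    qed
    then have "(\<lambda>n. S (S (\<eta> n))) \<longlonglongrightarrow> S x" by (rule LIM_zero_cancel)
    with 1 have "l = S x" by (rule LIMSEQ_unique)
    with l \<eta> lim show ?thesis by blast
  qed
  show SxV: "S x \<in> V" using approx[OF x] by blast
  show "a (S x) (S y) = x \<bullet> y" if y: "y \<in> H"
  proof -
    obtain \<eta> where \<eta>: "\<And>n::nat. \<eta> n \<in> H" and lim: "(\<lambda>n. S (\<eta> n)) \<longlonglongrightarrow> y"
      and alim: "(\<lambda>n. a (S (S (\<eta> n)) - S y) (S (S (\<eta> n)) - S y)) \<longlonglongrightarrow> 0"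
      using approx[OF y] by blast
    \<comment> \<open>Only one argument is approximated: with \<open>S x\<close> a fixed element of
      \<open>V\<close>, the form equation evaluates each term exactly.\<close>
    have "(\<lambda>n. a (S (S (\<eta> n))) (S x)) \<longlonglongrightarrow> a (S y) (S x)"
      using S_S_V(1)[OF \<eta>] approx[OF y] alim SxV by (intro V.tendsto_form) auto
    moreover have "a (S (S (\<eta> n))) (S x) = S (\<eta> n) \<bullet> x" for n
      using S_S_V(2)[OF \<eta> SxV] S_sym[OF \<eta> x] by simp
    moreover have "(\<lambda>n. S (\<eta> n) \<bullet> x) \<longlonglongrightarrow> y \<bullet> x"
      using lim by (intro tendsto_inner tendsto_const)
    ultimately have "a (S y) (S x) = y \<bullet> x" using LIMSEQ_unique by simp
    then show ?thesis using V.sym[of "S x" "S y"] SxV approx[OF y] by (simp add: inner_commute)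
  qed
qed

text \<open>The preimage is the Riesz representative in \<open>H\<close> of the functional sending
  \<xi> to \<open>a (S \<xi>) v\<close>, which is bounded by the isometry. The form equation for S S
  z then gives S y = v.\<close>

lemma S_onto:
  assumes v: "v \<in> V" shows "\<exists>x\<in>H. v = S x"
proof -
  have "\<exists>y\<in>H. \<forall>\<xi>\<in>H. y \<bullet> \<xi> = a (S \<xi>) v"
  proof (rule riesz)
    fix \<xi> assume \<xi>: "\<xi> \<in> H"
    show "\<bar>a (S \<xi>) v\<bar> \<le> sqrt (a v v) * sqrt (\<xi> \<bullet> \<xi>)"
      using V.cauchy_schwarz_sqrt[OF S_in_V_iso(1)[OF \<xi>] v] S_in_V_iso(2)[OF \<xi> \<xi>]
      by (simp add: mult.commute)
  qed (use v in \<open>simp_all add: S_add S_scale V.add_left V.scale_left S_in_V_iso(1)\<close>)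
  then obtain y where y: "y \<in> H" "\<And>\<xi>. \<xi> \<in> H \<Longrightarrow> y \<bullet> \<xi> = a (S \<xi>) v" by blast
  have "S y = v"
  proof (rule inner_eqI)
    fix z assume z: "z \<in> H"
    have "S y \<bullet> z = y \<bullet> S z" using y z by (simp add: S_sym)
    also have "\<dots> = a (S (S z)) v" using y z by (simp add: S_in_H)
    also have "\<dots> = z \<bullet> v" using z v by (rule S_S_V(2))
    finally show "S y \<bullet> z = v \<bullet> z" by (simp add: inner_commute)
  qed (use y v in \<open>auto intro: S_in_H V_in_H\<close>)
  then show ?thesis using y by blast
qed

text \<open>Connects the source element, given through the power 1/2, with the power -1/2 inside
  \<open>KA\<close>. Testing with \<open>S v\<close> is legitimate because it lies in the domain of
  the root.\<close>

lemma S_root_pos: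
  assumes uz: "(u, z) \<in> spectral_integral H E root_pos" shows "S z = u"
proof (rule inner_eqI)
  note D = spectral_integralD[OF uz]
  show "S z \<in> H" "u \<in> H" using D S_in_H by auto
  fix v assume v: "v \<in> H"
  have udom: "u \<in> spectral_dom H E root_inv" using D(2) dom_root_inv by simp
  have "4 * (S z \<bullet> v) = 4 * (z \<bullet> S v)" using D v by (simp add: S_sym)
  also have "\<dots> = (\<integral>t. root_pos t \<partial>\<mu> (u + S v)) - (\<integral>t. root_pos t \<partial>\<mu> (u - S v))"
    by (rule D(4)[OF S_dom_root_pos[OF v]])
  also have "\<dots> = (\<integral>t. root_pos t \<partial>\<mu> (S v + u)) - (\<integral>t. root_pos t \<partial>\<mu> (S v - u))"
    using \<mu>_diff_commute[OF D(2) S_in_H[OF v]] by (simp add: add.commute)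
  also have "\<dots> = (\<integral>t. root_pos t * root_inv t \<partial>\<mu> (v + u)) - (\<integral>t. root_pos t * root_inv t \<partial>\<mu> (v - u))"
  proof (rule spectral_integral_polar[OF root_measurable(1) S_spectral[OF v] udom root_measurable(2)
        integrable_dom_polar[OF root_measurable(2) S_dom_root_pos[OF v] D(1)]])
    show "integrable (\<mu> (v + u)) (\<lambda>t. root_pos t * root_inv t)"
      "integrable (\<mu> (v - u)) (\<lambda>t. root_pos t * root_inv t)"
      using v D(2) by (auto intro!: integrable_eq_1 root_facts(3))
  qed
  also have "\<dots> = 4 * (v \<bullet> u)" by (rule polar_const_1[OF _ root_facts(3) v D(2)]) simp_all
  finally show "S z \<bullet> v = u \<bullet> v" by (simp add: inner_commute)
qed

end

text \<open>With \<open>D = S - S'\<close> one has \<open>S D = - D S'\<close>, so that \<open>\<langle>S D x, D x\<rangle> = - \<langle>S' x, D\<^sup>2 x\<rangle>\<close>;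
  along a sequence of unit vectors with \<open>D\<^sup>2 x \<approx> \<parallel>D\<parallel>\<^sup>2 x\<close> both sides must tend to \<open>0\<close>.\<close>

lemma (in hilbert_subspace) positive_root_unique:
  assumes H: "\<And>x. x \<in> H \<Longrightarrow> S x \<in> H" "\<And>x. x \<in> H \<Longrightarrow> S' x \<in> H"
    and diff: "\<And>x y. x \<in> H \<Longrightarrow> y \<in> H \<Longrightarrow> S (x - y) = S x - S y"
      "\<And>x y. x \<in> H \<Longrightarrow> y \<in> H \<Longrightarrow> S' (x - y) = S' x - S' y"
    and scale: "\<And>x c. x \<in> H \<Longrightarrow> S (c *\<^sub>R x) = c *\<^sub>R S x" "\<And>x c. x \<in> H \<Longrightarrow> S' (c *\<^sub>R x) = c *\<^sub>R S' x"
    and sym: "\<And>x y. x \<in> H \<Longrightarrow> y \<in> H \<Longrightarrow> S x \<bullet> y = x \<bullet> S y"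
      "\<And>x y. x \<in> H \<Longrightarrow> y \<in> H \<Longrightarrow> S' x \<bullet> y = x \<bullet> S' y"
    and pos: "\<And>x. x \<in> H \<Longrightarrow> S x \<bullet> S x \<le> S x \<bullet> x" "\<And>x. x \<in> H \<Longrightarrow> S' x \<bullet> S' x \<le> S' x \<bullet> x"
    and le: "\<And>x. x \<in> H \<Longrightarrow> norm (S x) \<le> norm x" "\<And>x. x \<in> H \<Longrightarrow> norm (S' x) \<le> norm x"
    and sq: "\<And>x. x \<in> H \<Longrightarrow> S (S x) = S' (S' x)"
    and x: "x \<in> H"
  shows "S x = S' x"
proof -
  define D where "D x = S x - S' x" for x
  have DH: "D x \<in> H" if "x \<in> H" for x using that H by (simp add: D_def)
  have Dscale: "D (c *\<^sub>R x) = c *\<^sub>R D x" if "x \<in> H" for c x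
    using that scale by (simp add: D_def scaleR_diff_right)
  have Dsym: "D x \<bullet> y = x \<bullet> D y" if "x \<in> H" "y \<in> H" for x y
    using that sym by (simp add: D_def inner_diff_left inner_diff_right)
  \<comment> \<open>The square of the operator norm of \<open>D\<close>; the goal is
    \<open>s = 0\<close>.\<close>
  define s where "s = (SUP x\<in>{x\<in>H. norm x \<le> 1}. (norm (D x))\<^sup>2)"
  have norm_D: "norm (D x) \<le> 2 * norm x" if "x \<in> H" for x
    using norm_triangle_ineq4[of "S x" "S' x"] le[OF that] by (simp add: D_def)
  have D4: "(norm (D x))\<^sup>2 \<le> 4" if "x \<in> H" "norm x \<le> 1" for x
  proof -
    have "norm (D x) \<le> 2" using norm_D[OF that(1)] that(2) by simp
    then have "(norm (D x))\<^sup>2 \<le> 2\<^sup>2" by (intro power_mono) auto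
    then show ?thesis by simp
  qed
  have bdd: "bdd_above ((\<lambda>x. (norm (D x))\<^sup>2) ` {x\<in>H. norm x \<le> 1})"
    using D4 by (intro bdd_aboveI2[where M=4]) auto
  have s_ge: "(norm (D x))\<^sup>2 \<le> s" if "x \<in> H" "norm x \<le> 1" for x
    unfolding s_def using that bdd by (intro cSUP_upper) auto
  have ne: "{x\<in>H. norm x \<le> 1} \<noteq> {}" using closed(1) by (auto intro: exI[of _ 0])
  have s4: "s \<le> 4" unfolding s_def using D4 ne by (intro cSUP_least) auto
  have s0: "0 \<le> s" using s_ge[of 0] by (auto intro: order_trans[OF zero_le_power2])
  have D_le: "(norm (D x))\<^sup>2 \<le> s * (norm x)\<^sup>2" if x: "x \<in> H" for x
  proof (cases "x = 0")
    case True
    then show ?thesis using Dscale[OF x, of 0] by simp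
  next
    case False
    have "(norm (D ((1 / norm x) *\<^sub>R x)))\<^sup>2 \<le> s" using x False by (intro s_ge) auto
    then have "(norm (D x))\<^sup>2 / (norm x)\<^sup>2 \<le> s" using x by (simp add: Dscale power_divide)
    then show ?thesis using False by (simp add: pos_divide_le_eq)
  qed
  have "s = 0"
  proof (rule ccontr)
    assume "s \<noteq> 0"
    with s0 have spos: "0 < s" by simp
    \<comment> \<open>The constants satisfy s \<kappa> = \<tau>^2, which gives |r| \<le> \<tau>, and
      4 \<tau> = s (s / 4), which gives |D x|^2 \<le> s / 4. As s \<le> 4, also \<kappa> \<le> s /
      16, so s - \<kappa> < |D x|^2 is contradicted.\<close>
    define \<kappa> where "\<kappa> = s ^ 3 / 256"
    define \<tau> where "\<tau> = s\<^sup>2 / 16"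
    have \<kappa>: "0 < \<kappa>" and \<tau>: "0 < \<tau>" using spos by (auto simp: \<kappa>_def \<tau>_def)
    have "s * \<kappa> = \<tau>\<^sup>2" by (simp add: \<kappa>_def \<tau>_def power2_eq_square power3_eq_cube)
    obtain x where x: "x \<in> H" "norm x \<le> 1" and xs: "s - \<kappa> < (norm (D x))\<^sup>2"
      using less_cSUP_iff[OF ne bdd, of "s - \<kappa>"] \<kappa> by (auto simp: s_def)
    define r where "r = D (D x) - s *\<^sub>R x"
    have "r \<bullet> r = D (D x) \<bullet> D (D x) - 2 * s * (D (D x) \<bullet> x) + s\<^sup>2 * (x \<bullet> x)"
      by (simp add: r_def inner_diff_left inner_diff_right power2_eq_square algebra_simps inner_commute)
    also have "D (D x) \<bullet> x = (norm (D x))\<^sup>2"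
      using Dsym[OF DH[OF x(1)] x(1)] by (simp add: power2_norm_eq_inner)
    finally have r2: "(norm r)\<^sup>2 = (norm (D (D x)))\<^sup>2 - 2 * s * (norm (D x))\<^sup>2 + s\<^sup>2 * (norm x)\<^sup>2"
      by (simp add: power2_norm_eq_inner)
    have "(norm x)\<^sup>2 \<le> 1" using x(2) by (simp add: power_le_one)
    then have "s\<^sup>2 * (norm x)\<^sup>2 \<le> s\<^sup>2" by (simp add: mult_left_le)
    then have "(norm r)\<^sup>2 \<le> s * (norm (D x))\<^sup>2 - 2 * s * (norm (D x))\<^sup>2 + s\<^sup>2"
      using D_le[OF DH[OF x(1)]] r2 by linarith
    also have "\<dots> = s * (s - (norm (D x))\<^sup>2)" by (simp add: algebra_simps power2_eq_square)
    also have "\<dots> \<le> s * \<kappa>" using xs spos by (intro mult_left_mono) auto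
    finally have "(norm r)\<^sup>2 \<le> \<tau>\<^sup>2" using \<open>s * \<kappa> = \<tau>\<^sup>2\<close> by simp
    then have r\<tau>: "norm r \<le> \<tau>" using less_imp_le[OF \<tau>] by (rule power2_le_imp_le)
    have rH: "r \<in> H" using x DH by (simp add: r_def)
    \<comment> \<open>Used with the two operators in both orders: \<open>R\<close>, \<open>Q\<close>
      are \<open>S'\<close>, \<open>S\<close> and then \<open>S\<close>, \<open>S'\<close>. The
      vector \<open>x\<close> is nearly an eigenvector of the square of \<open>D\<close>, with
      residual \<open>r\<close>.\<close>
    have key: "s * (R x \<bullet> x) \<le> \<tau>"
      if R: "\<And>y. y \<in> H \<Longrightarrow> R y \<in> H" "\<And>y z. y \<in> H \<Longrightarrow> z \<in> H \<Longrightarrow> R y \<bullet> z = y \<bullet> R z"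
        "norm (R x) \<le> norm x" and Q: "0 \<le> Q (D x) \<bullet> D x" and QR: "Q (D x) = - D (R x)" for R Q
    proof -
      have "Q (D x) \<bullet> D x = - (R x \<bullet> D (D x))"
        unfolding QR using Dsym[OF R(1)[OF x(1)] DH[OF x(1)]] by simp
      also have "D (D x) = r + s *\<^sub>R x" by (simp add: r_def)
      finally have "s * (R x \<bullet> x) \<le> - (R x \<bullet> r)" using Q by (simp add: inner_add_right)
      also have "\<dots> \<le> norm (R x) * norm r"
        using Cauchy_Schwarz_ineq2[of "R x" r] by linarith
      also have "\<dots> \<le> 1 * \<tau>" using R(3) x(2) r\<tau> by (intro mult_mono) auto
      finally show ?thesis by simp
    qed
    have pos0: "0 \<le> S y \<bullet> y" "0 \<le> S' y \<bullet> y" if "y \<in> H" for y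
      using pos(1)[OF that] pos(2)[OF that] inner_ge_zero[of "S y"] inner_ge_zero[of "S' y"] by linarith+
    have 1: "s * (S' x \<bullet> x) \<le> \<tau>"
    proof (rule key[where Q=S])
      show "S (D x) = - D (S' x)" using x(1) H diff sq by (simp add: D_def)
    qed (use H sym le pos0 DH x in auto)
    have 2: "s * (S x \<bullet> x) \<le> \<tau>"
    proof (rule key[where Q=S'])
      show "S' (D x) = - D (S x)" using x(1) H diff sq by (simp add: D_def)
    qed (use H sym le pos0 DH x in auto)
    have "(norm (D x))\<^sup>2 \<le> 2 * (S x \<bullet> S x) + 2 * (S' x \<bullet> S' x)"
      using sum_sq_le[OF H(1)[OF x(1)] H(2)[OF x(1)]] by (simp add: D_def power2_norm_eq_inner)
    also have "\<dots> \<le> 2 * (S x \<bullet> x) + 2 * (S' x \<bullet> x)"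
      using pos x(1) by (intro add_mono mult_left_mono) auto
    finally have "s * (norm (D x))\<^sup>2 \<le> s * (2 * (S x \<bullet> x) + 2 * (S' x \<bullet> x))"
      using spos by (intro mult_left_mono) auto
    also have "\<dots> \<le> 4 * \<tau>" using 1 2 by (simp add: distrib_left)
    also have "\<dots> = s * (s / 4)" by (simp add: \<tau>_def power2_eq_square)
    finally have "(norm (D x))\<^sup>2 \<le> s / 4" using spos by simp
    moreover have "\<kappa> \<le> s / 16"
    proof -
      have "s\<^sup>2 \<le> 4\<^sup>2" using s4 s0 by (intro power_mono)
      then have "s * s\<^sup>2 \<le> s * 16" using s0 by (intro mult_left_mono) auto
      then show ?thesis by (simp add: \<kappa>_def power2_eq_square power3_eq_cube)
    qed
    ultimately show False using xs spos by linarith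
  qed
  then have "(norm (D x))\<^sup>2 \<le> 0" using D_le[OF x] by simp
  then show ?thesis by (simp add: D_def)
qed

text \<open>Both squares solve the same form equation, which does not mention the spectral measure,
  so they agree by coercivity; then the positive root is unique.\<close>

lemma form_operator_pvm_root_unique:
  assumes "form_operator_pvm H V a E" "form_operator_pvm H V a E'" "x \<in> H"
  shows "form_operator_pvm.S H E x = form_operator_pvm.S H E' x"
proof -
  interpret A: form_operator_pvm H V a E by fact
  interpret B: form_operator_pvm H V a E' by fact
  show ?thesis
  proof (rule A.positive_root_unique[OF A.S_in_H B.S_in_H A.S_diff B.S_diff A.S_scale B.S_scale
        A.S_sym B.S_sym A.S_norm_le_inner B.S_norm_le_inner A.S_norm_le B.S_norm_le _ assms(3)])
    fix y assume "y \<in> H"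
    then show "A.S (A.S y) = B.S (B.S y)"
      by (intro A.form_eqI) (simp_all add: A.S_S_V B.S_S_V)
  qed
qed

section \<open>Tikhonov regularization with a quadratic form penalty\<close>

locale tikhonov = form_operator H V a
  for H V :: "'h::real_inner set" and a +
  fixes K :: "'h \<Rightarrow> 'h" and \<alpha> C :: real
  assumes K_in_H: "u \<in> V \<Longrightarrow> K u \<in> H"
    and K_add: "u \<in> V \<Longrightarrow> v \<in> V \<Longrightarrow> K (u + v) = K u + K v"
    and K_scale: "u \<in> V \<Longrightarrow> K (c *\<^sub>R u) = c *\<^sub>R K u"
    and K_bound: "u \<in> V \<Longrightarrow> norm (K u) \<le> C * sqrt (a u u)"
    and \<alpha>_pos: "0 < \<alpha>"
begin

text \<open>The bilinear form of the normal equation; half of \<open>b u u\<close> is the quadratic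
  part of the Tikhonov functional.\<close>

definition b where "b u v = K u \<bullet> K v + \<alpha> * a u v"

lemma form_le_b: "u \<in> V \<Longrightarrow> \<alpha> * a u u \<le> b u u"
  by (simp add: b_def)

end

text \<open>The diagonal of \<open>b\<close> lies between \<alpha> and C^2 + \<alpha> times that of
  \<open>a\<close>, so completeness carries over.\<close>

sublocale tikhonov \<subseteq> b: form_space V b
proof
  fix X :: "nat \<Rightarrow> 'h"
  assume X: "\<And>n. X n \<in> V"
    and cauchy: "\<And>e. e > 0 \<Longrightarrow> \<exists>N. \<forall>m\<ge>N. \<forall>n\<ge>N. b (X m - X n) (X m - X n) < e"
  have "\<exists>l\<in>V. (\<lambda>n. a (X n - l) (X n - l)) \<longlonglongrightarrow> 0"
  proof (rule V.complete[OF X])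
    fix e :: real assume "e > 0"
    then have "\<alpha> * e > 0" using \<alpha>_pos by simp
    from cauchy[OF this] obtain N where
      N: "\<And>m n. m \<ge> N \<Longrightarrow> n \<ge> N \<Longrightarrow> b (X m - X n) (X m - X n) < \<alpha> * e" by blast
    have "a (X m - X n) (X m - X n) < e" if "m \<ge> N" "n \<ge> N" for m n
    proof -
      have "\<alpha> * a (X m - X n) (X m - X n) < \<alpha> * e"
        using form_le_b[OF V.closed(3)[OF X X], of m n] N[OF that] by linarith
      then show ?thesis using \<alpha>_pos by simp
    qed
    then show "\<exists>N. \<forall>m\<ge>N. \<forall>n\<ge>N. a (X m - X n) (X m - X n) < e" by blast
  qed
  then obtain l where l: "l \<in> V" and lim: "(\<lambda>n. a (X n - l) (X n - l)) \<longlonglongrightarrow> 0" by blast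
  have "(\<lambda>n. b (X n - l) (X n - l)) \<longlonglongrightarrow> 0"
  proof (rule Lim_null_comparison[OF always_eventually])
    show "\<forall>n. norm (b (X n - l) (X n - l)) \<le> (C\<^sup>2 + \<alpha>) * a (X n - l) (X n - l)"
    proof
      fix n
      define d where "d = X n - l"
      have d: "d \<in> V" using X l by (simp add: d_def)
      have "(norm (K d))\<^sup>2 \<le> (C * sqrt (a d d))\<^sup>2"
        using K_bound[OF d] by (intro power_mono) auto
      then have "K d \<bullet> K d \<le> C\<^sup>2 * a d d"
        using V.nonneg[OF d] by (simp add: power2_norm_eq_inner power_mult_distrib)
      then show "norm (b (X n - l) (X n - l)) \<le> (C\<^sup>2 + \<alpha>) * a (X n - l) (X n - l)"
        unfolding d_def[symmetric] using V.nonneg[OF d] \<alpha>_pos by (simp add: b_def distrib_right)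
    qed
    show "(\<lambda>n. (C\<^sup>2 + \<alpha>) * a (X n - l) (X n - l)) \<longlonglongrightarrow> 0"
      using tendsto_mult_left[OF lim, of "C\<^sup>2 + \<alpha>"] by simp
  qed
  with l show "\<exists>l\<in>V. (\<lambda>n. b (X n - l) (X n - l)) \<longlonglongrightarrow> 0" by blast
next
  fix u v assume "u \<in> V" "v \<in> V"
  then show "b u v = b v u" using V.sym by (simp add: b_def inner_commute)
qed (use V.subsp V.nonneg \<alpha>_pos in
    \<open>auto simp: b_def K_add K_scale V.add_left V.scale_left inner_add_left distrib_left\<close>)

context tikhonov
begin

lemma b_eqI:
  assumes "u \<in> V" "u' \<in> V" "\<And>v. v \<in> V \<Longrightarrow> b u v = b u' v"
  shows "u = u'"
proof -
  have 0: "b (u - u') (u - u') = 0" using assms by (simp add: b.diff_left)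
  have "\<alpha> * a (u - u') (u - u') \<le> 0" using form_le_b[of "u - u'"] assms 0 by simp
  then have "a (u - u') (u - u') \<le> 0" using \<alpha>_pos by (simp add: mult_le_0_iff)
  then have "(u - u') \<bullet> (u - u') \<le> 0" using coercive[of "u - u'"] assms by simp
  then show ?thesis using inner_ge_zero[of "u - u'"] by (simp add: antisym_conv)
qed

lemma b_riesz:
  assumes "\<And>u v. u \<in> V \<Longrightarrow> v \<in> V \<Longrightarrow> \<phi> (u + v) = \<phi> u + \<phi> v" "\<And>u c. u \<in> V \<Longrightarrow> \<phi> (c *\<^sub>R u) = c * \<phi> u"
    and bound: "\<And>v. v \<in> V \<Longrightarrow> \<bar>\<phi> v\<bar> \<le> D * sqrt (a v v)"
  shows "\<exists>u\<in>V. \<forall>v\<in>V. b u v = \<phi> v"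
proof (rule b.riesz[OF assms(1,2)])
  fix v assume v: "v \<in> V"
  have "sqrt \<alpha> * sqrt (a v v) \<le> sqrt (b v v)"
    using form_le_b[OF v] by (simp flip: real_sqrt_mult)
  then have le: "sqrt (a v v) \<le> sqrt (b v v) / sqrt \<alpha>"
    using \<alpha>_pos by (simp add: pos_le_divide_eq mult.commute)
  have "\<bar>\<phi> v\<bar> \<le> D * sqrt (a v v)" by (rule bound[OF v])
  also have "\<dots> \<le> \<bar>D\<bar> * sqrt (a v v)" using V.nonneg[OF v] by (intro mult_right_mono) auto
  also have "\<dots> \<le> \<bar>D\<bar> * (sqrt (b v v) / sqrt \<alpha>)" by (intro mult_left_mono le) simp
  finally show "\<bar>\<phi> v\<bar> \<le> \<bar>D\<bar> / sqrt \<alpha> * sqrt (b v v)" by simp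
qed

text \<open>Characterized by the normal equation rather than by minimization, so that linearity in
  the data is immediate; \<open>J_minimizer\<close> later identifies it with the minimizer.\<close>

definition sol where "sol y = (SOME u. u \<in> V \<and> (\<forall>v\<in>V. b u v = y \<bullet> K v))"

lemma sol: "sol y \<in> V" "v \<in> V \<Longrightarrow> b (sol y) v = y \<bullet> K v"
proof -
  have "\<exists>u\<in>V. \<forall>v\<in>V. b u v = y \<bullet> K v"
  proof (rule b_riesz[where D = "norm y * C"])
    fix v assume v: "v \<in> V"
    have "\<bar>y \<bullet> K v\<bar> \<le> norm y * norm (K v)" by (rule Cauchy_Schwarz_ineq2)
    also have "\<dots> \<le> norm y * (C * sqrt (a v v))" using K_bound[OF v] by (intro mult_left_mono) auto
    finally show "\<bar>y \<bullet> K v\<bar> \<le> norm y * C * sqrt (a v v)" by simp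
  qed (simp_all add: K_add K_scale inner_add_right)
  then have "\<exists>u. u \<in> V \<and> (\<forall>v\<in>V. b u v = y \<bullet> K v)" by blast
  then have "sol y \<in> V \<and> (\<forall>v\<in>V. b (sol y) v = y \<bullet> K v)" unfolding sol_def by (rule someI_ex)
  then show "sol y \<in> V" "v \<in> V \<Longrightarrow> b (sol y) v = y \<bullet> K v" by auto
qed

lemma sol_add: "sol (x + y) = sol x + sol y"
  by (rule b_eqI) (simp_all add: sol b.add_left inner_add_left)

lemma sol_diff: "sol (x - y) = sol x - sol y"
  by (rule b_eqI) (simp_all add: sol b.diff_left inner_diff_left)

definition J where "J y u = 1 / 2 * (norm (K u - y))\<^sup>2 + \<alpha> / 2 * a u u"

text \<open>Exact quadratic expansion: the linear term vanishes by the normal equation. Existence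
  and uniqueness of the minimizer are both read off from it.\<close>

lemma J_sol:
  assumes v: "v \<in> V"
  shows "J y v = J y (sol y) + 1 / 2 * b (v - sol y) (v - sol y)"
proof -
  let ?u = "sol y"
  have eq: "J y u = 1 / 2 * b u u - y \<bullet> K u + 1 / 2 * (y \<bullet> y)" if "u \<in> V" for u
    by (simp add: J_def b_def power2_norm_eq_inner inner_diff_left inner_diff_right
        inner_commute algebra_simps)
  have 1: "b ?u v = y \<bullet> K v" "b ?u ?u = y \<bullet> K ?u" using sol v by auto
  have 2: "b (v - ?u) (v - ?u) = b v v - 2 * b ?u v + b ?u ?u"
    using v sol(1)[of y] b.sym[of v ?u] by (simp add: b.bilin)
  show ?thesis unfolding eq[OF v] eq[OF sol(1)] 2 1 by (simp add: field_simps)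
qed

lemma J_minimizer:
  "is_arg_min (J y) (\<lambda>v. v \<in> V) u \<longleftrightarrow> u = sol y"
proof
  assume u: "is_arg_min (J y) (\<lambda>v. v \<in> V) u"
  then have uV: "u \<in> V" and "\<not> J y (sol y) < J y u" using sol(1)[of y] by (auto simp: is_arg_min_def)
  then have "b (u - sol y) (u - sol y) \<le> 0" using J_sol[OF uV, of y] by simp
  then have 0: "b (u - sol y) (u - sol y) = 0" using b.nonneg[of "u - sol y"] uV sol(1) by simp
  show "u = sol y"
  proof (rule b_eqI[OF uV sol(1)])
    fix v assume v: "v \<in> V"
    have "(b (u - sol y) v)\<^sup>2 \<le> 0"
      using b.cauchy_schwarz[of "u - sol y" v] uV sol(1) v 0 by simp
    then show "b u v = b (sol y) v" using uV sol(1) v by (simp add: b.diff_left)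
  qed
next
  assume "u = sol y"
  moreover have "J y (sol y) \<le> J y v" if v: "v \<in> V" for v
    using J_sol[OF v, of y] b.nonneg[OF V.closed(3)[OF v sol(1)], of y] by linarith
  ultimately show "is_arg_min (J y) (\<lambda>v. v \<in> V) u"
    using sol(1)[of y] unfolding is_arg_min_def by (metis not_less)
qed

text \<open>Testing the normal equation with its solution and \<open>\<parallel>y\<parallel> t \<le> t\<^sup>2 + \<parallel>y\<parallel>\<^sup>2 / 4\<close>.\<close>

lemma sol_noise_bound: "a (sol y) (sol y) \<le> (norm y)\<^sup>2 / (4 * \<alpha>)"
proof -
  let ?t = "norm (K (sol y))"
  have "?t\<^sup>2 + \<alpha> * a (sol y) (sol y) = y \<bullet> K (sol y)"
    using sol(2)[OF sol(1), of y y] by (simp add: b_def power2_norm_eq_inner)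
  also have "\<dots> \<le> norm y * ?t" by (rule norm_cauchy_schwarz)
  also have "\<dots> \<le> ?t\<^sup>2 + (norm y)\<^sup>2 / 4"
    using zero_le_power2[of "?t - norm y / 2"] by (simp add: power2_diff power_divide mult.commute)
  finally show ?thesis using \<alpha>_pos by (simp add: field_simps)
qed

text \<open>Supplies measurability of the random error. A difference of solutions solves the problem
  for the difference of data, so \<open>sol_noise_bound\<close> yields the Lipschitz constant, the
  root of 1 / (4 \<alpha>).\<close>

lemma sol_continuous:
  assumes q: "q \<in> V"
  shows "continuous_on UNIV (\<lambda>y. sqrt (a (sol y - q) (sol y - q)))"
proof (rule lipschitz_on_continuous_on)
  let ?f = "\<lambda>y. sqrt (a (sol y - q) (sol y - q))" and ?L = "1 / (2 * sqrt \<alpha>)"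
  have le: "?f x \<le> ?f y + ?L * dist x y" for x y
  proof -
    have "sol x - q = (sol y - q) + sol (x - y)" by (simp add: sol_diff)
    then have "?f x \<le> ?f y + sqrt (a (sol (x - y)) (sol (x - y)))"
      using V.minkowski[of "sol y - q" "sol (x - y)"] q sol(1) by (simp only: V.closed)
    also have "sqrt (a (sol (x - y)) (sol (x - y))) \<le> sqrt ((norm (x - y))\<^sup>2 / (4 * \<alpha>))"
      by (intro real_sqrt_le_mono sol_noise_bound)
    also have "\<dots> = ?L * dist x y"
      by (simp add: real_sqrt_divide real_sqrt_mult dist_norm)
    finally show ?thesis by simp
  qed
  show "?L-lipschitz_on UNIV ?f"
  proof (rule lipschitz_onI)
    fix x y
    show "dist (?f x) (?f y) \<le> ?L * dist x y"
      using le[of x y] le[of y x] by (simp add: dist_real_def dist_commute abs_le_iff)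
  qed (use \<alpha>_pos in simp)
qed

text \<open>By linearity the error is \<open>sol\<close> of the noise minus the bias
  \<open>q\<close>. The mean of the noise is not prescribed, so the cross term is absorbed by the
  factor 2 of \<open>sum_sq_le\<close>, and 1 / (4 \<alpha>) becomes 1 / (2 \<alpha>).\<close>

lemma mean_error:
  assumes M: "prob_space M" and \<eta>: "\<eta> \<in> borel_measurable M"
    and int: "integrable M (\<lambda>\<omega>. (norm (\<eta> \<omega>))\<^sup>2)" and \<delta>: "(\<integral>\<omega>. (norm (\<eta> \<omega>))\<^sup>2 \<partial>M) \<le> \<delta>\<^sup>2"
    and u: "u \<in> V" and Q: "a (u - sol (K u)) (u - sol (K u)) \<le> Q"
  shows "integrable M (\<lambda>\<omega>. a (sol (K u + \<eta> \<omega>) - u) (sol (K u + \<eta> \<omega>) - u))"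
    and "(\<integral>\<omega>. a (sol (K u + \<eta> \<omega>) - u) (sol (K u + \<eta> \<omega>) - u) \<partial>M) \<le> \<delta>\<^sup>2 / (2 * \<alpha>) + 2 * Q"
proof -
  interpret prob_space M by fact
  define q where "q = u - sol (K u)"
  have q: "q \<in> V" using u sol(1) by (simp add: q_def)
  have err: "sol (K u + e) - u = sol e - q" for e by (simp add: q_def sol_add)
  have nn: "0 \<le> a (sol e - q) (sol e - q)" for e using q sol(1) by (intro V.nonneg) auto
  have "(\<lambda>y. sqrt (a (sol y - q) (sol y - q))) \<in> borel_measurable borel"
    by (rule borel_measurable_continuous_onI[OF sol_continuous[OF q]])
  from measurable_compose[OF \<eta> borel_measurable_power[OF this, of 2]]
  have meas: "(\<lambda>\<omega>. a (sol (\<eta> \<omega>) - q) (sol (\<eta> \<omega>) - q)) \<in> borel_measurable M"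
    using nn by simp
  have le: "a (sol e - q) (sol e - q) \<le> (norm e)\<^sup>2 / (2 * \<alpha>) + 2 * Q" for e
  proof -
    have "a (sol e - q) (sol e - q) \<le> 2 * a (sol e) (sol e) + 2 * a q q"
      by (rule V.sum_sq_le[OF sol(1) q])
    also have "\<dots> \<le> 2 * ((norm e)\<^sup>2 / (4 * \<alpha>)) + 2 * Q"
      using Q sol_noise_bound[of e] by (simp add: q_def)
    finally show ?thesis by simp
  qed
  have int2: "integrable M (\<lambda>\<omega>. (norm (\<eta> \<omega>))\<^sup>2 / (2 * \<alpha>) + 2 * Q)"
    using int by simp
  have int3: "integrable M (\<lambda>\<omega>. a (sol (\<eta> \<omega>) - q) (sol (\<eta> \<omega>) - q))"
    using le nn by (intro Bochner_Integration.integrable_bound[OF int2 meas] AE_I2)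
      (simp add: abs_of_nonneg order_trans[OF nn le])
  then show "integrable M (\<lambda>\<omega>. a (sol (K u + \<eta> \<omega>) - u) (sol (K u + \<eta> \<omega>) - u))" by (simp add: err)
  have "(\<integral>\<omega>. a (sol (\<eta> \<omega>) - q) (sol (\<eta> \<omega>) - q) \<partial>M) \<le> (\<integral>\<omega>. (norm (\<eta> \<omega>))\<^sup>2 / (2 * \<alpha>) + 2 * Q \<partial>M)"
    by (rule integral_mono[OF int3 int2 le])
  also have "\<dots> = (\<integral>\<omega>. (norm (\<eta> \<omega>))\<^sup>2 \<partial>M) / (2 * \<alpha>) + 2 * Q"
    using int by (simp add: prob_space)
  also have "\<dots> \<le> \<delta>\<^sup>2 / (2 * \<alpha>) + 2 * Q"
    using \<delta> \<alpha>_pos by (simp add: divide_right_mono)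
  finally show "(\<integral>\<omega>. a (sol (K u + \<eta> \<omega>) - u) (sol (K u + \<eta> \<omega>) - u) \<partial>M) \<le> \<delta>\<^sup>2 / (2 * \<alpha>) + 2 * Q"
    by (simp add: err)
qed

section \<open>The bias under the source condition\<close>

definition KA where "KA = {(f, K u) | f u. (f, u) \<in> op_power H (form_op H V a) (- 1 / 2)}"

lemma bias_bound:
  assumes u: "u \<in> V" and uz: "(u, z) \<in> op_power H (form_op H V a) (1 / 2)"
    and wz: "(w, z) \<in> op_power H (KA O adjoint_op H KA) \<beta>" and \<beta>: "0 < \<beta>" "\<beta> \<le> 1"
  shows "a (u - sol (K u)) (u - sol (K u)) \<le> (c_const \<beta> * \<alpha> powr \<beta>)\<^sup>2 * (w \<bullet> w)"
proof -
  have pvmI: "form_operator_pvm H V a E" if "spectral_measure_of H (form_op H V a) E" for E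
    using that form_operator_axioms hilbert_subspace_axioms
    by (simp add: spectral_measure_of_def form_operator_pvm_def pvm_def pvm_axioms_def
        form_operator_pvm_axioms_def)
  have roots: "(\<lambda>t. t powr (- 1 / 2)) = root_inv" "(\<lambda>t. t powr (1 / 2)) = root_pos"
    by (auto simp: root_inv_def root_pos_def)
  obtain E where E: "spectral_measure_of H (form_op H V a) E" and uzE: "(u, z) \<in> spectral_integral H E root_pos"
    using uz unfolding op_power_def roots by blast
  interpret E: form_operator_pvm H V a E by (rule pvmI[OF E])
  let ?S = E.S
  \<comment> \<open>The power -1/2 ranges over all spectral measures of the form operator;
    uniqueness of the positive root collapses it to the graph of the one map
    \<open>?S\<close>.\<close>
  have power_iff: "(f, v) \<in> op_power H (form_op H V a) (- 1 / 2) \<longleftrightarrow> f \<in> H \<and> v = ?S f" for f v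
  proof
    assume "(f, v) \<in> op_power H (form_op H V a) (- 1 / 2)"
    then obtain E' where E': "spectral_measure_of H (form_op H V a) E'"
      and fv: "(f, v) \<in> spectral_integral H E' root_inv" unfolding op_power_def roots by blast
    interpret E': form_operator_pvm H V a E' by (rule pvmI[OF E'])
    have f: "f \<in> H" using E'.spectral_integralD(2)[OF fv] .
    then show "f \<in> H \<and> v = ?S f"
      using E'.S_unique[OF fv] form_operator_pvm_root_unique[OF pvmI[OF E] pvmI[OF E'] f] by simp
  next
    assume "f \<in> H \<and> v = ?S f"
    then show "(f, v) \<in> op_power H (form_op H V a) (- 1 / 2)"
      using E E.S_spectral unfolding op_power_def roots by blast
  qed
  have SV: "?S x \<in> V" if "x \<in> H" for x using E.S_in_V_iso(1)[OF that] .
  let ?T = "KA O adjoint_op H KA"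
  have T_iff: "(f, g) \<in> ?T \<longleftrightarrow> f \<in> H \<and> g \<in> H \<and> (\<forall>x\<in>H. K (?S x) \<bullet> K (?S f) = x \<bullet> g)" for f g
  proof -
    have "KA = {(x, K (?S x)) | x. x \<in> H}" unfolding KA_def power_iff by blast
    then show ?thesis using K_in_H SV by (auto simp: adjoint_op_def relcomp_unfold)
  qed
  have zH: "z \<in> H" using E.spectral_integralD(3)[OF uzE] .
  have Sz: "?S z = u" by (rule E.S_root_pos[OF uzE])
  obtain F where F: "projection_valued_measure H F" and T: "?T = spectral_integral H F (\<lambda>t. t)"
    and wzF: "(w, z) \<in> spectral_integral H F (\<lambda>t. t powr \<beta>)"
    using wz unfolding op_power_def spectral_measure_of_def by blast
  interpret F: pvm H F by unfold_locales (rule F)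
  have T_pos: "0 * (p \<bullet> p) \<le> y \<bullet> p" if "(p, y) \<in> spectral_integral H F (\<lambda>t. t)" for p y
  proof -
    have "p \<in> H" "K (?S p) \<bullet> K (?S p) = p \<bullet> y" using that T_iff[of p y] unfolding T by auto
    then show ?thesis by (metis inner_commute inner_ge_zero mult_zero_left)
  qed
  \<comment> \<open>Dictionary between \<open>V\<close> and \<open>H\<close>: through the isometry
    \<open>?S\<close>, an equation for \<open>b\<close> tested on \<open>V\<close> becomes T p +
    \<alpha> p = v.\<close>
  have normal: "(p, y) \<in> spectral_integral H F (\<lambda>t. t)"
    if p: "p \<in> H" and y: "y \<in> H" and v: "v \<in> H"
      and eq: "\<And>\<xi>. \<xi> \<in> H \<Longrightarrow> b (?S p) (?S \<xi>) = a (?S v) (?S \<xi>)"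
      and yp: "y + \<alpha> *\<^sub>R p = v" for p y v
  proof -
    have "K (?S \<xi>) \<bullet> K (?S p) = \<xi> \<bullet> y" if \<xi>: "\<xi> \<in> H" for \<xi>
    proof -
      have "K (?S p) \<bullet> K (?S \<xi>) + \<alpha> * (p \<bullet> \<xi>) = v \<bullet> \<xi>"
        using eq[OF \<xi>] E.S_in_V_iso(2)[OF p \<xi>] E.S_in_V_iso(2)[OF v \<xi>] by (simp add: b_def)
      also have "v \<bullet> \<xi> = y \<bullet> \<xi> + \<alpha> * (p \<bullet> \<xi>)" unfolding yp[symmetric] by (simp add: inner_add_left)
      finally show ?thesis by (simp add: inner_commute)
    qed
    then show ?thesis unfolding T[symmetric] T_iff using p y by blast
  qed
  \<comment> \<open>Riesz for \<open>b\<close> with the functional \<open>a (?S x)\<close> solves T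
    p + \<alpha> p = x; as \<open>T_pos\<close> gives m = 0, the support of \<open>F\<close> lies in
    [0,\<infinity>).\<close>
  have nonneg: "AE t in F.\<mu> x. 0 \<le> t" if x: "x \<in> H" for x
  proof (rule F.spectral_lower_bound[where \<alpha>=\<alpha>, OF _ T_pos])
    fix x assume x: "x \<in> H"
    have "\<exists>q\<in>V. \<forall>v\<in>V. b q v = a (?S x) v"
    proof (rule b_riesz)
      fix v assume "v \<in> V"
      then show "\<bar>a (?S x) v\<bar> \<le> sqrt (a (?S x) (?S x)) * sqrt (a v v)"
        by (rule V.cauchy_schwarz_sqrt[OF SV[OF x]])
    qed (use SV[OF x] in \<open>simp_all add: V.add_right V.scale_right\<close>)
    then obtain q where q: "q \<in> V" "\<And>v. v \<in> V \<Longrightarrow> b q v = a (?S x) v" by blast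
    obtain p where p: "p \<in> H" "q = ?S p" using E.S_onto[OF q(1)] by blast
    have "(p, x - \<alpha> *\<^sub>R p) \<in> spectral_integral H F (\<lambda>t. t)"
      using p q SV x by (intro normal[where v=x]) auto
    then show "\<exists>p y. (p, y) \<in> spectral_integral H F (\<lambda>t. t) \<and> y + \<alpha> *\<^sub>R p = x"
      by (intro exI[of _ p] exI[of _ "x - \<alpha> *\<^sub>R p"]) simp
  qed (use \<alpha>_pos x in auto)
  define q where "q = u - sol (K u)"
  have qV: "q \<in> V" using u sol(1) by (simp add: q_def)
  obtain p where p: "p \<in> H" "q = ?S p" using E.S_onto[OF qV] by blast
  \<comment> \<open>The only possible value of T p: the normal equation gives
    \<open>b q v = \<alpha> * a u v\<close> with \<open>u = ?S z\<close>, that is T p + \<alpha> p =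
    \<alpha> z.\<close>
  define y where "y = \<alpha> *\<^sub>R z - \<alpha> *\<^sub>R p"
  have "(p, y) \<in> spectral_integral H F (\<lambda>t. t)"
  proof (rule normal[where v="\<alpha> *\<^sub>R z"])
    fix \<xi> assume \<xi>: "\<xi> \<in> H"
    have "b q (?S \<xi>) = b u (?S \<xi>) - K u \<bullet> K (?S \<xi>)"
      using sol u SV[OF \<xi>] by (simp add: q_def b.diff_left)
    also have "\<dots> = a (?S (\<alpha> *\<^sub>R z)) (?S \<xi>)"
      using zH u SV[OF \<xi>] by (simp add: b_def E.S_scale V.scale_left Sz)
    finally show "b (?S p) (?S \<xi>) = a (?S (\<alpha> *\<^sub>R z)) (?S \<xi>)" by (simp add: p(2))
  qed (use p zH in \<open>auto simp: y_def\<close>)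
  from F.source_bias_bound[OF this wzF _ nonneg[OF p(1)] nonneg[OF F.spectral_integralD(2)[OF wzF]] \<alpha>_pos \<beta>]
  have "p \<bullet> p \<le> (c_const \<beta> * \<alpha> powr \<beta>)\<^sup>2 * (w \<bullet> w)" by (simp add: y_def)
  moreover have "a q q = p \<bullet> p" unfolding p(2) by (rule E.S_in_V_iso(2)[OF p(1,1)])
  ultimately show ?thesis by (simp add: q_def)
qed

end

section \<open>Completeness of the concrete function spaces\<close>

lemma sq_int_rep: "sq_int (rep_L2 u)"
  using Quotient3_rep_reflp[OF Quotient3_L2, of u] by (simp add: sq_int_eq_def)

lemma rep_L2_measurable[measurable]: "rep_L2 u \<in> borel_measurable lborel"
  using sq_int_rep[of u] by (simp add: sq_int_def)

lemma sq_int_eq_refl: "sq_int f \<Longrightarrow> sq_int_eq f f"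
  by (simp add: sq_int_eq_def)

lemma rep_abs_L2: "sq_int f \<Longrightarrow> AE x in lborel. rep_L2 (abs_L2 f) x = f x"
  using Quotient3_rep_abs[OF Quotient3_L2 sq_int_eq_refl, of f] by (simp add: sq_int_eq_def)

lemma abs_rep_L2: "abs_L2 (rep_L2 u) = u"
  by (rule Quotient3_abs_rep[OF Quotient3_L2])

lemmas rep_refl = sq_int_eq_refl[OF sq_int_rep]

text \<open>Representatives are arbitrary choices in each class, so they respect the vector
  operations only almost everywhere.\<close>

lemma rep_L2_add: "AE x in lborel. rep_L2 (u + v) x = rep_L2 u x + rep_L2 v x"
  using plus_L2.abs_eq[OF rep_refl[of u] rep_refl[of v]] rep_abs_L2[OF sq_int_add[OF sq_int_rep sq_int_rep], of u v]
  by (simp add: abs_rep_L2)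

lemma rep_L2_diff: "AE x in lborel. rep_L2 (u - v) x = rep_L2 u x - rep_L2 v x"
  using minus_L2.abs_eq[OF rep_refl[of u] rep_refl[of v]] rep_abs_L2[OF sq_int_diff[OF sq_int_rep sq_int_rep], of u v]
  by (simp add: abs_rep_L2)

lemma rep_L2_scale: "AE x in lborel. rep_L2 (c *\<^sub>R u) x = c * rep_L2 u x"
  using scaleR_L2.abs_eq[OF rep_refl[of u], of c] rep_abs_L2[OF sq_int_scale[OF sq_int_rep], of c u]
  by (simp add: abs_rep_L2)

lemma rep_L2_zero: "AE x in lborel. rep_L2 0 x = 0"
  using rep_abs_L2[OF sq_int_0] by (simp add: zero_L2.abs_eq)

lemma norm_L2_sq: "(norm u)\<^sup>2 = (\<integral>x. (rep_L2 u x)\<^sup>2 \<partial>lborel)"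
  unfolding power2_norm_eq_inner inner_L2.rep_eq by (simp only: power2_eq_square)

lemma nn_integral_rep_L2: "(\<integral>\<^sup>+x. ennreal ((rep_L2 u x)\<^sup>2) \<partial>lborel) = ennreal ((norm u)\<^sup>2)"
  using sq_int_rep[of u] unfolding norm_L2_sq sq_int_def by (intro nn_integral_eq_integral) auto

text \<open>Fatou's lemma, used both for the completeness of L2 and for the lower semicontinuity of
  the Gagliardo form.\<close>

lemma nn_integral_limit_le:
  fixes g :: "nat \<Rightarrow> 'a \<Rightarrow> real"
  assumes meas: "\<And>m. g m \<in> borel_measurable M"
    and lim: "AE x in M. (\<lambda>m. g m x) \<longlonglongrightarrow> f x"
    and le: "\<And>m. m \<ge> N \<Longrightarrow> (\<integral>\<^sup>+x. ennreal (g m x) \<partial>M) \<le> C"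
  shows "(\<integral>\<^sup>+x. ennreal (f x) \<partial>M) \<le> C"
proof -
  have "(\<integral>\<^sup>+x. ennreal (f x) \<partial>M) = (\<integral>\<^sup>+x. liminf (\<lambda>m. ennreal (g m x)) \<partial>M)"
    by (intro nn_integral_cong_AE, use lim in eventually_elim)
      (intro lim_imp_Liminf[symmetric] tendsto_ennrealI, auto)
  also have "\<dots> \<le> liminf (\<lambda>m. \<integral>\<^sup>+x. ennreal (g m x) \<partial>M)"
    using meas by (intro nn_integral_liminf) auto
  also have "\<dots> \<le> C"
    by (rule Liminf_le) (use le in \<open>auto simp: eventually_sequentially\<close>)
  finally show ?thesis .
qed

text \<open>Riesz-Fischer. The almost everywhere convergent subsequence is part of the conclusion
  because vanishing outside a set and the Gagliardo form are both handled pointwise.\<close>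

lemma L2_Cauchy_limit:
  fixes X :: "nat \<Rightarrow> 'a::euclidean_space L2"
  assumes X: "Cauchy X"
  obtains u r where "strict_mono r" "X \<longlonglongrightarrow> u"
    "AE x in lborel. (\<lambda>n. rep_L2 (X (r n)) x) \<longlonglongrightarrow> rep_L2 u x"
proof -
  have "\<exists>N. \<forall>m\<ge>N. \<forall>n\<ge>N. norm (X m - X n) < (1/2) ^ k" for k :: nat
    using CauchyD[OF X, of "(1/2) ^ k"] by simp
  then obtain N where N: "\<And>k m n. m \<ge> N k \<Longrightarrow> n \<ge> N k \<Longrightarrow> norm (X m - X n) < (1/2) ^ k" by metis
  \<comment> \<open>Partial sums of \<open>N i + 1\<close> are strictly increasing, and the n-th one
    is at least \<open>N n\<close>.\<close>
  define r where "r n = (\<Sum>i\<le>n. N i + 1)" for n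
  have r: "strict_mono r" by (simp add: strict_mono_Suc_iff r_def)
  have rN: "N n \<le> r n" for n
    unfolding r_def by (rule order_trans[OF _ member_le_sum[of n]]) auto
  have near: "norm (X (r m) - X (r n)) < (1/2) ^ n" if "n \<le> m" for m n
    using that rN[of n] strict_mono_mono[OF r] by (intro N) (auto dest: monoD intro: order_trans)
  define f where "f n = rep_L2 (X (r n))" for n
  have f_meas[measurable]: "f n \<in> borel_measurable lborel" for n by (simp add: f_def)
  have diff: "AE x in lborel. rep_L2 (X (r m) - X (r n)) x = f m x - f n x" for m n
    unfolding f_def by (rule rep_L2_diff)
  have nn_diff: "(\<integral>\<^sup>+x. ennreal ((f m x - f n x)\<^sup>2) \<partial>lborel) \<le> ennreal ((1/4) ^ n)" if "n \<le> m" for m n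
  proof -
    have "(\<integral>\<^sup>+x. ennreal ((f m x - f n x)\<^sup>2) \<partial>lborel) = ennreal ((norm (X (r m) - X (r n)))\<^sup>2)"
      unfolding nn_integral_rep_L2[symmetric]
      by (rule nn_integral_cong_AE) (use diff[of m n] in eventually_elim, simp)
    also have "\<dots> \<le> ennreal (((1/2) ^ n)\<^sup>2)"
      using near[OF that] by (intro ennreal_leI power_mono) auto
    also have "((1/2) ^ n)\<^sup>2 = (1/4 :: real) ^ n"
      by (simp add: power2_eq_square flip: power_mult_distrib)
    finally show ?thesis .
  qed
  \<comment> \<open>The weight 2^n is still summable against the bound 4^-n. Finiteness of the sum
    at x gives |f (n+1) x - f n x|^2 \<le> c 2^-n, hence increments with a convergent geometric
    majorant.\<close>
  define D where "D n x = 2 ^ n * (f (Suc n) x - f n x)\<^sup>2" for n x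
  have D_meas[measurable]: "D n \<in> borel_measurable lborel" for n unfolding D_def by measurable
  have "(\<integral>\<^sup>+x. (\<Sum>n. ennreal (D n x)) \<partial>lborel) = (\<Sum>n. \<integral>\<^sup>+x. ennreal (D n x) \<partial>lborel)"
    by (rule nn_integral_suminf) measurable
  also have "\<dots> \<le> (\<Sum>n. ennreal ((1/2) ^ n))"
  proof (rule suminf_le)
    fix n
    have "(\<integral>\<^sup>+x. ennreal (D n x) \<partial>lborel) = ennreal (2 ^ n) * (\<integral>\<^sup>+x. ennreal ((f (Suc n) x - f n x)\<^sup>2) \<partial>lborel)"
      unfolding D_def by (subst nn_integral_cmult[symmetric]) (simp_all add: ennreal_mult)
    also have "\<dots> \<le> ennreal (2 ^ n) * ennreal ((1/4) ^ n)"
      by (intro mult_left_mono nn_diff) auto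
    also have "\<dots> = ennreal ((1/2) ^ n)"
      by (simp flip: ennreal_mult power_mult_distrib)
    finally show "(\<integral>\<^sup>+x. ennreal (D n x) \<partial>lborel) \<le> ennreal ((1/2) ^ n)" .
  qed auto
  also have "\<dots> < \<infinity>"
    by (subst suminf_ennreal2) (auto simp: summable_geometric)
  finally have "AE x in lborel. (\<Sum>n. ennreal (D n x)) \<noteq> \<infinity>"
    by (intro nn_integral_PInf_AE) auto
  then have conv: "AE x in lborel. convergent (\<lambda>n. f n x)"
  proof eventually_elim
    fix x assume fin: "(\<Sum>n. ennreal (D n x)) \<noteq> \<infinity>"
    define c where "c = enn2real (\<Sum>n. ennreal (D n x))"
    have c: "ennreal c = (\<Sum>n. ennreal (D n x))" using fin by (simp add: c_def less_top)
    have c0: "0 \<le> c" by (simp add: c_def)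
    have Dle: "D n x \<le> c" for n
    proof -
      have "ennreal (D n x) = (\<Sum>i\<in>{n}. ennreal (D i x))" by simp
      also have "\<dots> \<le> (\<Sum>i. ennreal (D i x))" by (rule sum_le_suminf) auto
      finally show ?thesis using c0 unfolding c[symmetric] by simp
    qed
    have bound: "norm (f (Suc n) x - f n x) \<le> sqrt c * sqrt (1/2) ^ n" for n
    proof -
      have "(f (Suc n) x - f n x)\<^sup>2 \<le> c * (1/2) ^ n"
        using Dle[of n] by (simp add: D_def power_one_over pos_le_divide_eq mult.commute)
      then have "sqrt ((f (Suc n) x - f n x)\<^sup>2) \<le> sqrt (c * (1/2) ^ n)" by (rule real_sqrt_le_mono)
      then have "\<bar>f (Suc n) x - f n x\<bar> \<le> sqrt (c * (1/2) ^ n)" by (simp only: real_sqrt_abs)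
      then show ?thesis by (simp add: real_sqrt_mult real_sqrt_power)
    qed
    have "sqrt (1/2) < (1::real)" by simp
    then have "summable (\<lambda>n. sqrt c * sqrt (1/2) ^ n)"
      by (intro summable_mult summable_geometric) simp
    then have "summable (\<lambda>n. f (Suc n) x - f n x)"
      by (rule summable_comparison_test'[where N=0]) (rule bound)
    then have "convergent (\<lambda>n. \<Sum>i<n. f (Suc i) x - f i x)" by (simp add: summable_iff_convergent)
    then have "convergent (\<lambda>n. f n x - f 0 x)"
      by (simp only: sum_lessThan_telescope[of "\<lambda>n. f n x"])
    then have "convergent (\<lambda>n. (f n x - f 0 x) + f 0 x)"
      by (intro convergent_add convergent_const)
    then show "convergent (\<lambda>n. f n x)" by simp
  qed
  define g where "g x = lim (\<lambda>n. f n x)" for x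
  have g_meas[measurable]: "g \<in> borel_measurable lborel"
    unfolding g_def by (rule borel_measurable_lim_metric) measurable
  have lim: "AE x in lborel. (\<lambda>n. f n x) \<longlonglongrightarrow> g x"
    using conv by eventually_elim (simp add: g_def convergent_LIMSEQ_iff)
  have nn: "(\<integral>\<^sup>+x. ennreal ((g x - f n x)\<^sup>2) \<partial>lborel) \<le> ennreal ((1/4) ^ n)" for n
  proof (rule nn_integral_limit_le[where g = "\<lambda>m x. (f m x - f n x)\<^sup>2" and N = n])
    show "AE x in lborel. (\<lambda>m. (f m x - f n x)\<^sup>2) \<longlonglongrightarrow> (g x - f n x)\<^sup>2"
      using lim by eventually_elim (intro tendsto_intros)
  qed (auto intro: nn_diff)
  have sq_diff: "sq_int (\<lambda>x. g x - f n x)" for n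
    unfolding sq_int_def
  proof
    show "integrable lborel (\<lambda>x. (g x - f n x)\<^sup>2)"
      using nn[of n] by (intro integrableI_bounded) (auto intro: le_less_trans)
  qed measurable
  have "sq_int (\<lambda>x. (g x - f 0 x) + f 0 x)"
    by (intro sq_int_add sq_diff) (simp add: f_def sq_int_rep)
  then have g: "sq_int g" by simp
  define u where "u = abs_L2 g"
  have u: "AE x in lborel. rep_L2 u x = g x" unfolding u_def by (rule rep_abs_L2[OF g])
  have "norm (X (r n) - u) \<le> (1/2) ^ n" for n
  proof -
    have "ennreal ((norm (u - X (r n)))\<^sup>2) = (\<integral>\<^sup>+x. ennreal ((g x - f n x)\<^sup>2) \<partial>lborel)"
      unfolding nn_integral_rep_L2[symmetric]
      by (rule nn_integral_cong_AE)
        (use u rep_L2_diff[of u "X (r n)"] in eventually_elim, simp add: f_def)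
    then have "ennreal ((norm (u - X (r n)))\<^sup>2) \<le> ennreal ((1/4) ^ n)"
      using nn[of n] by (simp only:)
    then have "(norm (u - X (r n)))\<^sup>2 \<le> (1/4) ^ n" by (subst (asm) ennreal_le_iff) simp_all
    also have "\<dots> = ((1/2) ^ n)\<^sup>2" by (simp add: power2_eq_square flip: power_mult_distrib)
    finally show ?thesis by (subst norm_minus_commute) (rule power2_le_imp_le, auto)
  qed
  then have "(\<lambda>n. X (r n) - u) \<longlonglongrightarrow> 0"
    by (intro Lim_null_comparison[OF always_eventually LIMSEQ_power_zero[of "1/2"]]) auto
  then have "(X \<circ> r) \<longlonglongrightarrow> u" unfolding comp_def by (rule LIM_zero_cancel)
  then have "X \<longlonglongrightarrow> u" by (rule Cauchy_converges_subseq[OF X r])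
  moreover have "AE x in lborel. (\<lambda>n. rep_L2 (X (r n)) x) \<longlonglongrightarrow> rep_L2 u x"
    using lim u by eventually_elim (simp add: f_def)
  ultimately show ?thesis using that r by blast
qed

lemma L2_on_limit:
  assumes X: "\<And>n. X n \<in> L2_on \<Omega>"
    and lim: "AE x in lborel. (\<lambda>n. rep_L2 (X (r n)) x) \<longlonglongrightarrow> rep_L2 u x"
  shows "u \<in> L2_on \<Omega>"
proof -
  have "AE x in lborel. \<forall>n. x \<notin> \<Omega> \<longrightarrow> rep_L2 (X (r n)) x = 0"
    using X by (subst AE_all_countable) (auto simp: L2_on_def)
  then have "AE x in lborel. x \<notin> \<Omega> \<longrightarrow> rep_L2 u x = 0"
    using lim by eventually_elim (auto simp: LIMSEQ_const_iff)
  then show ?thesis by (simp add: L2_on_def)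
qed

lemma subspace_L2_on: "subspace (L2_on \<Omega>)"
proof (rule subspaceI)
  show "0 \<in> L2_on \<Omega>" using rep_L2_zero unfolding L2_on_def mem_Collect_eq by eventually_elim simp
  show "u + v \<in> L2_on \<Omega>" if "u \<in> L2_on \<Omega>" "v \<in> L2_on \<Omega>" for u v
    using that rep_L2_add[of u v] unfolding L2_on_def mem_Collect_eq by eventually_elim simp
  show "c *\<^sub>R u \<in> L2_on \<Omega>" if "u \<in> L2_on \<Omega>" for u c
    using that rep_L2_scale[of c u] unfolding L2_on_def mem_Collect_eq by eventually_elim simp
qed

lemma hilbert_L2_on: "hilbert_subspace (L2_on \<Omega>)"
proof
  show "subspace (L2_on \<Omega>)" by (rule subspace_L2_on)
  show "uniform_space_class.complete (L2_on \<Omega>)"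
  proof (rule completeI)
    fix X assume X: "\<forall>n. X n \<in> L2_on \<Omega>" "Cauchy X"
    obtain u r where "X \<longlonglongrightarrow> u" "AE x in lborel. (\<lambda>n. rep_L2 (X (r n)) x) \<longlonglongrightarrow> rep_L2 u x"
      using L2_Cauchy_limit[OF X(2)] by blast
    then show "\<exists>u\<in>L2_on \<Omega>. X \<longlonglongrightarrow> u" using L2_on_limit[of X \<Omega> r u] X(1) by blast
  qed
qed

section \<open>The Gagliardo form and its completeness\<close>

definition gag :: "real \<Rightarrow> 'a::euclidean_space L2 \<Rightarrow> 'a \<times> 'a \<Rightarrow> real" where
  "gag s u z = (rep_L2 u (fst z) - rep_L2 u (snd z)) * sqrt (gagliardo_kernel s (fst z) (snd z))"

abbreviation "lborel2 \<equiv> (lborel :: 'a::euclidean_space measure) \<Otimes>\<^sub>M (lborel :: 'a measure)"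

lemma gag_measurable[measurable]: "gag s (u :: 'a::euclidean_space L2) \<in> borel_measurable lborel2"
  unfolding gag_def[abs_def] gagliardo_kernel_def by measurable

lemma gagliardo_kernel_nonneg: "0 \<le> gagliardo_kernel s x y"
  by (simp add: gagliardo_kernel_def)

lemma gag_mult: "gag s u (x, y) * gag s v (x, y) =
    (rep_L2 u x - rep_L2 u y) * (rep_L2 v x - rep_L2 v y) * gagliardo_kernel s x y"
proof -
  have "sqrt (gagliardo_kernel s x y) * sqrt (gagliardo_kernel s x y) = gagliardo_kernel s x y"
    using gagliardo_kernel_nonneg[of s x y] by simp
  then show ?thesis by (simp add: gag_def mult.left_commute mult.assoc)
qed

lemma Hs_iff: "u \<in> Hs s \<longleftrightarrow> integrable lborel2 (\<lambda>z. (gag s u z)\<^sup>2)"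
proof -
  have "(\<lambda>(x, y). (rep_L2 u x - rep_L2 u y)\<^sup>2 * gagliardo_kernel s x y) = (\<lambda>z. (gag s u z)\<^sup>2)"
    using gag_mult[of s u _ _ u] by (auto simp: fun_eq_iff power2_eq_square)
  then show ?thesis by (simp add: Hs_def)
qed

text \<open>An exceptional null set in one variable becomes two null cylinders in the product, so
  properties of representatives hold at both points of the double integral.\<close>

lemma AE_lborel2:
  assumes "AE x in (lborel :: 'a::euclidean_space measure). P x"
  shows "AE z in (lborel2 :: ('a \<times> 'a) measure). P (fst z) \<and> P (snd z)"
proof -
  from assms show ?thesis
  proof (rule AE_E3)
    fix N
    assume N': "\<And>x. x \<in> space lborel - N \<Longrightarrow> P x" and N: "N \<in> null_sets (lborel :: 'a measure)"
    have "N \<times> UNIV \<in> null_sets (lborel2 :: ('a \<times> 'a) measure)"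
      by (rule lborel.times_in_null_sets1[OF N]) simp
    moreover have "UNIV \<times> N \<in> null_sets (lborel2 :: ('a \<times> 'a) measure)"
      by (rule lborel.times_in_null_sets2[OF _ N]) simp
    ultimately have "N \<times> UNIV \<union> UNIV \<times> N \<in> null_sets (lborel2 :: ('a \<times> 'a) measure)" by (rule null_sets.Un)
    then show ?thesis by (rule AE_I') (use N' in force)
  qed
qed

lemma gag_add: "AE z in lborel2. gag s (u + v) z = gag s u z + gag s v z"
  using AE_lborel2[OF rep_L2_add[of u v]] by eventually_elim (simp add: gag_def algebra_simps)

lemma gag_diff: "AE z in lborel2. gag s (u - v) z = gag s u z - gag s v z"
  using AE_lborel2[OF rep_L2_diff[of u v]] by eventually_elim (simp add: gag_def left_diff_distrib)

lemma gag_scale: "AE z in lborel2. gag s (c *\<^sub>R u) z = c * gag s u z"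
  using AE_lborel2[OF rep_L2_scale[of c u]] by eventually_elim (simp add: gag_def algebra_simps)

lemma gag_zero: "AE z in lborel2. gag s 0 z = 0"
  using AE_lborel2[OF rep_L2_zero] by eventually_elim (simp add: gag_def)

lemma integrable_mult_of_squares:
  fixes f g :: "'a \<Rightarrow> real"
  assumes "f \<in> borel_measurable M" "g \<in> borel_measurable M"
    and "integrable M (\<lambda>x. (f x)\<^sup>2)" "integrable M (\<lambda>x. (g x)\<^sup>2)"
  shows "integrable M (\<lambda>x. f x * g x)"
proof (rule Bochner_Integration.integrable_bound)
  show "integrable M (\<lambda>x. (f x)\<^sup>2 + (g x)\<^sup>2)" using assms by simp
  show "AE x in M. norm (f x * g x) \<le> norm ((f x)\<^sup>2 + (g x)\<^sup>2)"
  proof (rule AE_I2)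
    fix x
    have "2 * \<bar>f x * g x\<bar> \<le> (f x)\<^sup>2 + (g x)\<^sup>2"
      using sum_squares_bound[of "\<bar>f x\<bar>" "\<bar>g x\<bar>"] by (simp add: abs_mult mult.assoc)
    then show "norm (f x * g x) \<le> norm ((f x)\<^sup>2 + (g x)\<^sup>2)" by simp
  qed
qed (use assms in simp)

lemma integrable_gag_mult: "u \<in> Hs s \<Longrightarrow> v \<in> Hs s \<Longrightarrow> integrable lborel2 (\<lambda>z. gag s u z * gag s v z)"
  unfolding Hs_iff by (intro integrable_mult_of_squares) auto

lemma Hs_add:
  assumes u: "u \<in> Hs s" and v: "v \<in> Hs s" shows "u + v \<in> Hs s"
proof -
  have "integrable lborel2 (\<lambda>z. (gag s u z + gag s v z)\<^sup>2)"
    using u v integrable_gag_mult[OF u v] by (simp add: Hs_iff power2_sum mult.assoc)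
  then show ?thesis unfolding Hs_iff
  proof (rule integrable_cong_AE_imp)
    show "AE z in lborel2. (gag s u z + gag s v z)\<^sup>2 = (gag s (u + v) z)\<^sup>2"
      using gag_add[of s u v] by eventually_elim simp
  qed simp
qed

lemma Hs_scale:
  assumes u: "u \<in> Hs s" shows "c *\<^sub>R u \<in> Hs s"
proof -
  have "integrable lborel2 (\<lambda>z. (c * gag s u z)\<^sup>2)"
    using u by (simp add: Hs_iff power_mult_distrib)
  then show ?thesis unfolding Hs_iff
  proof (rule integrable_cong_AE_imp)
    show "AE z in lborel2. (c * gag s u z)\<^sup>2 = (gag s (c *\<^sub>R u) z)\<^sup>2"
      using gag_scale[of s c u] by eventually_elim simp
  qed simp
qed

lemma Hs_zero: "0 \<in> Hs s"
proof -
  have "integrable lborel2 (\<lambda>z. 0 :: real)" by simp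
  then show ?thesis unfolding Hs_iff
  proof (rule integrable_cong_AE_imp)
    show "AE z in lborel2. 0 = (gag s 0 z)\<^sup>2"
      using gag_zero[of s] by eventually_elim simp
  qed simp
qed

lemma Hs0_iff: "u \<in> Hs0 \<Omega> s \<longleftrightarrow> u \<in> Hs s \<and> u \<in> L2_on \<Omega>"
  by (simp add: Hs0_def L2_on_def)

lemma frac_const_pos: "0 < s \<Longrightarrow> s < 1 \<Longrightarrow> 0 < frac_const N s"
  unfolding frac_const_def by (intro divide_pos_pos mult_pos_pos Gamma_real_pos) auto

text \<open>As \<open>u\<close> vanishes outside \<Omega>, the integral over \<Omega> is the full
  inner product. With the square root of the kernel inside \<open>gag\<close>, the second part is an
  inner product of square integrable functions on the product space.\<close>

lemma frac_form_eq:
  fixes u v :: "'a::euclidean_space L2"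
  assumes "\<Omega> \<in> sets borel" "u \<in> L2_on \<Omega>"
  shows "frac_form \<Omega> s u v = u \<bullet> v + frac_const DIM('a) s / 2 * (\<integral>z. gag s u z * gag s v z \<partial>lborel2)"
proof -
  have "(LINT x:\<Omega>|lborel. rep_L2 u x * rep_L2 v x) = u \<bullet> v"
    unfolding set_lebesgue_integral_def inner_L2.rep_eq
    using assms by (intro integral_cong_AE) (auto simp: L2_on_def elim!: eventually_mono simp: indicator_def)
  moreover have "(\<lambda>(x, y). (rep_L2 u x - rep_L2 u y) * (rep_L2 v x - rep_L2 v y) * gagliardo_kernel s x y) =
      (\<lambda>z. gag s u z * gag s v z)"
    using gag_mult[of s u _ _ v] by (auto simp: fun_eq_iff)
  ultimately show ?thesis by (simp add: frac_form_def)
qed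

text \<open>Lower semicontinuity by Fatou with \<open>v\<close> held fixed. In the completeness
  proof \<open>v\<close> is a late member of the Cauchy sequence.\<close>

lemma gag_integral_le_of_limit:
  fixes u :: "'a::euclidean_space L2" and X :: "nat \<Rightarrow> 'a L2"
  assumes lim: "AE x in lborel. (\<lambda>m. rep_L2 (X m) x) \<longlonglongrightarrow> rep_L2 u x"
    and v: "\<And>m. X m - v \<in> Hs s" and le: "\<And>m. m \<ge> N \<Longrightarrow> (\<integral>z. (gag s (X m - v) z)\<^sup>2 \<partial>lborel2) \<le> e"
  shows "u - v \<in> Hs s" "(\<integral>z. (gag s (u - v) z)\<^sup>2 \<partial>lborel2) \<le> e"
proof -
  have "AE z in lborel2. \<forall>m. gag s (X m - v) z = gag s (X m) z - gag s v z"
    unfolding AE_all_countable using gag_diff by blast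
  then have lim2: "AE z in lborel2. (\<lambda>m. (gag s (X m - v) z)\<^sup>2) \<longlonglongrightarrow> (gag s (u - v) z)\<^sup>2"
    using gag_diff[of s u v] AE_lborel2[OF lim]
  proof eventually_elim
    case (elim z)
    have "(\<lambda>m. gag s (X m) z) \<longlonglongrightarrow> gag s u z"
      unfolding gag_def using elim(3) by (intro tendsto_intros) auto
    then show ?case unfolding elim(2) unfolding elim(1)[rule_format] by (intro tendsto_power tendsto_diff tendsto_const)
  qed
  have nn: "(\<integral>\<^sup>+z. ennreal ((gag s (u - v) z)\<^sup>2) \<partial>lborel2) \<le> ennreal e"
  proof (rule nn_integral_limit_le[OF _ lim2, where N=N])
    fix m assume "m \<ge> N"
    have "(\<integral>\<^sup>+z. ennreal ((gag s (X m - v) z)\<^sup>2) \<partial>lborel2) = ennreal (\<integral>z. (gag s (X m - v) z)\<^sup>2 \<partial>lborel2)"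
      using v[of m] unfolding Hs_iff by (intro nn_integral_eq_integral) auto
    then show "(\<integral>\<^sup>+z. ennreal ((gag s (X m - v) z)\<^sup>2) \<partial>lborel2) \<le> ennreal e"
      using le[OF \<open>m \<ge> N\<close>] by (simp add: ennreal_leI)
  qed measurable
  show uv: "u - v \<in> Hs s"
    unfolding Hs_iff using nn by (intro integrableI_bounded) (auto intro: le_less_trans)
  \<comment> \<open>Since \<open>ennreal\<close> sends negative reals to 0, the sign of
    \<open>e\<close> is needed to return to a real inequality.\<close>
  have "0 \<le> (\<integral>z. (gag s (X N - v) z)\<^sup>2 \<partial>lborel2)" by simp
  then have "0 \<le> e" using le[of N] by linarith
  have "ennreal (\<integral>z. (gag s (u - v) z)\<^sup>2 \<partial>lborel2) \<le> ennreal e"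
    using nn uv unfolding Hs_iff by (subst nn_integral_eq_integral[symmetric]) auto
  then show "(\<integral>z. (gag s (u - v) z)\<^sup>2 \<partial>lborel2) \<le> e" using \<open>0 \<le> e\<close> by simp
qed

lemma form_space_Hs0:
  fixes \<Omega> :: "'a::euclidean_space set"
  assumes \<Omega>: "\<Omega> \<in> sets borel" and s: "0 < s" "s < 1"
  shows "form_space (Hs0 \<Omega> s) (frac_form \<Omega> s)"
proof
  define c where "c = frac_const DIM('a) s / 2"
  have c: "0 < c" using frac_const_pos[OF s] by (simp add: c_def)
  note eq = frac_form_eq[OF \<Omega>, where s=s, folded c_def]
  note sub = subspace_L2_on[of \<Omega>]
  show "subspace (Hs0 \<Omega> s)"
    using sub by (intro subspaceI)
      (simp_all add: Hs0_iff Hs_zero Hs_add Hs_scale subspace_0 subspace_add subspace_scale)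
  fix u v w :: "'a L2" and r :: real
  assume u: "u \<in> Hs0 \<Omega> s" and w: "w \<in> Hs0 \<Omega> s"
  show "frac_form \<Omega> s (u + v) w = frac_form \<Omega> s u w + frac_form \<Omega> s v w" if v: "v \<in> Hs0 \<Omega> s"
  proof -
    have "(\<integral>z. gag s (u + v) z * gag s w z \<partial>lborel2) = (\<integral>z. gag s u z * gag s w z + gag s v z * gag s w z \<partial>lborel2)"
      by (rule integral_cong_AE)
        (use gag_add[of s u v] in \<open>simp_all, eventually_elim, simp add: distrib_right\<close>)
    also have "\<dots> = (\<integral>z. gag s u z * gag s w z \<partial>lborel2) + (\<integral>z. gag s v z * gag s w z \<partial>lborel2)"
      using u v w by (intro Bochner_Integration.integral_add integrable_gag_mult) (simp_all add: Hs0_iff)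
    finally show ?thesis
      using u v w sub by (simp add: eq Hs0_iff subspace_add inner_add_left distrib_left)
  qed
  show "frac_form \<Omega> s (r *\<^sub>R u) w = r * frac_form \<Omega> s u w"
  proof -
    have "(\<integral>z. gag s (r *\<^sub>R u) z * gag s w z \<partial>lborel2) = (\<integral>z. r * (gag s u z * gag s w z) \<partial>lborel2)"
      by (rule integral_cong_AE)
        (use gag_scale[of s r u] in \<open>simp_all, eventually_elim, simp\<close>)
    then show ?thesis
      using u w sub by (simp add: eq Hs0_iff subspace_scale distrib_left)
  qed
  show "frac_form \<Omega> s u w = frac_form \<Omega> s w u"
    using u w by (simp add: eq Hs0_iff inner_commute mult.commute)
  show "0 \<le> frac_form \<Omega> s u u"
    using u c by (simp add: eq Hs0_iff)
next
  fix X :: "nat \<Rightarrow> 'a L2"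
  define c where "c = frac_const DIM('a) s / 2"
  have c: "0 < c" using frac_const_pos[OF s] by (simp add: c_def)
  note eq = frac_form_eq[OF \<Omega>, where s=s, folded c_def]
  note sub = subspace_L2_on[of \<Omega>]
  have Hs_diff: "u - v \<in> Hs s" if "u \<in> Hs s" "v \<in> Hs s" for u v :: "'a L2"
    using Hs_add[OF that(1) Hs_scale[OF that(2), of "-1"]] by simp
  assume X: "\<And>n. X n \<in> Hs0 \<Omega> s"
    and cauchy: "\<And>e. 0 < e \<Longrightarrow> \<exists>N. \<forall>m\<ge>N. \<forall>n\<ge>N. frac_form \<Omega> s (X m - X n) (X m - X n) < e"
  have form_sq: "frac_form \<Omega> s v v = (norm v)\<^sup>2 + c * (\<integral>z. (gag s v z)\<^sup>2 \<partial>lborel2)" if "v \<in> L2_on \<Omega>" for v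
    unfolding eq[OF that] power2_norm_eq_inner by (simp only: power2_eq_square)
  have gag_nn: "0 \<le> (\<integral>z. (gag s v z)\<^sup>2 \<partial>lborel2)" for v :: "'a L2" by simp
  have XL: "X n \<in> L2_on \<Omega>" and XH: "X n \<in> Hs s" for n using X[of n] by (auto simp: Hs0_iff)
  have XD: "X m - X n \<in> L2_on \<Omega>" for m n using sub XL by (intro subspace_diff)
  have "Cauchy X"
  proof (rule metric_CauchyI)
    fix e :: real assume e: "0 < e"
    then obtain N where N: "\<forall>m\<ge>N. \<forall>n\<ge>N. frac_form \<Omega> s (X m - X n) (X m - X n) < e\<^sup>2"
      using cauchy[of "e\<^sup>2"] by auto
    have "dist (X m) (X n) < e" if "m \<ge> N" "n \<ge> N" for m n
    proof -
      have "(norm (X m - X n))\<^sup>2 + c * (\<integral>z. (gag s (X m - X n) z)\<^sup>2 \<partial>lborel2) < e\<^sup>2"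
        using N that by (simp flip: form_sq[OF XD])
      moreover have "0 \<le> c * (\<integral>z. (gag s (X m - X n) z)\<^sup>2 \<partial>lborel2)" using c by simp
      ultimately have "(norm (X m - X n))\<^sup>2 < e\<^sup>2" by linarith
      then show ?thesis unfolding dist_norm by (rule power2_less_imp_less) (use e in simp)
    qed
    then show "\<exists>N. \<forall>m\<ge>N. \<forall>n\<ge>N. dist (X m) (X n) < e" by blast
  qed
  then obtain u r where r: "strict_mono r" and Xu: "X \<longlonglongrightarrow> u"
    and lim: "AE x in lborel. (\<lambda>n. rep_L2 (X (r n)) x) \<longlonglongrightarrow> rep_L2 u x"
    using L2_Cauchy_limit by blast
  have uL: "u \<in> L2_on \<Omega>" using XL lim by (rule L2_on_limit[of X \<Omega> r])
  \<comment> \<open>Of the two indices in the Cauchy condition, one is sent to infinity along the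
    subsequence and the other stays fixed. The index \<open>r m\<close> is late enough because
    \<open>m \<le> r m\<close>.\<close>
  have small: "\<exists>N. \<forall>n\<ge>N. u - X n \<in> Hs s \<and> (\<integral>z. (gag s (u - X n) z)\<^sup>2 \<partial>lborel2) \<le> e" if e: "0 < e" for e
  proof -
    obtain N where N: "\<forall>m\<ge>N. \<forall>n\<ge>N. frac_form \<Omega> s (X m - X n) (X m - X n) < c * e"
      using cauchy[of "c * e"] c e by auto
    have le: "(\<integral>z. (gag s (X m - X n) z)\<^sup>2 \<partial>lborel2) \<le> e" if "m \<ge> N" "n \<ge> N" for m n
    proof -
      have "(norm (X m - X n))\<^sup>2 + c * (\<integral>z. (gag s (X m - X n) z)\<^sup>2 \<partial>lborel2) < c * e"
        using N that by (simp flip: form_sq[OF XD])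
      moreover have "0 \<le> (norm (X m - X n))\<^sup>2" by simp
      ultimately have "c * (\<integral>z. (gag s (X m - X n) z)\<^sup>2 \<partial>lborel2) \<le> c * e" by linarith
      then show ?thesis using c by simp
    qed
    have "u - X n \<in> Hs s \<and> (\<integral>z. (gag s (u - X n) z)\<^sup>2 \<partial>lborel2) \<le> e" if n: "n \<ge> N" for n
    proof -
      have "(\<integral>z. (gag s (X (r m) - X n) z)\<^sup>2 \<partial>lborel2) \<le> e" if "m \<ge> N" for m
        using le[OF order_trans[OF that seq_suble[OF r]] n] .
      then show ?thesis
        using gag_integral_le_of_limit[of "\<lambda>m. X (r m)" u "X n" s N e, OF lim] Hs_diff[OF XH XH] by blast
    qed
    then show ?thesis by blast
  qed
  have uH: "u \<in> Hs s"
  proof -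
    obtain N where "u - X N \<in> Hs s" using small[of 1] by auto
    from Hs_add[OF this XH[of N]] show ?thesis by simp
  qed
  have uX: "u - X n \<in> L2_on \<Omega>" for n using sub uL XL by (intro subspace_diff)
  have sym: "frac_form \<Omega> s (X n - u) (X n - u) = frac_form \<Omega> s (u - X n) (u - X n)" for n
  proof -
    have "(\<integral>z. (gag s (X n - u) z)\<^sup>2 \<partial>lborel2) = (\<integral>z. (gag s (u - X n) z)\<^sup>2 \<partial>lborel2)"
      by (rule integral_cong_AE)
        (use gag_diff[of s u "X n"] gag_diff[of s "X n" u] in
          \<open>simp_all, eventually_elim, simp add: power2_commute\<close>)
    then show ?thesis
      using subspace_diff[OF sub XL uL] uX by (simp add: form_sq norm_minus_commute)
  qed
  have "(\<lambda>n. \<integral>z. (gag s (u - X n) z)\<^sup>2 \<partial>lborel2) \<longlonglongrightarrow> 0"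
  proof (rule LIMSEQ_I)
    fix e :: real assume "0 < e"
    then obtain N where "\<forall>n\<ge>N. (\<integral>z. (gag s (u - X n) z)\<^sup>2 \<partial>lborel2) \<le> e / 2"
      using small[of "e / 2"] by auto
    then show "\<exists>N. \<forall>n\<ge>N. norm ((\<integral>z. (gag s (u - X n) z)\<^sup>2 \<partial>lborel2) - 0) < e"
      using \<open>0 < e\<close> by (intro exI[of _ N]) force
  qed
  moreover have "(\<lambda>n. (norm (u - X n))\<^sup>2) \<longlonglongrightarrow> 0"
    using tendsto_power[OF tendsto_norm[OF tendsto_diff[OF tendsto_const[of u] Xu]], of 2] by simp
  ultimately have "(\<lambda>n. (norm (u - X n))\<^sup>2 + c * (\<integral>z. (gag s (u - X n) z)\<^sup>2 \<partial>lborel2)) \<longlonglongrightarrow> 0 + c * 0"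
    by (intro tendsto_add tendsto_mult tendsto_const)
  then have "(\<lambda>n. frac_form \<Omega> s (X n - u) (X n - u)) \<longlonglongrightarrow> 0"
    unfolding sym form_sq[OF uX] by simp
  then show "\<exists>l\<in>Hs0 \<Omega> s. (\<lambda>n. frac_form \<Omega> s (X n - l) (X n - l)) \<longlonglongrightarrow> 0"
    using uH uL by (intro bexI[of _ u]) (simp_all add: Hs0_iff)
qed

lemma form_operator_Hs0:
  assumes \<Omega>: "\<Omega> \<in> sets borel" and s: "0 < s" "s < 1"
  shows "form_operator (L2_on \<Omega>) (Hs0 \<Omega> s) (frac_form \<Omega> s)"
proof -
  interpret V: form_space "Hs0 \<Omega> s" "frac_form \<Omega> s" by (rule form_space_Hs0[OF assms])
  interpret hilbert_subspace "L2_on \<Omega>" by (rule hilbert_L2_on)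
  show ?thesis
  proof
    show "Hs0 \<Omega> s \<subseteq> L2_on \<Omega>" by (auto simp: Hs0_iff)
    fix v assume "v \<in> Hs0 \<Omega> s"
    then show "v \<bullet> v \<le> frac_form \<Omega> s v v"
      using less_imp_le[OF frac_const_pos[OF s]] by (simp add: Hs0_iff frac_form_eq[OF \<Omega>])
  qed
qed

section \<open>The rate for the fractional inverse problem\<close>

theorem corollary3p5:
  fixes \<Omega> :: "(real ^ 'n::finite) set" and s \<beta> :: real
    and K :: "(real ^ 'n) L2 \<Rightarrow> (real ^ 'n) L2" and u\<^sub>0 w :: "(real ^ 'n) L2"
  assumes "bounded_lipschitz_domain \<Omega>"
    and "0 < s" and "s < 1"
    and "bounded_linear_Hs0_L2 \<Omega> s K"
    and "u\<^sub>0 \<in> Hs0 \<Omega> s"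
    and "0 < \<beta>" and "\<beta> \<le> 1"
    and "w \<in> L2_on \<Omega>"
    and "source_condition \<Omega> s K u\<^sub>0 \<beta> w"
  shows
    "(\<forall>(M :: 'w measure) \<delta> \<eta>. 0 < \<delta> \<and> L2_noise M \<Omega> \<delta> \<eta> \<longrightarrow>
        (\<forall>\<omega>\<in>space M. \<exists>!u. is_tikhonov_min \<Omega> s K (alpha_opt \<beta> \<delta>) (K u\<^sub>0 + \<eta> \<omega>) u) \<and>
        integrable M (\<lambda>\<omega>. sq_error \<Omega> s K u\<^sub>0 (alpha_opt \<beta> \<delta>) (\<eta> \<omega>)) \<and>
        (\<integral>\<omega>. sq_error \<Omega> s K u\<^sub>0 (alpha_opt \<beta> \<delta>) (\<eta> \<omega>) \<partial>M)
          \<le> C_opt \<beta> w * \<delta> powr (4 * \<beta> / (2 * \<beta> + 1)))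
     \<and>
     (\<forall>(M :: real \<Rightarrow> 'w measure) \<eta>. (\<forall>\<delta>>0. L2_noise (M \<delta>) \<Omega> \<delta> (\<eta> \<delta>)) \<longrightarrow>
        (\<lambda>\<delta>. \<integral>\<omega>. sq_error \<Omega> s K u\<^sub>0 (alpha_opt \<beta> \<delta>) (\<eta> \<delta> \<omega>) \<partial>M \<delta>)
          \<in> O[at_right 0](\<lambda>\<delta>. \<delta> powr (4 * \<beta> / (2 * \<beta> + 1))))"
    (is "?bound \<and> ?order")
proof -
  let ?V = "Hs0 \<Omega> s" and ?a = "frac_form \<Omega> s" and ?r = "\<lambda>\<delta>. \<delta> powr (4 * \<beta> / (2 * \<beta> + 1))"
  have \<Omega>: "\<Omega> \<in> sets borel" using assms(1) by (simp add: bounded_lipschitz_domain_def)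
  obtain C where K: "\<And>u. u \<in> ?V \<Longrightarrow> K u \<in> L2_on \<Omega>"
    "\<And>u v. u \<in> ?V \<Longrightarrow> v \<in> ?V \<Longrightarrow> K (u + v) = K u + K v"
    "\<And>u c. u \<in> ?V \<Longrightarrow> K (c *\<^sub>R u) = c *\<^sub>R K u"
    "\<And>u. u \<in> ?V \<Longrightarrow> norm (K u) \<le> C * sqrt (?a u u)"
    using assms(4) unfolding bounded_linear_Hs0_L2_def Hs0_norm_def by blast
  have main: "(\<forall>\<omega>\<in>space M. \<exists>!u. is_tikhonov_min \<Omega> s K (alpha_opt \<beta> \<delta>) (K u\<^sub>0 + \<eta> \<omega>) u) \<and>
      integrable M (\<lambda>\<omega>. sq_error \<Omega> s K u\<^sub>0 (alpha_opt \<beta> \<delta>) (\<eta> \<omega>)) \<and>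
      (\<integral>\<omega>. sq_error \<Omega> s K u\<^sub>0 (alpha_opt \<beta> \<delta>) (\<eta> \<omega>) \<partial>M) \<le> C_opt \<beta> w * ?r \<delta>"
    if \<delta>: "0 < \<delta>" and noise: "L2_noise M \<Omega> \<delta> \<eta>" for M :: "'w measure" and \<delta> \<eta>
  proof -
    define \<alpha> where "\<alpha> = alpha_opt \<beta> \<delta>"
    have \<alpha>: "0 < \<alpha>" using \<delta> by (simp add: \<alpha>_def alpha_opt_def)
    interpret F: form_operator "L2_on \<Omega>" ?V ?a by (rule form_operator_Hs0[OF \<Omega> assms(2,3)])
    interpret T: tikhonov "L2_on \<Omega>" ?V ?a K \<alpha> C
      by unfold_locales (use K \<alpha> in auto)
    \<comment> \<open>On \<open>?V\<close> the form is nonnegative, so squaring undoes the root in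
      \<open>Hs0_norm\<close>; \<open>is_arg_min\<close> compares values on \<open>?V\<close>
      only.\<close>
    have min_iff: "is_tikhonov_min \<Omega> s K \<alpha> y u \<longleftrightarrow> u = T.sol y" for y u
    proof -
      have "tikhonov_functional \<Omega> s K \<alpha> y v = T.J y v" if "v \<in> ?V" for v
        using F.V.nonneg[OF that] by (simp add: tikhonov_functional_def T.J_def Hs0_norm_def)
      then have "is_tikhonov_min \<Omega> s K \<alpha> y u \<longleftrightarrow> is_arg_min (T.J y) (\<lambda>v. v \<in> ?V) u"
        unfolding is_tikhonov_min_def is_arg_min_def by metis
      then show ?thesis by (simp only: T.J_minimizer)
    qed
    have tmin: "tikhonov_min \<Omega> s K \<alpha> y = T.sol y" for y
      by (simp add: tikhonov_min_def min_iff)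
    have err: "sq_error \<Omega> s K u\<^sub>0 \<alpha> e = ?a (T.sol (K u\<^sub>0 + e) - u\<^sub>0) (T.sol (K u\<^sub>0 + e) - u\<^sub>0)" for e
      using F.V.nonneg[of "T.sol (K u\<^sub>0 + e) - u\<^sub>0"] T.sol(1) assms(5)
      by (simp add: sq_error_def tmin Hs0_norm_def)
    obtain z where z: "(u\<^sub>0, z) \<in> op_power (L2_on \<Omega>) (form_op (L2_on \<Omega>) ?V ?a) (1 / 2)"
      "(w, z) \<in> op_power (L2_on \<Omega>) (T.KA O adjoint_op (L2_on \<Omega>) T.KA) \<beta>"
      using assms(9) unfolding source_condition_def BstarB_op_def B_op_def frac_op_def T.KA_def by blast
    note bias = T.bias_bound[OF assms(5) z assms(6,7)]
    have n: "prob_space M" "\<eta> \<in> borel_measurable M" "integrable M (\<lambda>\<omega>. (norm (\<eta> \<omega>))\<^sup>2)"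
      "(\<integral>\<omega>. (norm (\<eta> \<omega>))\<^sup>2 \<partial>M) \<le> \<delta>\<^sup>2"
      using noise by (auto simp: L2_noise_def)
    note mean = T.mean_error[OF n assms(5) bias]
    \<comment> \<open>Balance of noise and bias: with this \<alpha>, both \<delta>^2 / \<alpha> and
      \<alpha>^(2 \<beta>) equal the claimed power of \<delta>.\<close>
    have "\<delta>\<^sup>2 / \<alpha> = ?r \<delta>"
    proof -
      have "\<delta>\<^sup>2 / \<alpha> = \<delta> powr (2 - 2 / (2 * \<beta> + 1))"
        using \<delta> by (simp add: \<alpha>_def alpha_opt_def powr_diff powr_numeral)
      also have "2 - 2 / (2 * \<beta> + 1) = 4 * \<beta> / (2 * \<beta> + 1)"
        using assms(6) by (simp add: field_simps)
      finally show ?thesis .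
    qed
    moreover have "(\<alpha> powr \<beta>)\<^sup>2 = ?r \<delta>"
    proof -
      have "(\<alpha> powr \<beta>)\<^sup>2 = \<delta> powr (2 / (2 * \<beta> + 1) * \<beta> * 2)"
        using \<delta> by (simp add: \<alpha>_def alpha_opt_def powr_powr power2_eq_square flip: powr_add)
      then show ?thesis by (simp add: field_simps)
    qed
    moreover have "\<delta>\<^sup>2 / (2 * \<alpha>) = \<delta>\<^sup>2 / \<alpha> / 2" by simp
    ultimately have "\<delta>\<^sup>2 / (2 * \<alpha>) + 2 * ((c_const \<beta> * \<alpha> powr \<beta>)\<^sup>2 * (w \<bullet> w)) =
        ?r \<delta> / 2 + 2 * ((c_const \<beta>)\<^sup>2 * ?r \<delta> * (norm w)\<^sup>2)"
      by (simp only: power_mult_distrib power2_norm_eq_inner)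
    also have "\<dots> = C_opt \<beta> w * ?r \<delta>"
      by (simp add: C_opt_def distrib_right)
    finally have "\<delta>\<^sup>2 / (2 * \<alpha>) + 2 * ((c_const \<beta> * \<alpha> powr \<beta>)\<^sup>2 * (w \<bullet> w)) = C_opt \<beta> w * ?r \<delta>" .
    then show ?thesis
      using mean min_iff unfolding \<alpha>_def[symmetric] err by simp
  qed
  have ?bound using main by blast
  \<comment> \<open>The noise model may vary with \<delta>; the constant
    \<open>C_opt \<beta> w\<close> depends on neither \<open>M\<close> nor \<eta>, so one constant
    serves all \<delta>.\<close>
  moreover have ?order
  proof (intro allI impI)
    fix M :: "real \<Rightarrow> 'w measure" and \<eta>
    assume noise: "\<forall>\<delta>>0. L2_noise (M \<delta>) \<Omega> \<delta> (\<eta> \<delta>)"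
    show "(\<lambda>\<delta>. \<integral>\<omega>. sq_error \<Omega> s K u\<^sub>0 (alpha_opt \<beta> \<delta>) (\<eta> \<delta> \<omega>) \<partial>M \<delta>) \<in> O[at_right 0](?r)"
    proof (rule bigoI)
      have "norm (\<integral>\<omega>. sq_error \<Omega> s K u\<^sub>0 (alpha_opt \<beta> \<delta>) (\<eta> \<delta> \<omega>) \<partial>M \<delta>) \<le> C_opt \<beta> w * norm (?r \<delta>)"
        if "0 < \<delta>" for \<delta>
      proof -
        have "0 \<le> (\<integral>\<omega>. sq_error \<Omega> s K u\<^sub>0 (alpha_opt \<beta> \<delta>) (\<eta> \<delta> \<omega>) \<partial>M \<delta>)"
          by (intro Bochner_Integration.integral_nonneg) (simp add: sq_error_def)
        then show ?thesis using main[OF that] noise that by simp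
      qed
      then show "\<forall>\<^sub>F \<delta> in at_right 0. norm (\<integral>\<omega>. sq_error \<Omega> s K u\<^sub>0 (alpha_opt \<beta> \<delta>) (\<eta> \<delta> \<omega>) \<partial>M \<delta>)
          \<le> C_opt \<beta> w * norm (?r \<delta>)"
        by (auto simp: eventually_at_right_less intro: eventually_mono[OF eventually_at_right_less])
    qed
  qed
  ultimately show ?thesis by blast
qed

end
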